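(* Consider the mixed membership model described in the context, and assume Conditions (C1) and (C2) hold. Fix two distinct nodes $i\neq j$. (i) Under the null hypothesis $H_0:\boldsymbol\pi_i=\boldsymbol\pi_j$, if in addition Condition (C3) holds, then $T_{ij}\to\chi^2_K$ in distribution as $n\to\infty$. (ii) Under the alternative $\boldsymbol\pi_i\neq\boldsymbol\pi_j$ with $\sqrt{n\theta}\,\|\boldsymbol\pi_i-\boldsymbol\pi_j\|\to\infty$, for every arbitrarily large constant $C>0$, $P(T_{ij}>C)\to1$ as $n\to\infty$. Moreover, if Condition (C3) holds, $\|\boldsymbol\pi_i-\boldsymbol\pi_j\|$ is of the same order as $1/\sqrt{n\theta}$, and $[\mathbf V(i)-\mathbf V(j)]^T\boldsymbol\Sigma_1^{-1}[\mathbf V(i)-\mathbf V(j)]\to\mu$ for some constant $\mu$, then $T_{ij}\to\chi^2_K(\mu)$ in distribution, the noncentral chi-square distribution with $K$ degrees of freedom and noncentrality (mean parameter) $\mu$.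
   Context: Network model: $n$ nodes, $K\ge1$ a fixed (finite) integer. A symmetric random matrix $\mathbf X^*$ has independent Bernoulli entries on and above the diagonal with $\mathbb E\mathbf X^*=\mathbf H$; the observed adjacency matrix $\mathbf X$ is either $\mathbf X^*$ or $\mathbf X^*-\mathrm{diag}(\mathbf X^* )$, and $\mathbf W=(w_{lm})=\mathbf X-\mathbf H$. Mixed membership model: $\mathbf H=\theta\boldsymbol\Pi\mathbf P\boldsymbol\Pi^T$ where $\theta=\theta_n>0$ may tend to $0$, $\boldsymbol\Pi=(\boldsymbol\pi_1,\dots,\boldsymbol\pi_n)^T\in\mathbb R^{n\times K}$ with each $\boldsymbol\pi_l$ a probability vector (nonnegative entries summing to 1), $\mathbf P=(p_{kl})\in[0,1]^{K\times K}$ nonsingular, and $\mathbf H$ of rank $K$. Write $\mathbf H=\mathbf V\mathbf D\mathbf V^T$ with $\mathbf D=\mathrm{diag}(d_1,\dots,d_K)$, $|d_1|\ge\dots\ge|d_K|>0$, $\mathbf V=(\mathbf v_1,\dots,\mathbf v_K)$ with orthonormal columns; $\mathbf V(l)$ denotes the $l$-th row. Let $\widehat d_1,\dots,\widehat d_n$ be the eigenvalues of $\mathbf X$ ordered so $|\widehat d_1|\ge\dots\ge|\widehat d_n|$ with unit eigenvectors $\widehat{\mathbf v}_1,\dots,\widehat{\mathbf v}_n$, oriented so that $\widehat{\mathbf v}_k^T\mathbf v_k\ge0$; $\widehat{\mathbf V}=(\widehat{\mathbf v}_1,\dots,\widehat{\mathbf v}_K)$. Let $\alpha_n=\{\max_{1\le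 m\le n}\sum_{l=1}^n\mathrm{var}(w_{lm})\}^{1/2}$. $\mathbf e_l$ is the $l$-th standard basis vector. Define the $K\times K$ matrix $\boldsymbol\Sigma_1=\mathrm{cov}[(\mathbf e_i-\mathbf e_j)^T\mathbf W\mathbf V\mathbf D^{-1}]$ and the statistic $T_{ij}=[\widehat{\mathbf V}(i)-\widehat{\mathbf V}(j)]^T\boldsymbol\Sigma_1^{-1}[\widehat{\mathbf V}(i)-\widehat{\mathbf V}(j)]$. Condition (C1): there is a constant $c_0>0$ with $\min\{|d_a|/|d_b|:1\le a<b\le K,\ d_a\neq-d_b\}\ge1+c_0$, and $\alpha_n\to\infty$. Condition (C2): there are constants $0<c_0,c_1<1$ with $\lambda_K(\boldsymbol\Pi^T\boldsymbol\Pi)\ge c_0n$, $\lambda_K(\mathbf P)\ge c_0$, and $\theta\ge n^{-c_1}$ ($\lambda_K$ = $K$-th largest eigenvalue). Condition (C3): all eigenvalues of $n^2\theta\boldsymbol\Sigma_1$ are bounded away from $0$ and $\infty$ as $n\to\infty$. *)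

theory Defs
  imports "HOL-Probability.Probability"
begin

(* Conventions: nodes are indexed 0..n-1, communities / eigen-indices 0..K-1.
   n x n and K x K real matrices are functions nat => nat => real with explicit bounds. *)

type_synonym sample = "nat \<times> nat \<Rightarrow> bool"

definition Hmat :: "nat \<Rightarrow> real \<Rightarrow> (nat \<Rightarrow> nat \<Rightarrow> real) \<Rightarrow> (nat \<Rightarrow> nat \<Rightarrow> real) \<Rightarrow> nat \<Rightarrow> nat \<Rightarrow> real" where
  "Hmat K theta Pm P l m = theta * (\<Sum>a<K. \<Sum>b<K. Pm l a * P a b * Pm m b)"

definition edge_pmf :: "nat \<Rightarrow> (nat \<Rightarrow> nat \<Rightarrow> real) \<Rightarrow> sample pmf" where
  "edge_pmf n H = Pi_pmf {(l, m). l \<le> m \<and> m < n} False (\<lambda>(l, m). bernoulli_pmf (H l m))"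

definition Xstar :: "sample \<Rightarrow> nat \<Rightarrow> nat \<Rightarrow> real" where
  "Xstar s l m = (if s (min l m, max l m) then 1 else 0)"

definition Xobs :: "bool \<Rightarrow> sample \<Rightarrow> nat \<Rightarrow> nat \<Rightarrow> real" where
  "Xobs loops s l m = (if \<not> loops \<and> l = m then 0 else Xstar s l m)"

definition Wmat :: "bool \<Rightarrow> (nat \<Rightarrow> nat \<Rightarrow> real) \<Rightarrow> sample \<Rightarrow> nat \<Rightarrow> nat \<Rightarrow> real" where
  "Wmat loops H s l m = Xobs loops s l m - H l m"

definition cov_pmf :: "'a pmf \<Rightarrow> ('a \<Rightarrow> real) \<Rightarrow> ('a \<Rightarrow> real) \<Rightarrow> real" where
  "cov_pmf p f g = measure_pmf.expectation p
     (\<lambda>s. (f s - measure_pmf.expectation p f) * (g s - measure_pmf.expectation p g))"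

definition alpha_n :: "bool \<Rightarrow> nat \<Rightarrow> (nat \<Rightarrow> nat \<Rightarrow> real) \<Rightarrow> real" where
  "alpha_n loops n H = sqrt (Max ((\<lambda>m. \<Sum>l<n. cov_pmf (edge_pmf n H)
        (\<lambda>s. Wmat loops H s l m) (\<lambda>s. Wmat loops H s l m)) ` {..<n}))"

text \<open>Sigma_1 = cov[(e_i - e_j)^T W V D^{-1}], a K x K matrix.\<close>
definition Sigma1 :: "bool \<Rightarrow> nat \<Rightarrow> (nat \<Rightarrow> nat \<Rightarrow> real) \<Rightarrow> (nat \<Rightarrow> nat \<Rightarrow> real) \<Rightarrow> (nat \<Rightarrow> real)
    \<Rightarrow> nat \<Rightarrow> nat \<Rightarrow> nat \<Rightarrow> nat \<Rightarrow> real" where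
  "Sigma1 loops n H V d i j a b =
     cov_pmf (edge_pmf n H)
       (\<lambda>s. \<Sum>l<n. (Wmat loops H s i l - Wmat loops H s j l) * V l a / d a)
       (\<lambda>s. \<Sum>l<n. (Wmat loops H s i l - Wmat loops H s j l) * V l b / d b)"

text \<open>(Real) eigenvalues of a K x K matrix, and the K-th largest one (= the smallest, for
  symmetric matrices, whose eigenvalues are all real).\<close>
definition is_eigval :: "nat \<Rightarrow> (nat \<Rightarrow> nat \<Rightarrow> real) \<Rightarrow> real \<Rightarrow> bool" where
  "is_eigval K A lam \<longleftrightarrow> (\<exists>v. (\<exists>k<K. v k \<noteq> 0) \<and> (\<forall>a<K. (\<Sum>b<K. A a b * v b) = lam * v a))"

definition lambda_K :: "nat \<Rightarrow> (nat \<Rightarrow> nat \<Rightarrow> real) \<Rightarrow> real" where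
  "lambda_K K A = Min {lam. is_eigval K A lam}"

text \<open>Eigen-decomposition of the rank-K matrix H: H = V D V^T, V (n x K) with orthonormal
  columns, D = diag(d_0..d_{K-1}), |d_0| >= ... >= |d_{K-1}| > 0.  V l k = k-th entry of row V(l).\<close>
definition H_eigdecomp :: "nat \<Rightarrow> nat \<Rightarrow> (nat \<Rightarrow> nat \<Rightarrow> real) \<Rightarrow> (nat \<Rightarrow> nat \<Rightarrow> real) \<Rightarrow> (nat \<Rightarrow> real) \<Rightarrow> bool" where
  "H_eigdecomp n K H V d \<longleftrightarrow>
     (\<forall>a<K. \<forall>b<K. (\<Sum>l<n. V l a * V l b) = (if a = b then 1 else 0)) \<and>
     (\<forall>l<n. \<forall>m<n. H l m = (\<Sum>k<K. V l k * d k * V m k)) \<and>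
     (\<forall>a b. a \<le> b \<and> b < K \<longrightarrow> \<bar>d b\<bar> \<le> \<bar>d a\<bar>) \<and>
     (\<forall>k<K. d k \<noteq> 0)"

text \<open>Full spectral decomposition of the symmetric n x n matrix X: eigenvalues dh_0..dh_{n-1}
  ordered by nonincreasing absolute value, with orthonormal unit eigenvectors;
  Vh k l = l-th entry of the k-th eigenvector.\<close>
definition ordered_eigdecomp :: "nat \<Rightarrow> (nat \<Rightarrow> nat \<Rightarrow> real) \<Rightarrow> (nat \<Rightarrow> nat \<Rightarrow> real) \<Rightarrow> (nat \<Rightarrow> real) \<Rightarrow> bool" where
  "ordered_eigdecomp n X Vh dh \<longleftrightarrow>
     (\<forall>a<n. \<forall>b<n. (\<Sum>l<n. Vh a l * Vh b l) = (if a = b then 1 else 0)) \<and>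
     (\<forall>k<n. \<forall>l<n. (\<Sum>m<n. X l m * Vh k m) = dh k * Vh k l) \<and>
     (\<forall>a b. a \<le> b \<and> b < n \<longrightarrow> \<bar>dh b\<bar> \<le> \<bar>dh a\<bar>)"

definition qform :: "nat \<Rightarrow> (nat \<Rightarrow> nat \<Rightarrow> real) \<Rightarrow> (nat \<Rightarrow> real) \<Rightarrow> real" where
  "qform K A x = (\<Sum>a<K. \<Sum>b<K. x a * A a b * x b)"

text \<open>Standard normal distribution and (noncentral) chi-square distribution with K degrees of
  freedom and noncentrality mu: law of sum_k (Z_k + m_k)^2, Z_k iid N(0,1), sum_k m_k^2 = mu.\<close>
definition std_normal :: "real measure" where
  "std_normal = density lborel std_normal_density"

definition chi_square :: "nat \<Rightarrow> real \<Rightarrow> real measure" where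
  "chi_square K mu = distr (PiM {..<K} (\<lambda>_. std_normal)) borel
     (\<lambda>z. \<Sum>k<K. (z k + (if k = 0 then sqrt mu else 0))\<^sup>2)"

text \<open>The test statistic T_ij = (Vh(i) - Vh(j))^T Sigma_1^{-1} (Vh(i) - Vh(j)), where Sinv is
  Sigma_1^{-1} and Vh k l is the l-th entry of the k-th eigenvector.\<close>
definition Tstat :: "nat \<Rightarrow> (nat \<Rightarrow> nat \<Rightarrow> real) \<Rightarrow> (nat \<Rightarrow> nat \<Rightarrow> real) \<Rightarrow> nat \<Rightarrow> nat \<Rightarrow> real" where
  "Tstat K Sinv Vh i j = qform K Sinv (\<lambda>a. Vh a i - Vh a j)"

end

theory Submission
  imports Defs "Jordan_Normal_Form.Determinant" "HOL-Real_Asymp.Real_Asymp"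
begin

text \<open>
  Since \<open>\<lambda>\<^sub>K(P) \<ge> c\<^sub>0 > 0\<close> and \<open>P\<close> is symmetric, \<open>P\<close> is positive definite, so all \<open>d\<^sub>k\<close> are positive and of
  order \<open>n\<theta>\<close>, with gaps of that order. Iterating \<open>X v = \<delta> v\<close> with \<open>X = H + W\<close> gives the exact expansion
  \<open>v = (\<Sum>p<N. \<delta>\<^sup>-\<^sup>p\<^sup>-\<^sup>1 W\<^sup>p H v) + \<delta>\<^sup>-\<^sup>N W\<^sup>N v\<close>, where \<open>H v\<close> lies in the span of the columns of \<open>V\<close>. Second
  moments \<open>E (W\<^sup>p x)(i)\<^sup>2 \<le> C\<^sub>p (n\<theta>)\<^sup>p \<parallel>x\<parallel>\<^sub>\<infinity>\<^sup>2\<close>, obtained by counting walks, show that only the terms \<open>p = 0, 1\<close>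
  matter at the scale \<open>1 / (n \<surd>\<theta>)\<close>; here \<open>N\<close> is a constant, because \<open>n\<theta>\<close> grows like a power of \<open>n\<close>. The same
  moments bound the operator norm of \<open>W\<close>, and a residual argument gives consistency of the leading
  eigenpairs, which is all the coefficients of the expansion require. Hence
  \<open>Vh(i) - Vh(j) \<approx> V(i) - V(j) + (e\<^sub>i - e\<^sub>j)\<^sup>T W V D\<^sup>-\<^sup>1\<close>, and the last term is a sum of independent centred
  variables. After whitening by \<open>\<Sigma>\<^sub>1\<close>, the law of the quadratic form is identified by its Laplace
  transform: averaging the characteristic function over an independent Gaussian turns pointwise
  convergence of characteristic functions into convergence of \<open>E exp (- t \<parallel>Y\<parallel>\<^sup>2)\<close>.
\<close>

section \<open>Moments of walks in the noise matrix\<close>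

text \<open>The obstacle is that the eigenvectors are only consistent: their overlaps with the
  columns of \<open>V\<close> are known up to a small \<open>eta\<close>, without a rate, while the
  entries of \<open>V\<close> are of order \<open>1 / sqrt n\<close>, far above the noise scale
  \<open>1 / (n * sqrt theta)\<close>. Expanding a single row would leave an error of order
  \<open>eta / sqrt n\<close>. Subtracting row j from row i before estimating multiplies the
  coefficient error by V(i) - V(j) instead, so the total error is a small multiple of the noise
  scale plus |V(i) - V(j)|. This is negligible both when the difference is of the order of the noise
  and when it dominates. Only two rows are involved, so Markov's inequality for second moments
  suffices. The term p = 1 lives on the noise scale itself and can only be bounded in probability,
  by a constant \<open>M\<close>. The remainder applies \<open>W ^ N\<close> to a random vector, so
  it needs the norm of a whole row of \<open>W ^ N\<close>; with D = n * theta this asks for an N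
  such that n * D / D ^ N tends to 0.\<close>

definition mv :: "nat \<Rightarrow> (nat \<Rightarrow> nat \<Rightarrow> real) \<Rightarrow> (nat \<Rightarrow> real) \<Rightarrow> nat \<Rightarrow> real" where
  "mv n W x = (\<lambda>l. \<Sum>m<n. W l m * x m)"

definition wlists :: "nat \<Rightarrow> nat \<Rightarrow> nat list set" where
  "wlists n p = {xs. set xs \<subseteq> {..<n} \<and> length xs = p}"

fun pathw :: "(nat \<Rightarrow> nat \<Rightarrow> real) \<Rightarrow> nat \<Rightarrow> nat list \<Rightarrow> real" where
  "pathw W i [] = 1"
| "pathw W i (x # xs) = W i x * pathw W x xs"

text \<open>Edges are normalised to (min, max), the index set of the independent coordinates of
  \<open>edge_pmf\<close>, so that traversals in opposite directions count as the same random
  variable.\<close>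

fun pedges :: "nat \<Rightarrow> nat list \<Rightarrow> (nat \<times> nat) list" where
  "pedges i [] = []"
| "pedges i (x # xs) = (min i x, max i x) # pedges x xs"

definition edges :: "nat \<Rightarrow> (nat \<times> nat) set" where
  "edges n = {(l, m). l \<le> m \<and> m < n}"

text \<open>An entry of W as a function of the single coordinate it depends on. On a removed
  diagonal the entry is the constant - H, hence not centred.\<close>

definition ew :: "bool \<Rightarrow> (nat \<Rightarrow> nat \<Rightarrow> real) \<Rightarrow> nat \<times> nat \<Rightarrow> bool \<Rightarrow> real" where
  "ew loops H e b = (if \<not> loops \<and> fst e = snd e then 0 else of_bool b) - H (fst e) (snd e)"

lemma finite_edges [simp, intro]: "finite (edges n)"
proof (rule finite_subset)
  show "edges n \<subseteq> {..<n} \<times> {..<n}" by (auto simp: edges_def)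
qed auto

lemma finite_wlists [simp, intro]: "finite (wlists n p)"
  unfolding wlists_def by (rule finite_lists_length_eq) auto

lemma wlists_Suc: "wlists n (Suc p) = (\<lambda>(m, xs). m # xs) ` ({..<n} \<times> wlists n p)"
  by (auto simp: wlists_def length_Suc_conv image_iff)

lemma wlists_0: "wlists n 0 = {[]}"
  by (auto simp: wlists_def)

lemma mv_pow_eq_sum_walks:
  "(mv n W ^^ p) x i = (\<Sum>xs\<in>wlists n p. pathw W i xs * x (last (i # xs)))"
proof (induction p arbitrary: i)
  case 0
  show ?case by (simp add: wlists_0)
next
  case (Suc p)
  have "(mv n W ^^ Suc p) x i = (\<Sum>m<n. W i m * (\<Sum>xs\<in>wlists n p. pathw W m xs * x (last (m # xs))))"
    by (simp add: Suc.IH mv_def[of n W "(mv n W ^^ p) x"] del: last.simps)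
  also have "\<dots> = (\<Sum>(m, xs)\<in>{..<n} \<times> wlists n p. pathw W i (m # xs) * x (last (i # m # xs)))"
    by (simp add: sum.cartesian_product [symmetric] sum_distrib_left mult.assoc)
  also have "\<dots> = (\<Sum>xs\<in>wlists n (Suc p). pathw W i xs * x (last (i # xs)))"
    unfolding wlists_Suc by (subst sum.reindex) (auto simp: inj_on_def case_prod_beta)
  finally show ?case .
qed

lemma pedges_subset:
  "i < n \<Longrightarrow> set xs \<subseteq> {..<n} \<Longrightarrow> set (pedges i xs) \<subseteq> edges n"
  by (induction xs arbitrary: i) (auto simp: edges_def)

lemma length_pedges [simp]: "length (pedges i xs) = length xs"
  by (induction xs arbitrary: i) auto

lemma Wmat_eq_ew:
  assumes "\<And>l m. l < n \<Longrightarrow> m < n \<Longrightarrow> H l m = H m l" "l < n" "m < n"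
  shows "Wmat loops H s l m = ew loops H (min l m, max l m) (s (min l m, max l m))"
  using assms by (auto simp: Wmat_def ew_def Xobs_def Xstar_def min_def max_def)

lemma pathw_eq_prod_edges:
  assumes "\<And>l m. l < n \<Longrightarrow> m < n \<Longrightarrow> H l m = H m l" "i < n" "set xs \<subseteq> {..<n}"
  shows "pathw (Wmat loops H s) i xs = prod_list (map (\<lambda>e. ew loops H e (s e)) (pedges i xs))"
  using assms(2,3)
proof (induction xs arbitrary: i)
  case (Cons x xs)
  then show ?case using Wmat_eq_ew[where n = n and H = H and l = i and m = x, OF assms(1)] by simp
qed simp

lemma prod_list_eq_prod_count:
  fixes f :: "'a \<Rightarrow> 'b::comm_semiring_1"
  assumes "finite A" "set es \<subseteq> A"
  shows "prod_list (map f es) = (\<Prod>e\<in>A. f e ^ count_list es e)"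
  using assms(2)
proof (induction es)
  case (Cons e es)
  have "(\<Prod>x\<in>A. f x ^ count_list (e # es) x) = (\<Prod>x\<in>A. (if x = e then f x else 1) * f x ^ count_list es x)"
    by (intro prod.cong) auto
  also have "\<dots> = f e * (\<Prod>x\<in>A. f x ^ count_list es x)"
    using Cons.prems assms(1) by (simp add: prod.distrib prod.delta)
  finally show ?case using Cons by simp
qed simp

text \<open>The value field is left general because the lemma serves real moments as well as complex
  characteristic functions.\<close>

lemma expectation_prod_edges:
  fixes f :: "nat \<times> nat \<Rightarrow> bool \<Rightarrow> 'c::{real_normed_field, banach, second_countable_topology}"
  shows "measure_pmf.expectation (edge_pmf n H) (\<lambda>s. \<Prod>e\<in>edges n. f e (s e)) =
    (\<Prod>e\<in>edges n. measure_pmf.expectation (bernoulli_pmf (H (fst e) (snd e))) (f e))"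
proof -
  let ?p = "\<lambda>e. bernoulli_pmf (H (fst e) (snd e))"
  have E: "edge_pmf n H = Pi_pmf (edges n) False ?p"
    unfolding edge_pmf_def edges_def by (simp add: case_prod_beta')
  have fin: "finite (set_pmf (edge_pmf n H))"
    unfolding E by (subst set_Pi_pmf) (auto intro!: finite_PiE_dflt)
  have "prob_space.indep_vars (measure_pmf (edge_pmf n H)) (\<lambda>_. borel) (\<lambda>e s. f e (s e)) (edges n)"
    unfolding E by (rule prob_space.indep_vars_compose2[OF measure_pmf.prob_space_axioms indep_vars_Pi_pmf]) auto
  then have "measure_pmf.expectation (edge_pmf n H) (\<lambda>s. \<Prod>e\<in>edges n. f e (s e)) =
     (\<Prod>e\<in>edges n. measure_pmf.expectation (edge_pmf n H) (\<lambda>s. f e (s e)))"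
    by (intro prob_space.indep_vars_lebesgue_integral[OF measure_pmf.prob_space_axioms]) (auto intro: integrable_measure_pmf_finite fin)
  also have "\<dots> = (\<Prod>e\<in>edges n. measure_pmf.expectation (?p e) (f e))"
  proof (intro prod.cong refl)
    fix e assume "e \<in> edges n"
    then have "?p e = map_pmf (\<lambda>s. s e) (edge_pmf n H)"
      unfolding E by (subst Pi_pmf_component) auto
    then show "measure_pmf.expectation (edge_pmf n H) (\<lambda>s. f e (s e)) = measure_pmf.expectation (?p e) (f e)"
      by simp
  qed
  finally show ?thesis .
qed

lemma finite_set_edge_pmf [simp, intro]: "finite (set_pmf (edge_pmf n H))"
  unfolding edge_pmf_def edges_def[symmetric]
  by (subst set_Pi_pmf) (auto intro!: finite_PiE_dflt)

lemma integrable_edge_pmf [simp, intro]: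
  "integrable (measure_pmf (edge_pmf n H)) (f :: _ \<Rightarrow> 'c::{banach, second_countable_topology})"
  by (rule integrable_measure_pmf_finite) auto

text \<open>A nonloop edge traversed once contributes its mean 0. Traversed at least twice it
  contributes at most its variance, as the entry has modulus at most 1. Loops get the trivial bound
  1.\<close>

lemma abs_ew_moment_le:
  assumes p: "0 \<le> H (fst e) (snd e)" "H (fst e) (snd e) \<le> q" "q \<le> 1"
  shows "\<bar>measure_pmf.expectation (bernoulli_pmf (H (fst e) (snd e))) (\<lambda>b. ew loops H e b ^ k)\<bar>
    \<le> (if fst e = snd e \<or> k = 0 then 1 else if k = 1 then 0 else q)"
proof -
  define h where "h = H (fst e) (snd e)"
  have h: "0 \<le> h" "h \<le> q" "h \<le> 1" using p by (auto simp: h_def)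
  have ex: "measure_pmf.expectation (bernoulli_pmf (H (fst e) (snd e))) (\<lambda>b. ew loops H e b ^ k)
     = h * ew loops H e True ^ k + (1 - h) * ew loops H e False ^ k"
    using h by (simp add: h_def)
  have ew1: "\<bar>ew loops H e b\<bar> \<le> 1" for b using h by (auto simp: ew_def h_def)
  have le1: "\<bar>h * ew loops H e True ^ k + (1 - h) * ew loops H e False ^ k\<bar> \<le> 1"
  proof -
    have "\<bar>h * ew loops H e True ^ k + (1 - h) * ew loops H e False ^ k\<bar>
       \<le> h * \<bar>ew loops H e True ^ k\<bar> + (1 - h) * \<bar>ew loops H e False ^ k\<bar>"
      using h by (intro order_trans[OF abs_triangle_ineq]) (simp add: abs_mult)
    also have "\<dots> \<le> h * 1 + (1 - h) * 1"
      using h ew1 by (intro add_mono mult_left_mono) (auto simp: power_abs intro!: power_le_one)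
    finally show ?thesis by simp
  qed
  consider "fst e = snd e \<or> k = 0" | "fst e \<noteq> snd e" "k = 1" | "fst e \<noteq> snd e" "k \<ge> 2" by linarith
  then show ?thesis
  proof cases
    case 1 then show ?thesis using le1 ex by simp
  next
    case 2 then show ?thesis unfolding ex by (simp add: ew_def h_def algebra_simps)
  next
    case 3
    have "\<bar>h * (1 - h) ^ k + (1 - h) * (- h) ^ k\<bar> \<le> h * (1 - h) ^ k + (1 - h) * h ^ k"
      using h by (intro order_trans[OF abs_triangle_ineq]) (simp add: abs_mult power_abs)
    also have "\<dots> \<le> h * (1 - h) ^ 2 + (1 - h) * h ^ 2"
      using h 3 by (intro add_mono mult_left_mono power_decreasing) auto
    also have "\<dots> = h * (1 - h)" by (simp add: power2_eq_square algebra_simps)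
    also have "\<dots> \<le> h * 1" using h by (intro mult_left_mono) auto
    finally show ?thesis using 3 h unfolding ex by (simp add: ew_def h_def)
  qed
qed

text \<open>Loops are excluded because they create no new vertex; this is also why the non-centred
  diagonal of \<open>W\<close> is harmless.\<close>

definition nonloops :: "(nat \<times> nat) set \<Rightarrow> (nat \<times> nat) set" where
  "nonloops F = {e \<in> F. fst e \<noteq> snd e}"

text \<open>A step to a vertex outside \<open>S\<close> uses a nonloop edge that is not in
  \<open>F\<close>, since all edges of \<open>F\<close> have both ends in \<open>S\<close>; so each
  new vertex is paid for by a new edge. \<open>S\<close> and \<open>F\<close> are arbitrary so that
  a second walk can start from what the first one has visited.\<close>

lemma card_vertices_walk:
  assumes "finite S" "finite F" "i \<in> S" "\<And>e. e \<in> F \<Longrightarrow> fst e \<in> S \<and> snd e \<in> S"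
  shows "card (S \<union> set xs) + card F \<le> card S + card (F \<union> nonloops (set (pedges i xs)))"
  using assms
proof (induction xs arbitrary: i S F)
  case (Cons x xs)
  show ?case
  proof (cases "x \<in> S")
    case True
    have eq: "S \<union> set (x # xs) = S \<union> set xs" using True by auto
    define F' where "F' = F \<union> nonloops {(min i x, max i x)}"
    have "card (S \<union> set xs) + card F' \<le> card S + card (F' \<union> nonloops (set (pedges x xs)))"
      using Cons.prems True by (intro Cons.IH) (auto simp: F'_def nonloops_def min_def max_def)
    moreover have "card F \<le> card F'" using Cons.prems by (intro card_mono) (auto simp: F'_def nonloops_def)
    moreover have "F' \<union> nonloops (set (pedges x xs)) = F \<union> nonloops (set (pedges i (x # xs)))"
      by (auto simp: F'_def nonloops_def)
    ultimately show ?thesis using eq by simp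
  next
    case False
    have eq: "S \<union> set (x # xs) = insert x S \<union> set xs" by auto
    define e where "e = (min i x, max i x)"
    have ne: "i \<noteq> x" using False Cons.prems by auto
    have "x = fst e \<or> x = snd e" by (auto simp: e_def min_def max_def)
    then have "e \<notin> F" using Cons.prems(4) False by metis
    have "card (insert x S \<union> set xs) + card (insert e F) \<le>
        card (insert x S) + card (insert e F \<union> nonloops (set (pedges x xs)))"
    proof (rule Cons.IH)
      show "fst e' \<in> insert x S \<and> snd e' \<in> insert x S" if "e' \<in> insert e F" for e'
      proof (cases "e' = e")
        case True
        then show ?thesis using Cons.prems(3) by (simp add: e_def min_def max_def)
      next
        case False
        then show ?thesis using Cons.prems(4)[of e'] that by simp
      qed
    qed (use Cons.prems in auto)
    moreover have "insert e F \<union> nonloops (set (pedges x xs)) = F \<union> nonloops (set (pedges i (x # xs)))"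
      using ne by (auto simp: e_def nonloops_def min_def max_def)
    ultimately show ?thesis using eq False \<open>e \<notin> F\<close> Cons.prems by simp
  qed
qed (auto simp: nonloops_def)

text \<open>Both walks start at \<open>i\<close>, so their union is a connected graph, which has at
  most one vertex more than it has edges.\<close>

lemma card_vertices_two_walks:
  "card (insert i (set xs \<union> set ys)) \<le> Suc (card (nonloops (set (pedges i xs @ pedges i ys))))"
proof -
  let ?S = "insert i (set xs)" and ?F = "nonloops (set (pedges i xs))"
  have 1: "card ?S \<le> Suc (card ?F)"
    using card_vertices_walk[of "{i}" "{}" i xs] by simp
  have sub: "fst e \<in> insert i (set xs) \<and> snd e \<in> insert i (set xs)" if "e \<in> set (pedges i xs)" for e i xs
    using that by (induction xs arbitrary: i) (auto simp: min_def max_def split: if_splits)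
  have 2: "card (?S \<union> set ys) + card ?F \<le> card ?S + card (?F \<union> nonloops (set (pedges i ys)))"
    by (rule card_vertices_walk) (auto simp: nonloops_def dest: sub)
  have "?F \<union> nonloops (set (pedges i ys)) = nonloops (set (pedges i xs @ pedges i ys))"
    by (auto simp: nonloops_def)
  with 1 2 show ?thesis by simp
qed

text \<open>List the \<open>v\<close> vertices other than \<open>i\<close>, in at most
  \<open>n ^ v\<close> ways; both walks are then words of length \<open>p\<close> over an alphabet
  of \<open>v + 1\<close> letters.\<close>

lemma card_walk_pairs_le:
  assumes "i < n"
  shows "card {(xs, ys). xs \<in> wlists n p \<and> ys \<in> wlists n p \<and> card (insert i (set xs \<union> set ys)) = Suc v}
     \<le> n ^ v * (v + 1) ^ (2 * p)"
proof -
  let ?L = "\<lambda>us. {xs. set xs \<subseteq> set (i # us) \<and> length xs = p}"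
  have "{(xs, ys). xs \<in> wlists n p \<and> ys \<in> wlists n p \<and> card (insert i (set xs \<union> set ys)) = Suc v}
      \<subseteq> (\<Union>us\<in>wlists n v. ?L us \<times> ?L us)" (is "?A \<subseteq> ?B")
  proof clarify
    fix xs ys assume w: "xs \<in> wlists n p" "ys \<in> wlists n p" and c: "card (insert i (set xs \<union> set ys)) = Suc v"
    let ?U = "(set xs \<union> set ys) - {i}"
    have "?U = insert i (set xs \<union> set ys) - {i}" by auto
    then have "card ?U = v" using c by (simp only: card_Diff_singleton[OF insertI1] diff_Suc_1)
    moreover obtain us where "set us = ?U" "distinct us"
      using finite_distinct_list[of ?U] by auto
    ultimately have "us \<in> wlists n v" "set xs \<subseteq> set (i # us)" "set ys \<subseteq> set (i # us)"
      using w distinct_card[of us] by (auto simp: wlists_def)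
    then show "(xs, ys) \<in> ?B" using w by (auto simp: wlists_def)
  qed
  moreover have "finite ?B" by (intro finite_UN_I) (auto intro!: finite_lists_length_eq)
  ultimately have "card ?A \<le> card ?B" by (rule card_mono[rotated])
  also have "\<dots> \<le> (\<Sum>us\<in>wlists n v. card (?L us \<times> ?L us))" by (rule card_UN_le) auto
  also have "\<dots> \<le> (\<Sum>us\<in>wlists n v. (v + 1) ^ (2 * p))"
  proof (rule sum_mono)
    fix us assume "us \<in> wlists n v"
    then have "card (set (i # us)) \<le> v + 1" using card_length[of "i # us"] by (simp add: wlists_def)
    then have "card (?L us) \<le> (v + 1) ^ p"
      by (subst card_lists_length_eq) (auto intro!: power_mono)
    then show "card (?L us \<times> ?L us) \<le> (v + 1) ^ (2 * p)"
      by (auto simp: card_cartesian_product mult_2 power_add intro!: mult_mono)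
  qed
  also have "\<dots> = n ^ v * (v + 1) ^ (2 * p)"
    by (simp add: wlists_def card_lists_length_eq)
  finally show ?thesis .
qed

text \<open>The expectation vanishes unless every nonloop edge is traversed at least twice; the
  number of such edges is then at most \<open>p\<close>, and it is at least \<open>v\<close>. The
  right-hand side has at most one nonzero term; the form of a sum lets \<open>walk_moment\<close>
  exchange it with the sum over walks.\<close>

lemma abs_expectation_walk_pair_le:
  assumes sym: "\<And>l m. l < n \<Longrightarrow> m < n \<Longrightarrow> H l m = H m l"
    and H: "\<And>l m. l < n \<Longrightarrow> m < n \<Longrightarrow> 0 \<le> H l m \<and> H l m \<le> q"
    and q: "0 \<le> q" "q \<le> 1" and i: "i < n" and xs: "xs \<in> wlists n p" and ys: "ys \<in> wlists n p"
  shows "\<bar>measure_pmf.expectation (edge_pmf n H) (\<lambda>s. pathw (Wmat loops H s) i xs * pathw (Wmat loops H s) i ys)\<bar>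
    \<le> (\<Sum>v\<le>p. of_bool (card (insert i (set xs \<union> set ys)) = Suc v) * q ^ v)"
proof -
  define es where "es = pedges i xs @ pedges i ys"
  define NL where "NL = nonloops (set es)"
  define V where "V = insert i (set xs \<union> set ys)"
  have sub: "set es \<subseteq> edges n"
    using pedges_subset[of i n xs] pedges_subset[of i n ys] i xs ys by (auto simp: es_def wlists_def)
  have len: "length es = 2 * p" using xs ys by (simp add: es_def wlists_def)
  have eq: "measure_pmf.expectation (edge_pmf n H) (\<lambda>s. pathw (Wmat loops H s) i xs * pathw (Wmat loops H s) i ys)
    = (\<Prod>e\<in>edges n. measure_pmf.expectation (bernoulli_pmf (H (fst e) (snd e))) (\<lambda>b. ew loops H e b ^ count_list es e))"
    using i xs ys by (subst expectation_prod_edges[symmetric], subst prod_list_eq_prod_count[OF _ sub, symmetric])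
      (auto simp: pathw_eq_prod_edges[OF sym] es_def wlists_def)
  define b where "b = (\<lambda>e. (if fst e = snd e \<or> count_list es e = 0 then 1 else if count_list es e = 1 then 0 else q))"
  have "\<bar>\<Prod>e\<in>edges n. measure_pmf.expectation (bernoulli_pmf (H (fst e) (snd e))) (\<lambda>b. ew loops H e b ^ count_list es e)\<bar>
    \<le> (\<Prod>e\<in>edges n. b e)"
    unfolding abs_prod using H q
    unfolding b_def by (intro prod_mono conjI abs_ge_zero abs_ew_moment_le) (auto simp: edges_def)
  also have "(\<Prod>e\<in>edges n. b e) = (\<Prod>e\<in>NL. b e)"
    using sub by (intro prod.mono_neutral_right) (auto simp: NL_def nonloops_def b_def count_list_0_iff)
  also have "\<dots> \<le> (\<Sum>v\<le>p. of_bool (card V = Suc v) * q ^ v)"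
  proof (cases "\<exists>e\<in>NL. count_list es e = 1")
    case True
    have "finite NL" by (simp add: NL_def nonloops_def)
    with True have "(\<Prod>e\<in>NL. b e) = 0" by (intro prod_zero) (auto simp: b_def NL_def nonloops_def)
    then show ?thesis using q by (simp add: sum_nonneg)
  next
    case False
    have ge2: "count_list es e \<ge> 2" if "e \<in> NL" for e
    proof -
      have "count_list es e \<noteq> 0" using that by (auto simp: NL_def nonloops_def count_list_0_iff)
      then show ?thesis using False that by (metis One_nat_def less_2_cases not_le)
    qed
    have fin: "finite NL" by (simp add: NL_def nonloops_def)
    have "(\<Prod>e\<in>NL. b e) = (\<Prod>e\<in>NL. q)"
    proof (intro prod.cong refl)
      fix e assume "e \<in> NL"
      then show "b e = q" using ge2[of e] by (auto simp: b_def NL_def nonloops_def)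
    qed
    then have bq: "(\<Prod>e\<in>NL. b e) = q ^ card NL" by simp
    \<comment> \<open>Two walks of \<open>p\<close> steps have \<open>2 * p\<close> traversals in
      all, and each nonloop edge uses at least two of them.\<close>
    have "2 * card NL = (\<Sum>e\<in>NL. 2)" by simp
    also have "\<dots> \<le> (\<Sum>e\<in>NL. count_list es e)" using ge2 by (intro sum_mono) auto
    also have "\<dots> \<le> (\<Sum>e\<in>set es. count_list es e)" by (intro sum_mono2) (auto simp: NL_def nonloops_def)
    also have "\<dots> = 2 * p" by (simp add: sum_count_set len)
    finally have NLp: "card NL \<le> p" by simp
    have V: "card V \<le> Suc (card NL)" unfolding V_def NL_def es_def by (rule card_vertices_two_walks)
    have "card V \<ge> 1" unfolding V_def by (simp add: Suc_le_eq card_gt_0_iff)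
    then obtain v where v: "card V = Suc v" by (cases "card V") auto
    have "(\<Sum>v'\<le>p. of_bool (card V = Suc v') * q ^ v') = (\<Sum>v'\<le>p. (if v' = v then q ^ v else 0))"
      by (intro sum.cong) (auto simp: v)
    also have "\<dots> = q ^ v" using V v NLp by (simp add: sum.delta)
    finally show ?thesis using bq V v q by (simp add: power_decreasing)
  qed
  finally show ?thesis using eq by (simp add: V_def)
qed

text \<open>The \<open>n ^ v\<close> choices of vertices meet the weight \<open>q ^ v\<close>. As
  \<open>n * q\<close> is at least 1, the case \<open>v = p\<close> dominates; it corresponds to
  pairs whose union is a tree with every edge used twice.\<close>

lemma walk_moment:
  assumes sym: "\<And>l m. l < n \<Longrightarrow> m < n \<Longrightarrow> H l m = H m l"
    and H: "\<And>l m. l < n \<Longrightarrow> m < n \<Longrightarrow> 0 \<le> H l m \<and> H l m \<le> q"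
    and q: "0 \<le> q" "q \<le> 1" and nq: "1 \<le> real n * q" and i: "i < n"
  shows "(\<Sum>xs\<in>wlists n p. \<Sum>ys\<in>wlists n p. \<bar>measure_pmf.expectation (edge_pmf n H)
       (\<lambda>s. pathw (Wmat loops H s) i xs * pathw (Wmat loops H s) i ys)\<bar>)
    \<le> real (p + 1) ^ (2 * p + 1) * (real n * q) ^ p"
proof -
  let ?c = "\<lambda>xs ys v. of_bool (card (insert i (set xs \<union> set ys)) = Suc v) :: real"
  have "(\<Sum>xs\<in>wlists n p. \<Sum>ys\<in>wlists n p. \<bar>measure_pmf.expectation (edge_pmf n H)
       (\<lambda>s. pathw (Wmat loops H s) i xs * pathw (Wmat loops H s) i ys)\<bar>)
     \<le> (\<Sum>xs\<in>wlists n p. \<Sum>ys\<in>wlists n p. \<Sum>v\<le>p. ?c xs ys v * q ^ v)"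
    by (intro sum_mono abs_expectation_walk_pair_le[OF sym H q i])
  also have "\<dots> = (\<Sum>v\<le>p. (\<Sum>(xs, ys)\<in>wlists n p \<times> wlists n p. ?c xs ys v) * q ^ v)"
    by (simp only: sum.cartesian_product[of _ "wlists n p" "wlists n p"] case_prod_beta sum_distrib_right sum.swap[of _ "{..p}"])
      (simp add: case_prod_beta)
  also have "\<dots> \<le> (\<Sum>v\<le>p. real (p + 1) ^ (2 * p) * (real n * q) ^ p)"
  proof (rule sum_mono)
    fix v assume v: "v \<in> {..p}"
    let ?A = "{(xs, ys). xs \<in> wlists n p \<and> ys \<in> wlists n p \<and> card (insert i (set xs \<union> set ys)) = Suc v}"
    have "(\<Sum>(xs, ys)\<in>wlists n p \<times> wlists n p. ?c xs ys v) = (\<Sum>z\<in>?A. 1)"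
      by (rule sum.mono_neutral_cong_right) (auto split: if_splits)
    also have "\<dots> \<le> real (n ^ v * (v + 1) ^ (2 * p))"
      using card_walk_pairs_le[OF i, of p v] by (simp only: sum_constant of_nat_le_iff mult_1_right)
    finally have "(\<Sum>(xs, ys)\<in>wlists n p \<times> wlists n p. ?c xs ys v) * q ^ v \<le> real (n ^ v * (v + 1) ^ (2 * p)) * q ^ v"
      using q by (intro mult_right_mono) auto
    also have "\<dots> = real (v + 1) ^ (2 * p) * (real n * q) ^ v"
      by (simp add: power_mult_distrib)
    also have "\<dots> \<le> real (p + 1) ^ (2 * p) * (real n * q) ^ p"
      using v nq by (intro mult_mono power_mono power_increasing) auto
    finally show "(\<Sum>(xs, ys)\<in>wlists n p \<times> wlists n p. ?c xs ys v) * q ^ v \<le> real (p + 1) ^ (2 * p) * (real n * q) ^ p" .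
  qed
  also have "\<dots> = real (p + 1) ^ (2 * p + 1) * (real n * q) ^ p" by simp
  finally show ?thesis .
qed

lemma expectation_mv_pow_sq_le:
  assumes sym: "\<And>l m. l < n \<Longrightarrow> m < n \<Longrightarrow> H l m = H m l"
    and H: "\<And>l m. l < n \<Longrightarrow> m < n \<Longrightarrow> 0 \<le> H l m \<and> H l m \<le> q"
    and q: "0 \<le> q" "q \<le> 1" and nq: "1 \<le> real n * q" and i: "i < n"
    and v: "\<And>l. l < n \<Longrightarrow> \<bar>v l\<bar> \<le> B"
  shows "measure_pmf.expectation (edge_pmf n H) (\<lambda>s. ((mv n (Wmat loops H s) ^^ p) v i)\<^sup>2)
    \<le> B\<^sup>2 * (real (p + 1) ^ (2 * p + 1) * (real n * q) ^ p)"
proof -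
  let ?E = "measure_pmf.expectation (edge_pmf n H)"
  let ?w = "\<lambda>s. pathw (Wmat loops H s) i"
  let ?v = "\<lambda>xs. v (last (i # xs))"
  have lastn: "last (i # xs) < n" if "xs \<in> wlists n p" for xs
    using that i last_in_set[of "i # xs"] by (auto simp: wlists_def simp del: last.simps)
  have "?E (\<lambda>s. ((mv n (Wmat loops H s) ^^ p) v i)\<^sup>2) =
      ?E (\<lambda>s. \<Sum>xs\<in>wlists n p. \<Sum>ys\<in>wlists n p. (?v xs * ?v ys) * (?w s xs * ?w s ys))"
    by (simp add: mv_pow_eq_sum_walks power2_eq_square sum_product mult_ac)
  also have "\<dots> = (\<Sum>xs\<in>wlists n p. \<Sum>ys\<in>wlists n p. (?v xs * ?v ys) * ?E (\<lambda>s. ?w s xs * ?w s ys))"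
    by (simp add: Bochner_Integration.integral_sum)
  also have "\<dots> \<le> (\<Sum>xs\<in>wlists n p. \<Sum>ys\<in>wlists n p. B\<^sup>2 * \<bar>?E (\<lambda>s. ?w s xs * ?w s ys)\<bar>)"
  proof (intro sum_mono)
    fix xs ys assume w: "xs \<in> wlists n p" "ys \<in> wlists n p"
    have "\<bar>?v xs * ?v ys\<bar> \<le> B * B"
      unfolding abs_mult using v[OF lastn[OF w(1)]] v[OF lastn[OF w(2)]] by (intro mult_mono) auto
    then have "\<bar>(?v xs * ?v ys) * ?E (\<lambda>s. ?w s xs * ?w s ys)\<bar> \<le> B\<^sup>2 * \<bar>?E (\<lambda>s. ?w s xs * ?w s ys)\<bar>"
      unfolding abs_mult[of "?v xs * ?v ys"] power2_eq_square by (intro mult_right_mono) auto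
    then show "(?v xs * ?v ys) * ?E (\<lambda>s. ?w s xs * ?w s ys) \<le> B\<^sup>2 * \<bar>?E (\<lambda>s. ?w s xs * ?w s ys)\<bar>" by linarith
  qed
  also have "\<dots> = B\<^sup>2 * (\<Sum>xs\<in>wlists n p. \<Sum>ys\<in>wlists n p. \<bar>?E (\<lambda>s. ?w s xs * ?w s ys)\<bar>)"
    by (simp add: sum_distrib_left)
  also have "\<dots> \<le> B\<^sup>2 * (real (p + 1) ^ (2 * p + 1) * (real n * q) ^ p)"
    by (intro mult_left_mono walk_moment[OF sym H q nq i]) auto
  finally show ?thesis .
qed

text \<open>Expected squared norm of row \<open>i\<close> of \<open>W ^ p\<close>. Unlike the bound
  for a fixed vector, it can be applied to an eigenvector that depends on W, through Cauchy-Schwarz.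
  The sum over \<open>l\<close> merely restricts to pairs of walks with a common end.\<close>

lemma expectation_mv_pow_row_le:
  assumes sym: "\<And>l m. l < n \<Longrightarrow> m < n \<Longrightarrow> H l m = H m l"
    and H: "\<And>l m. l < n \<Longrightarrow> m < n \<Longrightarrow> 0 \<le> H l m \<and> H l m \<le> q"
    and q: "0 \<le> q" "q \<le> 1" and nq: "1 \<le> real n * q" and i: "i < n"
  shows "measure_pmf.expectation (edge_pmf n H)
     (\<lambda>s. \<Sum>l<n. ((mv n (Wmat loops H s) ^^ p) (\<lambda>m. of_bool (m = l)) i)\<^sup>2)
    \<le> real (p + 1) ^ (2 * p + 1) * (real n * q) ^ p"
proof -
  let ?E = "measure_pmf.expectation (edge_pmf n H)"
  let ?w = "\<lambda>s. pathw (Wmat loops H s) i"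
  let ?la = "\<lambda>xs. last (i # xs)"
  have lastn: "last (i # xs) < n" if "xs \<in> wlists n p" for xs
    using that i last_in_set[of "i # xs"] by (auto simp: wlists_def simp del: last.simps)
  have "?E (\<lambda>s. \<Sum>l<n. ((mv n (Wmat loops H s) ^^ p) (\<lambda>m. of_bool (m = l)) i)\<^sup>2) =
      ?E (\<lambda>s. \<Sum>l<n. \<Sum>xs\<in>wlists n p. \<Sum>ys\<in>wlists n p. (of_bool (?la xs = l) * of_bool (?la ys = l)) * (?w s xs * ?w s ys))"
  proof (intro Bochner_Integration.integral_cong sum.cong refl)
    fix s l
    show "((mv n (Wmat loops H s) ^^ p) (\<lambda>m. of_bool (m = l)) i)\<^sup>2 =
       (\<Sum>xs\<in>wlists n p. \<Sum>ys\<in>wlists n p. (of_bool (?la xs = l) * of_bool (?la ys = l)) * (?w s xs * ?w s ys))"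
      unfolding mv_pow_eq_sum_walks power2_eq_square sum_product by (intro sum.cong refl) (simp only: ac_simps)
  qed
  also have "\<dots> = ?E (\<lambda>s. \<Sum>xs\<in>wlists n p. \<Sum>ys\<in>wlists n p. \<Sum>l<n. (of_bool (?la xs = l) * of_bool (?la ys = l)) * (?w s xs * ?w s ys))"
    by (simp only: sum.swap[of _ "wlists n p" "{..<n}"])
  also have "\<dots> = ?E (\<lambda>s. \<Sum>xs\<in>wlists n p. \<Sum>ys\<in>wlists n p. of_bool (?la xs = ?la ys) * (?w s xs * ?w s ys))"
  proof (intro Bochner_Integration.integral_cong refl sum.cong)
    fix s xs ys assume w: "xs \<in> wlists n p" "ys \<in> wlists n p"
    have "(\<Sum>l<n. (of_bool (?la xs = l) * of_bool (?la ys = l)) * (?w s xs * ?w s ys)) =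
      (\<Sum>l<n. if l = ?la xs then of_bool (?la xs = ?la ys) * (?w s xs * ?w s ys) else 0)"
      by (intro sum.cong) auto
    also have "\<dots> = of_bool (?la xs = ?la ys) * (?w s xs * ?w s ys)"
      using lastn[OF w(1)] by (simp only: sum.delta finite_lessThan lessThan_iff if_True)
    finally show "(\<Sum>l<n. (of_bool (?la xs = l) * of_bool (?la ys = l)) * (?w s xs * ?w s ys)) =
        of_bool (?la xs = ?la ys) * (?w s xs * ?w s ys)".
  qed
  also have "\<dots> = (\<Sum>xs\<in>wlists n p. \<Sum>ys\<in>wlists n p. of_bool (?la xs = ?la ys) * ?E (\<lambda>s. ?w s xs * ?w s ys))"
    by (simp add: Bochner_Integration.integral_sum del: last.simps)
  also have "\<dots> \<le> (\<Sum>xs\<in>wlists n p. \<Sum>ys\<in>wlists n p. \<bar>?E (\<lambda>s. ?w s xs * ?w s ys)\<bar>)"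
    by (intro sum_mono) (auto simp del: last.simps)
  also have "\<dots> \<le> real (p + 1) ^ (2 * p + 1) * (real n * q) ^ p"
    by (rule walk_moment[OF sym H q nq i])
  finally show ?thesis .
qed

section \<open>Quadratic forms and symmetric matrices\<close>

definition ip :: "nat \<Rightarrow> (nat \<Rightarrow> real) \<Rightarrow> (nat \<Rightarrow> real) \<Rightarrow> real" where
  "ip n x y = (\<Sum>l<n. x l * y l)"

definition bil :: "nat \<Rightarrow> (nat \<Rightarrow> nat \<Rightarrow> real) \<Rightarrow> (nat \<Rightarrow> real) \<Rightarrow> (nat \<Rightarrow> real) \<Rightarrow> real" where
  "bil K A x y = (\<Sum>a<K. \<Sum>b<K. x a * A a b * y b)"

text \<open>Transferred from square matrices of type \<open>mat\<close>. It turns orthonormality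
  into completeness, both for \<open>Parseval\<close> and for the dual basis in the
  whitening.\<close>

lemma left_right_inverse:
  fixes A B :: "nat \<Rightarrow> nat \<Rightarrow> real"
  assumes "\<And>a b. a < n \<Longrightarrow> b < n \<Longrightarrow> (\<Sum>l<n. A a l * B l b) = of_bool (a = b)"
    and "a < n" "b < n"
  shows "(\<Sum>l<n. B a l * A l b) = of_bool (a = b)"
proof -
  define MA where "MA = mat n n (\<lambda>(a, b). A a b)"
  define MB where "MB = mat n n (\<lambda>(a, b). B a b)"
  have c: "MA \<in> carrier_mat n n" "MB \<in> carrier_mat n n" by (auto simp: MA_def MB_def)
  have "MA * MB = 1\<^sub>m n"
    by (rule eq_matI) (auto simp: MA_def MB_def scalar_prod_def assms(1) lessThan_atLeast0[symmetric])
  from mat_mult_left_right_inverse[OF c this] have "(MB * MA) $$ (a, b) = 1\<^sub>m n $$ (a, b)" by simp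
  then show ?thesis using assms(2,3)
    by (auto simp: MA_def MB_def scalar_prod_def lessThan_atLeast0[symmetric])
qed

lemma ip_commute: "ip n x y = ip n y x"
  by (simp add: ip_def mult.commute)

lemma ip_add_left: "ip n (\<lambda>l. x l + y l) z = ip n x z + ip n y z"
  by (simp add: ip_def sum.distrib algebra_simps)

lemma ip_add_right: "ip n z (\<lambda>l. x l + y l) = ip n z x + ip n z y"
  by (simp add: ip_def sum.distrib algebra_simps)

lemma ip_diff_left: "ip n (\<lambda>l. x l - y l) z = ip n x z - ip n y z"
  by (simp add: ip_def sum_subtractf algebra_simps)

lemma ip_diff_right: "ip n z (\<lambda>l. x l - y l) = ip n z x - ip n z y"
  by (simp add: ip_def sum_subtractf algebra_simps)

lemma ip_scale_left: "ip n (\<lambda>l. c * x l) z = c * ip n x z"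
  by (simp add: ip_def sum_distrib_left algebra_simps)

lemma ip_scale_right: "ip n z (\<lambda>l. c * x l) = c * ip n z x"
  by (simp add: ip_def sum_distrib_left algebra_simps)

lemma ip_sum_left: "ip n (\<lambda>l. \<Sum>a\<in>F. f a l) z = (\<Sum>a\<in>F. ip n (f a) z)"
  unfolding ip_def by (subst sum.swap) (simp add: sum_distrib_right)

lemma ip_sum_right: "ip n z (\<lambda>l. \<Sum>a\<in>F. f a l) = (\<Sum>a\<in>F. ip n z (f a))"
  unfolding ip_def by (subst sum.swap) (simp add: sum_distrib_left)

lemmas ip_linear = ip_add_left ip_add_right ip_diff_left ip_diff_right ip_scale_left ip_scale_right
  ip_sum_left ip_sum_right

lemma ip_nonneg [simp]: "0 \<le> ip n x x"
  by (simp add: ip_def sum_nonneg)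

lemma ip_cong: "(\<And>l. l < n \<Longrightarrow> x l = x' l) \<Longrightarrow> (\<And>l. l < n \<Longrightarrow> y l = y' l) \<Longrightarrow> ip n x y = ip n x' y'"
  by (simp add: ip_def)

lemma ip_eq_0D: "ip n x x = 0 \<Longrightarrow> l < n \<Longrightarrow> x l = 0"
  unfolding ip_def by (subst (asm) sum_nonneg_eq_0_iff) auto

lemma ip_Cauchy_Schwarz: "(ip n x y)\<^sup>2 \<le> ip n x x * ip n y y"
  using Cauchy_Schwarz_ineq_sum[of x y "{..<n}"] by (simp add: ip_def power2_eq_square)

lemma ip_sum_orthonormal:
  assumes "finite F" "\<And>a b. a \<in> F \<Longrightarrow> b \<in> F \<Longrightarrow> ip n (u a) (u b) = of_bool (a = b)"
  shows "ip n (\<lambda>l. \<Sum>a\<in>F. c a * u a l) (\<lambda>l. \<Sum>a\<in>F. e a * u a l) = (\<Sum>a\<in>F. c a * e a)"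
proof -
  have "ip n (\<lambda>l. \<Sum>a\<in>F. c a * u a l) (\<lambda>l. \<Sum>a\<in>F. e a * u a l) =
     (\<Sum>a\<in>F. \<Sum>b\<in>F. e b * (c a * ip n (u a) (u b)))"
    by (simp add: ip_linear sum_distrib_left mult_ac)
  also have "\<dots> = (\<Sum>a\<in>F. \<Sum>b\<in>F. if b = a then c a * e a else 0)"
    by (intro sum.cong refl) (auto simp: assms(2))
  also have "\<dots> = (\<Sum>a\<in>F. c a * e a)"
    using assms(1) by (intro sum.cong refl) (simp add: sum.delta)
  finally show ?thesis .
qed

lemma Bessel:
  assumes "finite F" "\<And>a b. a \<in> F \<Longrightarrow> b \<in> F \<Longrightarrow> ip n (u a) (u b) = of_bool (a = b)"
  shows "(\<Sum>a\<in>F. (ip n (u a) x)\<^sup>2) \<le> ip n x x"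
proof -
  let ?p = "\<lambda>l. \<Sum>a\<in>F. ip n (u a) x * u a l"
  have pp: "ip n ?p ?p = (\<Sum>a\<in>F. (ip n (u a) x)\<^sup>2)"
    by (subst ip_sum_orthonormal[OF assms]) (auto simp: power2_eq_square)
  have px: "ip n ?p x = (\<Sum>a\<in>F. (ip n (u a) x)\<^sup>2)"
    by (simp add: ip_linear power2_eq_square)
  have "0 \<le> ip n (\<lambda>l. x l - ?p l) (\<lambda>l. x l - ?p l)" by simp
  also have "\<dots> = ip n x x - 2 * ip n ?p x + ip n ?p ?p"
    by (simp only: ip_diff_left ip_diff_right ip_commute[of n x ?p])
  finally show ?thesis using pp px by simp
qed

lemma Parseval:
  assumes "\<And>a b. a < n \<Longrightarrow> b < n \<Longrightarrow> ip n (u a) (u b) = of_bool (a = b)"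
  shows "(\<Sum>a<n. (ip n (u a) x)\<^sup>2) = ip n x x"
proof -
  have inv: "(\<Sum>a<n. u a l * u a m) = of_bool (l = m)" if "l < n" "m < n" for l m
    using left_right_inverse[of n u "\<lambda>l a. u a l" l m] assms that by (simp add: ip_def)
  have "(\<Sum>a<n. (ip n (u a) x)\<^sup>2) = (\<Sum>a<n. \<Sum>l<n. \<Sum>m<n. x l * x m * (u a l * u a m))"
    by (simp add: ip_def power2_eq_square sum_product mult_ac)
  also have "\<dots> = (\<Sum>l<n. \<Sum>a<n. \<Sum>m<n. x l * x m * (u a l * u a m))"
    by (rule sum.swap)
  also have "\<dots> = (\<Sum>l<n. \<Sum>m<n. \<Sum>a<n. x l * x m * (u a l * u a m))"
    by (rule sum.cong[OF refl]) (rule sum.swap)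
  also have "\<dots> = (\<Sum>l<n. \<Sum>m<n. if m = l then x l * x l else 0)"
    by (intro sum.cong refl) (auto simp: inv sum_distrib_left[symmetric])
  also have "\<dots> = ip n x x" by (simp add: ip_def sum.delta)
  finally show ?thesis .
qed

lemma qform_eq_bil: "qform K A x = bil K A x x"
  by (simp add: qform_def bil_def)

lemma bil_eq_ip: "bil K A x y = ip K x (\<lambda>a. \<Sum>b<K. A a b * y b)"
  by (simp add: bil_def ip_def sum_distrib_left mult.assoc)

lemma bil_commute:
  assumes "\<And>a b. a < K \<Longrightarrow> b < K \<Longrightarrow> A a b = A b a"
  shows "bil K A x y = bil K A y x"
proof -
  have "bil K A x y = (\<Sum>a<K. \<Sum>b<K. y b * A b a * x a)"
    unfolding bil_def by (intro sum.cong refl) (simp add: assms mult_ac)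
  then show ?thesis unfolding bil_def by (subst (asm) sum.swap) simp
qed

lemma bil_add_left: "bil K A (\<lambda>l. x l + y l) z = bil K A x z + bil K A y z"
  by (simp add: bil_eq_ip ip_linear)

lemma bil_diff_left: "bil K A (\<lambda>l. x l - y l) z = bil K A x z - bil K A y z"
  by (simp add: bil_eq_ip ip_linear)

lemma bil_scale_left: "bil K A (\<lambda>l. c * x l) z = c * bil K A x z"
  by (simp add: bil_eq_ip ip_linear)

lemma bil_sum_left: "bil K A (\<lambda>l. \<Sum>a\<in>F. f a l) z = (\<Sum>a\<in>F. bil K A (f a) z)"
  by (simp add: bil_eq_ip ip_linear)

lemma bil_add_right: "bil K A z (\<lambda>l. x l + y l) = bil K A z x + bil K A z y"
  by (simp add: bil_def sum.distrib algebra_simps)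

lemma bil_diff_right: "bil K A z (\<lambda>l. x l - y l) = bil K A z x - bil K A z y"
  by (simp add: bil_def sum_subtractf algebra_simps)

lemma bil_scale_right: "bil K A z (\<lambda>l. c * x l) = c * bil K A z x"
  by (simp add: bil_def sum_distrib_left mult_ac)

lemma bil_sum_right: "finite F \<Longrightarrow> bil K A z (\<lambda>l. \<Sum>a\<in>F. f a l) = (\<Sum>a\<in>F. bil K A z (f a))"
proof (induction F rule: finite_induct)
  case (insert a F)
  then show ?case by (simp add: bil_add_right)
qed (simp add: bil_def)

lemmas bil_linear = bil_add_left bil_add_right bil_diff_left bil_diff_right bil_scale_left bil_scale_right
  bil_sum_left bil_sum_right

section \<open>Eigenvalues of symmetric matrices and the Rayleigh quotient\<close>

lemma finite_eigvals:
  assumes sym: "\<And>a b. a < K \<Longrightarrow> b < K \<Longrightarrow> A a b = A b a"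
  shows "finite {lam. is_eigval K A lam}"
proof (rule ccontr)
  \<comment> \<open>K + 1 distinct eigenvalues would give K + 1 orthonormal vectors in K dimensions.
    \<open>Bessel\<close>, applied to each coordinate vector and summed over the coordinates, bounds
    their number by K. Finiteness is what gives \<open>Min\<close> in \<open>lambda_K\<close> its
    meaning.\<close>
  assume "infinite {lam. is_eigval K A lam}"
  then obtain F where F: "F \<subseteq> {lam. is_eigval K A lam}" "finite F" "card F = Suc K"
    using infinite_arbitrarily_large by blast
  have "\<exists>u. ip K u u = 1 \<and> (\<forall>a<K. (\<Sum>b<K. A a b * u b) = lam * u a)" if "lam \<in> F" for lam
  proof -
    from that F obtain v where v: "\<exists>k<K. v k \<noteq> 0" "\<And>a. a < K \<Longrightarrow> (\<Sum>b<K. A a b * v b) = lam * v a"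
      unfolding is_eigval_def by blast
    define s where "s = ip K v v"
    have "s \<noteq> 0" using v(1) ip_eq_0D unfolding s_def by blast
    then have s: "s > 0" using ip_nonneg[of K v] unfolding s_def by linarith
    have "ip K (\<lambda>l. (1 / sqrt s) * v l) (\<lambda>l. (1 / sqrt s) * v l) = 1"
      unfolding ip_linear using s by (simp add: s_def[symmetric] field_simps)
    moreover have "(\<Sum>b<K. A a b * ((1 / sqrt s) * v b)) = lam * ((1 / sqrt s) * v a)" if "a < K" for a
      using v(2)[OF that] by (simp add: sum_divide_distrib[symmetric])
    ultimately show ?thesis by blast
  qed
  then obtain u where u: "\<And>lam. lam \<in> F \<Longrightarrow> ip K (u lam) (u lam) = 1"
    "\<And>lam a. lam \<in> F \<Longrightarrow> a < K \<Longrightarrow> (\<Sum>b<K. A a b * u lam b) = lam * u lam a" by metis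
  have orth: "ip K (u l) (u m) = of_bool (l = m)" if "l \<in> F" "m \<in> F" for l m
  proof (cases "l = m")
    case False
    have "bil K A (u l) (u m) = m * ip K (u l) (u m)"
      unfolding bil_eq_ip ip_scale_right[symmetric] by (rule ip_cong) (auto simp: u that)
    moreover have "bil K A (u m) (u l) = l * ip K (u m) (u l)"
      unfolding bil_eq_ip ip_scale_right[symmetric] by (rule ip_cong) (auto simp: u that)
    ultimately have "m * ip K (u l) (u m) = l * ip K (u l) (u m)"
      using bil_commute[of K A "u l" "u m", OF sym] by (simp only: ip_commute[of K "u m" "u l"])
    then show ?thesis using False by auto
  qed (simp add: u that)
  have "(\<Sum>l\<in>F. (u l c)\<^sup>2) \<le> 1" if "c < K" for c
  proof -
    have e: "ip K y (\<lambda>m. of_bool (m = c)) = y c" for y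
      using that by (simp add: ip_def of_bool_def sum.delta' if_distrib cong: if_cong)
    show ?thesis using Bessel[OF F(2) orth, of "\<lambda>m. of_bool (m = c)"] unfolding e by simp
  qed
  then have "(\<Sum>c<K. \<Sum>l\<in>F. (u l c)\<^sup>2) \<le> (\<Sum>c<K. 1)" by (intro sum_mono) auto
  moreover have "(\<Sum>c<K. \<Sum>l\<in>F. (u l c)\<^sup>2) = (\<Sum>l\<in>F. ip K (u l) (u l))"
    unfolding ip_def power2_eq_square by (rule sum.swap)
  ultimately show False using u F by simp
qed

text \<open>Vectors are functions on all of \<open>nat\<close>. Fixing them to 0 from
  \<open>K\<close> on places the sphere, as a closed set, inside a product of compact intervals,
  which is compact by Tychonoff's theorem.\<close>

lemma compact_unit_sphere:
  "compact {x :: nat \<Rightarrow> real. (\<forall>k\<ge>K. x k = 0) \<and> ip K x x = 1}" (is "compact ?S")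
proof -
  define B where "B = (\<lambda>k. if k < K then {-1..1} else {0::real})"
  have "compactin (product_topology (\<lambda>_::nat. euclidean :: real topology) UNIV) (PiE UNIV B)"
    unfolding compactin_PiE by (auto simp: B_def compactin_euclidean_iff)
  then have "compact (PiE UNIV B)" unfolding euclidean_product_topology compactin_euclidean_iff .
  moreover have "closed ?S"
  proof -
    have "closed {x :: nat \<Rightarrow> real. x k = 0}" for k
      by (rule closed_Collect_eq) (auto intro: continuous_on_product_coordinates)
    then have c1: "closed (\<Inter>k\<in>{K..}. {x :: nat \<Rightarrow> real. x k = 0})" by (intro closed_INT) auto
    have c2: "closed {x :: nat \<Rightarrow> real. ip K x x = 1}"
      unfolding ip_def by (rule closed_Collect_eq) (auto intro!: continuous_intros continuous_on_product_coordinates)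
    have "?S = (\<Inter>k\<in>{K..}. {x. x k = 0}) \<inter> {x. ip K x x = 1}" by auto
    then show ?thesis using closed_Int[OF c1 c2] by simp
  qed
  moreover have "?S \<subseteq> PiE UNIV B"
  proof
    fix x assume x: "x \<in> ?S"
    have "x k \<in> B k" for k
    proof (cases "k < K")
      case True
      have "x k * x k \<le> ip K x x" unfolding ip_def
        by (rule member_le_sum[where f = "\<lambda>l. x l * x l"]) (use True in auto)
      then have "\<bar>x k\<bar> \<le> 1" using x abs_square_le_1[of "x k"] by (simp add: power2_eq_square)
      then show ?thesis using True by (auto simp: B_def)
    qed (use x in \<open>auto simp: B_def\<close>)
    then show "x \<in> PiE UNIV B" by auto
  qed
  ultimately have "compact (PiE UNIV B \<inter> ?S)" by (intro compact_Int_closed)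
  then show ?thesis using \<open>?S \<subseteq> PiE UNIV B\<close> by (simp add: Int_absorb1)
qed

text \<open>A minimiser of the quadratic form on the unit sphere is an eigenvector.\<close>

lemma eigval_Rayleigh_min:
  assumes K: "K \<ge> 1" and sym: "\<And>a b. a < K \<Longrightarrow> b < K \<Longrightarrow> A a b = A b a"
  obtains lam where "is_eigval K A lam" "\<And>x. lam * ip K x x \<le> qform K A x"
proof -
  define S where "S = {x :: nat \<Rightarrow> real. (\<forall>k\<ge>K. x k = 0) \<and> ip K x x = 1}"
  have "(\<lambda>k. of_bool (k = 0)) \<in> S"
    using K by (auto simp: S_def ip_def of_bool_def sum.delta' if_distrib cong: if_cong)
  then have ne: "S \<noteq> {}" by blast
  have cS: "compact S" unfolding S_def by (rule compact_unit_sphere)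
  have "continuous_on S (qform K A)"
    unfolding qform_def by (intro continuous_intros continuous_on_subset[OF continuous_on_product_coordinates]) auto
  from continuous_attains_inf[OF cS ne this]
  obtain x0 where x0: "x0 \<in> S" "\<And>y. y \<in> S \<Longrightarrow> qform K A x0 \<le> qform K A y" by blast
  define lam where "lam = qform K A x0"
  have bound: "lam * ip K x x \<le> qform K A x" for x
  proof (cases "ip K x x = 0")
    case True
    then have "\<And>l. l < K \<Longrightarrow> x l = 0" by (rule ip_eq_0D)
    then show ?thesis using True by (simp add: qform_def)
  next
    case False
    then have s: "ip K x x > 0" using ip_nonneg[of K x] by linarith
    define c where "c = 1 / sqrt (ip K x x)"
    have c: "c * c * ip K x x = 1" using s by (simp add: c_def field_simps)
    define y where "y = (\<lambda>l. if l < K then c * x l else 0)"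
    have "ip K y y = ip K (\<lambda>l. c * x l) (\<lambda>l. c * x l)" by (rule ip_cong) (auto simp: y_def)
    then have "y \<in> S" using c by (simp add: S_def ip_linear y_def)
    from x0(2)[OF this] have "lam \<le> qform K A y" by (simp add: lam_def)
    also have "\<dots> = qform K A (\<lambda>l. c * x l)" by (simp add: qform_def y_def)
    also have "\<dots> = c * c * qform K A x" by (simp add: qform_eq_bil bil_linear)
    finally have "lam * ip K x x \<le> (c * c * qform K A x) * ip K x x" using s by (intro mult_right_mono) auto
    also have "\<dots> = (c * c * ip K x x) * qform K A x" by (simp only: mult_ac)
    finally show ?thesis using c by simp
  qed
  define r where "r = (\<lambda>a. (\<Sum>b<K. A a b * x0 b) - lam * x0 a)"
  define M where "M = qform K A r - lam * ip K r r"
  have M: "0 \<le> M" using bound[of r] by (simp add: M_def)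
  \<comment> \<open>Variation of the minimiser in the direction of its residual
    \<open>r = A x0 - lam x0\<close>: the linear coefficient is twice the squared norm of
    \<open>r\<close>, so a small negative \<open>t\<close> gives a contradiction unless
    \<open>r\<close> vanishes.\<close>
  have expand: "0 \<le> 2 * t * ip K r r + t\<^sup>2 * M" for t
  proof -
    have "bil K A r x0 - lam * ip K r x0 = ip K r r"
      unfolding bil_eq_ip ip_scale_right[symmetric] ip_diff_right[symmetric] by (simp add: r_def)
    moreover have "bil K A x0 r = bil K A r x0" by (rule bil_commute) (rule sym)
    moreover have "0 \<le> qform K A (\<lambda>l. x0 l + t * r l) - lam * ip K (\<lambda>l. x0 l + t * r l) (\<lambda>l. x0 l + t * r l)"
      using bound[of "\<lambda>l. x0 l + t * r l"] by simp
    moreover have "qform K A x0 - lam * ip K x0 x0 = 0" using x0 by (simp add: lam_def S_def)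
    ultimately show ?thesis
      unfolding qform_eq_bil bil_linear ip_linear M_def
      by (simp add: ip_commute[of K x0 r] power2_eq_square algebra_simps)
  qed
  have "ip K r r = 0"
  proof (rule ccontr)
    assume "ip K r r \<noteq> 0"
    then have pos: "ip K r r > 0" using ip_nonneg[of K r] by linarith
    \<comment> \<open>The minimiser of the quadratic in \<open>t\<close> would divide by
      \<open>M\<close>; \<open>M + 1\<close> avoids the case \<open>M = 0\<close>.\<close>
    define t where "t = - (ip K r r / (M + 1))"
    have tM: "t * (M + 1) = - ip K r r" using M by (simp add: t_def)
    have t: "t < 0" using pos M by (simp add: t_def)
    have "2 * t * ip K r r + t\<^sup>2 * M = t * (2 * ip K r r + t * (M + 1) - t)"
      by (simp add: power2_eq_square algebra_simps)
    also have "\<dots> = t * (ip K r r - t)" using tM by simp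
    also have "\<dots> < 0" using t pos by (intro mult_neg_pos) auto
    finally show False using expand[of t] by simp
  qed
  then have "(\<Sum>b<K. A a b * x0 b) = lam * x0 a" if "a < K" for a
    using ip_eq_0D[of K r a] that by (simp add: r_def)
  moreover have "\<exists>k<K. x0 k \<noteq> 0"
  proof (rule ccontr)
    assume "\<not> (\<exists>k<K. x0 k \<noteq> 0)"
    then have "ip K x0 x0 = 0" by (simp add: ip_def)
    then show False using x0(1) by (simp add: S_def)
  qed
  ultimately have "is_eigval K A lam" unfolding is_eigval_def by blast
  then show thesis using bound that by blast
qed

text \<open>The minimum of the Rayleigh quotient is itself an eigenvalue, hence at least
  \<open>lambda_K\<close>. This turns the eigenvalue bounds of (C2) into coercivity of quadratic
  forms.\<close>

lemma lambda_K_le_qform: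
  assumes "K \<ge> 1" "\<And>a b. a < K \<Longrightarrow> b < K \<Longrightarrow> A a b = A b a"
  shows "lambda_K K A * ip K x x \<le> qform K A x"
proof -
  obtain lam where lam: "is_eigval K A lam" "\<And>x. lam * ip K x x \<le> qform K A x"
    using eigval_Rayleigh_min[of K A, OF assms] by blast
  have "lambda_K K A \<le> lam" unfolding lambda_K_def
    using lam(1) finite_eigvals[of K A, OF assms(2)] by (intro Min_le) auto
  then have "lambda_K K A * ip K x x \<le> lam * ip K x x" by (intro mult_right_mono) auto
  with lam(2)[of x] show ?thesis by linarith
qed

section \<open>Powers of a symmetric matrix: row norms and the operator norm\<close>

lemma mv_pow_linear:
  assumes "finite F" "l < n" "\<And>m. m < n \<Longrightarrow> x m = (\<Sum>a\<in>F. c a * u a m)"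
  shows "(mv n W ^^ p) x l = (\<Sum>a\<in>F. c a * (mv n W ^^ p) (u a) l)"
  using assms(2)
proof (induction p arbitrary: l)
  case (Suc p)
  have "(mv n W ^^ Suc p) x l = (\<Sum>m<n. W l m * (\<Sum>a\<in>F. c a * (mv n W ^^ p) (u a) m))"
    using Suc.IH by (simp add: mv_def[of n W "(mv n W ^^ p) x"])
  also have "\<dots> = (\<Sum>a\<in>F. c a * (\<Sum>m<n. W l m * (mv n W ^^ p) (u a) m))"
    unfolding sum_distrib_left by (subst sum.swap) (simp add: mult_ac)
  finally show ?case by (simp add: mv_def[of n W "(mv n W ^^ p) _"])
qed (simp add: assms(3))

text \<open>Squared Euclidean norm of row \<open>i\<close> of \<open>W ^ p\<close>; summed over
  \<open>i\<close> it is the squared Frobenius norm of \<open>W ^ p\<close>.\<close>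

definition rowsq :: "nat \<Rightarrow> (nat \<Rightarrow> nat \<Rightarrow> real) \<Rightarrow> nat \<Rightarrow> nat \<Rightarrow> real" where
  "rowsq n W p i = (\<Sum>l<n. ((mv n W ^^ p) (\<lambda>m. of_bool (m = l)) i)\<^sup>2)"

lemma mv_pow_sq_le_rowsq:
  assumes "i < n"
  shows "((mv n W ^^ p) x i)\<^sup>2 \<le> rowsq n W p i * ip n x x"
proof -
  have "(mv n W ^^ p) x i = (\<Sum>l<n. x l * (mv n W ^^ p) (\<lambda>m. of_bool (m = l)) i)"
    using assms by (intro mv_pow_linear) (auto simp: of_bool_def sum.delta' if_distrib cong: if_cong)
  also have "\<dots> = ip n (\<lambda>l. (mv n W ^^ p) (\<lambda>m. of_bool (m = l)) i) x" by (simp add: ip_def mult.commute)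
  finally show ?thesis using ip_Cauchy_Schwarz[of n "\<lambda>l. (mv n W ^^ p) (\<lambda>m. of_bool (m = l)) i" x]
    by (simp add: rowsq_def ip_def power2_eq_square)
qed

lemma ip_mv_symmetric:
  assumes "\<And>l m. l < n \<Longrightarrow> m < n \<Longrightarrow> W l m = W m l"
  shows "ip n (mv n W x) y = ip n x (mv n W y)"
proof -
  have "ip n (mv n W x) y = bil n W y x" by (simp add: bil_eq_ip ip_commute mv_def)
  also have "\<dots> = bil n W x y" by (rule bil_commute) (rule assms)
  finally show ?thesis by (simp add: bil_eq_ip mv_def)
qed

text \<open>Log-convexity of \<open>p \<mapsto> |W\<^sup>p x|\<^sup>2\<close> replaces the spectral theorem here.\<close>

lemma mv_norm_le_of_frobenius:
  assumes sym: "\<And>l m. l < n \<Longrightarrow> m < n \<Longrightarrow> W l m = W m l"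
    and N: "N \<ge> 1" and r: "0 \<le> r" and F: "(\<Sum>i<n. rowsq n W N i) \<le> r ^ N"
  shows "ip n (mv n W x) (mv n W x) \<le> r * ip n x x"
proof -
  define a where "a = (\<lambda>p. ip n ((mv n W ^^ p) x) ((mv n W ^^ p) x))"
  have a0: "0 \<le> a p" for p by (simp add: a_def)
  have lc: "(a (Suc p))\<^sup>2 \<le> a p * a (Suc (Suc p))" for p
  proof -
    have "a (Suc p) = ip n (mv n W ((mv n W ^^ p) x)) ((mv n W ^^ Suc p) x)" by (simp add: a_def)
    also have "\<dots> = ip n ((mv n W ^^ p) x) ((mv n W ^^ Suc (Suc p)) x)"
      by (subst ip_mv_symmetric[OF sym]) auto
    finally show ?thesis using ip_Cauchy_Schwarz by (simp add: a_def)
  qed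
  \<comment> \<open>The ratios a (p + 1) / a p increase with p, written without division because
    \<open>a p\<close> may vanish.\<close>
  have ratio: "a 1 * a p \<le> a 0 * a (Suc p)" for p
  proof (induction p)
    case (Suc p)
    show ?case
    proof (cases "a p = 0")
      case True
      then have "a (Suc p) = 0" using lc[of p] by simp
      then show ?thesis using a0 by simp
    next
      case False
      then have pos: "a p > 0" using a0[of p] by linarith
      have "a p * (a 1 * a (Suc p)) = (a 1 * a p) * a (Suc p)" by simp
      also have "\<dots> \<le> (a 0 * a (Suc p)) * a (Suc p)" using Suc a0 by (intro mult_right_mono) auto
      also have "\<dots> = a 0 * (a (Suc p))\<^sup>2" by (simp add: power2_eq_square)
      also have "\<dots> \<le> a 0 * (a p * a (Suc (Suc p)))" using lc a0 by (intro mult_left_mono) auto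
      also have "\<dots> = a p * (a 0 * a (Suc (Suc p)))" by simp
      finally show ?thesis using pos by simp
    qed
  qed simp
  \<comment> \<open>Product of the ratios: the power p + 1 of a 1 / a 0 is at most a (p + 1) / a 0.
    For p + 1 = N, an N-th root of the Frobenius bound on \<open>a N\<close> gives the
    claim.\<close>
  have pw: "a 1 ^ Suc p \<le> a 0 ^ p * a (Suc p)" for p
  proof (induction p)
    case (Suc p)
    have "a 1 ^ Suc (Suc p) = a 1 * a 1 ^ Suc p" by simp
    also have "\<dots> \<le> a 1 * (a 0 ^ p * a (Suc p))" using Suc a0 by (intro mult_left_mono) auto
    also have "\<dots> = a 0 ^ p * (a 1 * a (Suc p))" by simp
    also have "\<dots> \<le> a 0 ^ p * (a 0 * a (Suc (Suc p)))" using ratio a0 by (intro mult_left_mono) auto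
    finally show ?case by (simp add: mult_ac)
  qed simp
  have aN: "a N \<le> r ^ N * a 0"
  proof -
    have "a N = (\<Sum>i<n. ((mv n W ^^ N) x i)\<^sup>2)" by (simp add: a_def ip_def power2_eq_square)
    also have "\<dots> \<le> (\<Sum>i<n. rowsq n W N i * ip n x x)" by (intro sum_mono mv_pow_sq_le_rowsq) auto
    also have "\<dots> \<le> r ^ N * a 0" using F a0[of 0] by (simp add: sum_distrib_right[symmetric] a_def mult_right_mono)
    finally show ?thesis .
  qed
  obtain p where p: "N = Suc p" using N by (cases N) auto
  have "a 1 ^ Suc p \<le> a 0 ^ p * a (Suc p)" by (rule pw)
  also have "\<dots> \<le> a 0 ^ p * (r ^ N * a 0)" using aN a0 by (intro mult_left_mono) (auto simp: p)
  also have "\<dots> = (r * a 0) ^ Suc p" by (simp add: p power_mult_distrib mult_ac)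
  finally have "a 1 \<le> r * a 0" by (rule power_le_imp_le_base) (use r a0 in auto)
  then show ?thesis by (simp add: a_def)
qed

section \<open>Perturbation of eigenpairs\<close>

text \<open>Pythagoras for the residual \<open>W u = \<delta> u - H u\<close>: along
  \<open>v b\<close> its component is \<open>(\<delta> - d b)\<close> times the overlap, and on the
  orthogonal complement H vanishes and only \<open>\<delta> u\<close> is left.\<close>

lemma eigvec_perturbation_aux:
  fixes K n :: nat
  assumes orthV: "\<And>a b. a < K \<Longrightarrow> b < K \<Longrightarrow> ip n (v a) (v b) = of_bool (a = b)"
    and Hx: "\<And>x l. l < n \<Longrightarrow> mv n H x l = (\<Sum>b<K. (d b * ip n (v b) x) * v b l)"
    and X: "\<And>l m. l < n \<Longrightarrow> m < n \<Longrightarrow> X l m = H l m + W l m"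
    and W: "\<And>x. ip n (mv n W x) (mv n W x) \<le> e\<^sup>2 * ip n x x"
    and u: "ip n u u = 1" "\<And>l. l < n \<Longrightarrow> mv n X u l = \<delta> * u l"
  shows "(\<Sum>b<K. (d b - \<delta>)\<^sup>2 * (ip n (v b) u)\<^sup>2) + \<delta>\<^sup>2 * (1 - (\<Sum>b<K. (ip n (v b) u)\<^sup>2)) \<le> e\<^sup>2"
proof -
  let ?c = "\<lambda>b. ip n (v b) u"
  let ?h = "\<lambda>l. \<Sum>b<K. (d b * ?c b) * v b l"
  have Wu: "mv n W u l = \<delta> * u l - ?h l" if "l < n" for l
  proof -
    have "mv n X u l = mv n H u l + mv n W u l"
      using X that by (simp add: mv_def sum.distrib[symmetric] algebra_simps)
    then show ?thesis using u(2)[OF that] Hx[OF that, of u] by simp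
  qed
  have hh: "ip n ?h ?h = (\<Sum>b<K. (d b)\<^sup>2 * (?c b)\<^sup>2)"
    by (subst ip_sum_orthonormal[OF _ orthV]) (auto simp: power2_eq_square mult_ac)
  have hu: "ip n u ?h = (\<Sum>b<K. d b * (?c b)\<^sup>2)"
    unfolding ip_sum_right ip_scale_right by (simp add: ip_commute[of n u] power2_eq_square mult.assoc)
  have "ip n (mv n W u) (mv n W u) = ip n (\<lambda>l. \<delta> * u l - ?h l) (\<lambda>l. \<delta> * u l - ?h l)"
    by (rule ip_cong) (auto simp: Wu)
  also have "\<dots> = \<delta>\<^sup>2 - 2 * \<delta> * ip n u ?h + ip n ?h ?h"
    by (simp only: ip_diff_left ip_diff_right ip_scale_left ip_scale_right u ip_commute[of n ?h u]) (simp add: power2_eq_square)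
  also have "\<dots> = (\<Sum>b<K. (d b - \<delta>)\<^sup>2 * (?c b)\<^sup>2) + \<delta>\<^sup>2 * (1 - (\<Sum>b<K. (?c b)\<^sup>2))"
    unfolding hh hu by (simp add: power2_eq_square algebra_simps sum.distrib sum_distrib_left sum_subtractf sum_negf)
  finally show ?thesis using W[of u] u by simp
qed

text \<open>No min-max principle is used: the residuals \<open>(X - d\<^sub>a) v\<^sub>a\<close> and \<open>(H - \<delta>\<^sub>m) u\<^sub>m\<close> are small, so every \<open>d\<^sub>a\<close>
  has an eigenvalue of \<open>X\<close> nearby and every eigenvalue of \<open>X\<close> is close to some \<open>d\<^sub>a\<close> or to 0; the ordering
  then identifies the indices.\<close>

lemma eigen_perturbation:
  fixes K n :: nat
  assumes orthV: "\<And>a b. a < K \<Longrightarrow> b < K \<Longrightarrow> ip n (v a) (v b) = of_bool (a = b)"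
    and Hx: "\<And>x l. l < n \<Longrightarrow> mv n H x l = (\<Sum>b<K. (d b * ip n (v b) x) * v b l)"
    and X: "\<And>l m. l < n \<Longrightarrow> m < n \<Longrightarrow> X l m = H l m + W l m"
    and symX: "\<And>l m. l < n \<Longrightarrow> m < n \<Longrightarrow> X l m = X m l"
    and W: "\<And>x. ip n (mv n W x) (mv n W x) \<le> e\<^sup>2 * ip n x x"
    and orthU: "\<And>a b. a < n \<Longrightarrow> b < n \<Longrightarrow> ip n (u a) (u b) = of_bool (a = b)"
    and U: "\<And>k l. k < n \<Longrightarrow> l < n \<Longrightarrow> mv n X (u k) l = \<delta> k * u k l"
    and ord: "\<And>a b. a \<le> b \<Longrightarrow> b < n \<Longrightarrow> \<bar>\<delta> b\<bar> \<le> \<bar>\<delta> a\<bar>"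
    and gap0: "\<And>k. k < K \<Longrightarrow> g \<le> d k" and gap: "\<And>a b. a < b \<Longrightarrow> b < K \<Longrightarrow> d b + g \<le> d a"
    and e: "0 \<le> e" "e \<le> g / 4" and g: "0 < g" and k: "k < K"
  shows "k < n" "\<bar>\<delta> k - d k\<bar> \<le> e" "1 - (ip n (v k) (u k))\<^sup>2 \<le> (2 * e / g)\<^sup>2"
    "\<And>a. a < K \<Longrightarrow> a \<noteq> k \<Longrightarrow> (ip n (v a) (u k))\<^sup>2 \<le> (2 * e / g)\<^sup>2"
proof -
  have sep: "g \<le> \<bar>d a - d b\<bar>" if "a < K" "b < K" "a \<noteq> b" for a b
    using gap[of a b] gap[of b a] that by (cases "a < b") auto
  have aux: "(\<Sum>b<K. (d b - \<delta> m)\<^sup>2 * (ip n (v b) (u m))\<^sup>2) + (\<delta> m)\<^sup>2 * (1 - (\<Sum>b<K. (ip n (v b) (u m))\<^sup>2)) \<le> e\<^sup>2"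
    if "m < n" for m
    using that by (intro eigvec_perturbation_aux[OF orthV Hx X W _ U]) (auto simp: orthU)
  have bes: "(\<Sum>b<K. (ip n (v b) (u m))\<^sup>2) \<le> 1" if "m < n" for m
    using Bessel[of "{..<K}" n v "u m"] orthV orthU[OF that that] by simp
  \<comment> \<open>In the orthonormal basis \<open>u\<close>, the vector
    \<open>W (v a) = (X - d a) (v a)\<close> has coordinates \<open>(\<delta> m - d a)\<close> times
    the overlaps. If all these factors exceeded \<open>e\<close> in modulus, its norm would exceed
    \<open>e\<close>.\<close>
  have near: "\<exists>m<n. \<bar>\<delta> m - d a\<bar> \<le> e" if a: "a < K" for a
  proof (rule ccontr)
    assume "\<not> ?thesis"
    then have far: "e\<^sup>2 < (\<delta> m - d a)\<^sup>2" if "m < n" for m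
      using that e(1) power_strict_mono[of e "\<bar>\<delta> m - d a\<bar>" 2] by (auto simp: not_le)
    have one: "(\<Sum>m<n. (ip n (u m) (v a))\<^sup>2) = 1"
      using Parseval[of n u "v a"] orthU orthV[OF a a] by simp
    have "mv n W (v a) l = mv n X (v a) l - d a * v a l" if "l < n" for l
    proof -
      have "mv n X (v a) l = mv n H (v a) l + mv n W (v a) l"
        using X that by (simp add: mv_def sum.distrib[symmetric] algebra_simps)
      moreover have "mv n H (v a) l = (\<Sum>b<K. if b = a then d a * v a l else 0)"
        unfolding Hx[OF that] using a by (intro sum.cong refl) (auto simp: orthV)
      ultimately show ?thesis using a by (simp add: sum.delta)
    qed
    then have um: "ip n (u m) (mv n W (v a)) = (\<delta> m - d a) * ip n (u m) (v a)" if "m < n" for m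
    proof -
      have "ip n (u m) (mv n W (v a)) = ip n (u m) (\<lambda>l. mv n X (v a) l - d a * v a l)"
        by (rule ip_cong) (auto simp: \<open>\<And>l. l < n \<Longrightarrow> mv n W (v a) l = _ l\<close>)
      also have "\<dots> = ip n (mv n X (u m)) (v a) - d a * ip n (u m) (v a)"
        by (simp add: ip_linear ip_mv_symmetric[OF symX])
      also have "ip n (mv n X (u m)) (v a) = ip n (\<lambda>l. \<delta> m * u m l) (v a)"
        by (rule ip_cong) (auto simp: U that)
      finally show ?thesis by (simp add: ip_linear algebra_simps)
    qed
    have "(\<Sum>m<n. (\<delta> m - d a)\<^sup>2 * (ip n (u m) (v a))\<^sup>2) = (\<Sum>m<n. (ip n (u m) (mv n W (v a)))\<^sup>2)"
      by (intro sum.cong refl) (simp add: um power_mult_distrib)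
    also have "\<dots> = ip n (mv n W (v a)) (mv n W (v a))" by (rule Parseval) (rule orthU)
    also have "\<dots> \<le> e\<^sup>2" using W[of "v a"] orthV[OF a a] by simp
    finally have le: "(\<Sum>m<n. ((\<delta> m - d a)\<^sup>2 - e\<^sup>2) * (ip n (u m) (v a))\<^sup>2) \<le> 0"
      using one by (simp add: left_diff_distrib sum_subtractf sum_distrib_left[symmetric])
    moreover have nn: "0 \<le> ((\<delta> m - d a)\<^sup>2 - e\<^sup>2) * (ip n (u m) (v a))\<^sup>2" if "m < n" for m
      using far[OF that] by simp
    ultimately have "(\<Sum>m<n. ((\<delta> m - d a)\<^sup>2 - e\<^sup>2) * (ip n (u m) (v a))\<^sup>2) = 0"
      by (intro antisym sum_nonneg) auto
    then have "\<forall>m\<in>{..<n}. ((\<delta> m - d a)\<^sup>2 - e\<^sup>2) * (ip n (u m) (v a))\<^sup>2 = 0"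
      by (subst (asm) sum_nonneg_eq_0_iff) (auto intro: nn)
    then have "\<forall>m\<in>{..<n}. (ip n (u m) (v a))\<^sup>2 = 0"
      using far by (metis lessThan_iff mult_eq_0_iff order_less_irrefl right_minus_eq)
    then show False using one by simp
  qed
  \<comment> \<open>The other \<open>d b\<close>, and also 0, are at distance at least
    \<open>g\<close> from \<open>d a\<close>, hence at least g - g / 4 from
    \<open>\<delta> m\<close>; \<open>g / 2\<close> is a convenient lower bound. The residual
    estimate then bounds the part of \<open>u m\<close> that is not along
    \<open>v a\<close>.\<close>
  have conc: "1 - (ip n (v a) (u m))\<^sup>2 \<le> (2 * e / g)\<^sup>2" if a: "a < K" and m: "m < n" and nr: "\<bar>\<delta> m - d a\<bar> \<le> e" for a m
  proof -
    have big: "(g / 2)\<^sup>2 \<le> (d b - \<delta> m)\<^sup>2" if "b < K" "b \<noteq> a" for b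
      using sep[of a b] that a nr e by (intro abs_le_square_iff[THEN iffD1]) (auto simp: abs_if split: if_splits)
    have big0: "(g / 2)\<^sup>2 \<le> (\<delta> m)\<^sup>2"
      using gap0[OF a] nr e g by (intro abs_le_square_iff[THEN iffD1]) (auto simp: abs_if split: if_splits)
    have split: "(\<Sum>b<K. f b) = f a + (\<Sum>b\<in>{..<K} - {a}. f b)" for f :: "nat \<Rightarrow> real"
      using a by (subst sum.remove[of _ a]) auto
    have "(g / 2)\<^sup>2 * (1 - (ip n (v a) (u m))\<^sup>2) =
       (\<Sum>b\<in>{..<K} - {a}. (g / 2)\<^sup>2 * (ip n (v b) (u m))\<^sup>2) + (g / 2)\<^sup>2 * (1 - (\<Sum>b<K. (ip n (v b) (u m))\<^sup>2))"
      by (simp add: split sum_distrib_left algebra_simps)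
    also have "\<dots> \<le> (\<Sum>b\<in>{..<K} - {a}. (d b - \<delta> m)\<^sup>2 * (ip n (v b) (u m))\<^sup>2) + (\<delta> m)\<^sup>2 * (1 - (\<Sum>b<K. (ip n (v b) (u m))\<^sup>2))"
      using bes[OF m] by (intro add_mono sum_mono mult_right_mono big big0) auto
    also have "\<dots> \<le> (\<Sum>b<K. (d b - \<delta> m)\<^sup>2 * (ip n (v b) (u m))\<^sup>2) + (\<delta> m)\<^sup>2 * (1 - (\<Sum>b<K. (ip n (v b) (u m))\<^sup>2))"
      by (intro add_right_mono sum_mono2) auto
    also have "\<dots> \<le> e\<^sup>2" by (rule aux[OF m])
    finally show ?thesis using g by (simp add: field_simps power2_eq_square)
  qed
  have small: "(2 * e / g)\<^sup>2 \<le> 1 / 4"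
  proof -
    have "2 * e / g \<le> 1 / 2" "0 \<le> 2 * e / g" using e g by (auto simp: field_simps)
    then have "(2 * e / g)\<^sup>2 \<le> (1 / 2)\<^sup>2" by (intro power_mono) auto
    then show ?thesis by (simp add: power2_eq_square)
  qed
  \<comment> \<open>Two eigenvectors near the same \<open>d a\<close> would each have squared
    overlap at least 3 / 4 with the unit vector \<open>v a\<close>, against
    \<open>Bessel\<close>.\<close>
  have uniq: "m = m'" if a: "a < K" and m: "m < n" "m' < n" and nr: "\<bar>\<delta> m - d a\<bar> \<le> e" "\<bar>\<delta> m' - d a\<bar> \<le> e" for a m m'
  proof (rule ccontr)
    assume ne: "m \<noteq> m'"
    have "(\<Sum>k\<in>{m, m'}. (ip n (u k) (v a))\<^sup>2) \<le> ip n (v a) (v a)"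
      by (rule Bessel) (use orthU m in auto)
    then have "(ip n (v a) (u m))\<^sup>2 + (ip n (v a) (u m'))\<^sup>2 \<le> 1"
      using ne orthV[OF a a] by (simp add: ip_commute[of n "v a" "u m"] ip_commute[of n "v a" "u m'"])
    then show False using conc[OF a m(1) nr(1)] conc[OF a m(2) nr(2)] small by linarith
  qed
  \<comment> \<open>If \<open>\<delta> m\<close> were far from every \<open>d b\<close> and from 0,
    all squared coefficients in the residual estimate would exceed \<open>e\<^sup>2\<close>,
    although their weights sum to 1.\<close>
  have classify: "\<exists>b<K. \<bar>\<delta> m - d b\<bar> \<le> e" if m: "m < n" and big: "e < \<bar>\<delta> m\<bar>" for m
  proof (rule ccontr)
    assume "\<not> ?thesis"
    then have "e < \<bar>d b - \<delta> m\<bar>" if "b < K" for b using that by (auto simp: not_le abs_minus_commute)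
    then have far: "e\<^sup>2 < (d b - \<delta> m)\<^sup>2" if "b < K" for b
      using that e(1) power_strict_mono[of e "\<bar>d b - \<delta> m\<bar>" 2] by auto
    have far0: "e\<^sup>2 < (\<delta> m)\<^sup>2" using big e(1) power_strict_mono[of e "\<bar>\<delta> m\<bar>" 2] by auto
    have "(\<Sum>b<K. ((d b - \<delta> m)\<^sup>2 - e\<^sup>2) * (ip n (v b) (u m))\<^sup>2) + ((\<delta> m)\<^sup>2 - e\<^sup>2) * (1 - (\<Sum>b<K. (ip n (v b) (u m))\<^sup>2)) \<le> 0"
      using aux[OF m] by (simp add: algebra_simps sum_subtractf sum_distrib_left)
    moreover have nn: "0 \<le> ((d b - \<delta> m)\<^sup>2 - e\<^sup>2) * (ip n (v b) (u m))\<^sup>2" if "b < K" for b using far[OF that] by simp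
    have s0: "0 \<le> (\<Sum>b<K. ((d b - \<delta> m)\<^sup>2 - e\<^sup>2) * (ip n (v b) (u m))\<^sup>2)" by (intro sum_nonneg) (auto intro: nn)
    moreover have t0: "0 \<le> ((\<delta> m)\<^sup>2 - e\<^sup>2) * (1 - (\<Sum>b<K. (ip n (v b) (u m))\<^sup>2))" using far0 bes[OF m] by simp
    ultimately have z: "(\<Sum>b<K. ((d b - \<delta> m)\<^sup>2 - e\<^sup>2) * (ip n (v b) (u m))\<^sup>2) = 0"
      "((\<delta> m)\<^sup>2 - e\<^sup>2) * (1 - (\<Sum>b<K. (ip n (v b) (u m))\<^sup>2)) = 0" by linarith+
    have "\<forall>b\<in>{..<K}. ((d b - \<delta> m)\<^sup>2 - e\<^sup>2) * (ip n (v b) (u m))\<^sup>2 = 0"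
      using z(1) by (subst (asm) sum_nonneg_eq_0_iff) (auto intro: nn)
    then have "\<forall>b\<in>{..<K}. (ip n (v b) (u m))\<^sup>2 = 0"
      using far by (metis lessThan_iff mult_eq_0_iff order_less_irrefl right_minus_eq)
    then have "(\<Sum>b<K. (ip n (v b) (u m))\<^sup>2) = 0" by simp
    then show False using z(2) far0 by simp
  qed
  obtain f where f: "\<And>a. a < K \<Longrightarrow> f a < n" "\<And>a. a < K \<Longrightarrow> \<bar>\<delta> (f a) - d a\<bar> \<le> e" using near by metis
  have pos: "e < \<delta> (f a)" if "a < K" for a using f(2)[OF that] gap0[OF that] e g by linarith
  have fmono: "f a < f b" if "a < b" "b < K" for a b
  proof (rule ccontr)
    assume "\<not> f a < f b"
    then have "\<bar>\<delta> (f a)\<bar> \<le> \<bar>\<delta> (f b)\<bar>" using f(1)[of a] that by (intro ord) auto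
    then have "\<delta> (f a) \<le> \<delta> (f b)" using pos[of a] pos[of b] that e by simp
    then show False using f(2)[of a] f(2)[of b] gap[OF that] that e g by simp
  qed
  have ge: "a \<le> f a" if "a < K" for a using that
  proof (induction a)
    case (Suc a)
    then show ?case using fmono[of a "Suc a"] by linarith
  qed simp
  \<comment> \<open>An index below \<open>f a\<close> carries an eigenvalue at least as large in
    modulus, so it is classified as some \<open>f b\<close>, and the monotonicity of
    \<open>f\<close> forces \<open>b < a\<close>. There are only \<open>a\<close> such
    indices.\<close>
  have le: "f a \<le> a" if a: "a < K" for a
  proof -
    have "{..<f a} \<subseteq> f ` {..<a}"
    proof
      fix m assume m: "m \<in> {..<f a}"
      then have mn: "m < n" using f(1)[OF a] by simp
      have dm: "\<bar>\<delta> (f a)\<bar> \<le> \<bar>\<delta> m\<bar>" using m f(1)[OF a] by (intro ord) auto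
      then have "e < \<bar>\<delta> m\<bar>" using pos[OF a] by simp
      from classify[OF mn this] obtain b where b: "b < K" "\<bar>\<delta> m - d b\<bar> \<le> e" by blast
      have mb: "m = f b" by (rule uniq[OF b(1) mn f(1)[OF b(1)] b(2) f(2)[OF b(1)]])
      have "b < a"
      proof (rule ccontr)
        assume "\<not> b < a"
        then have "a < b \<or> a = b" by linarith
        then have "f a \<le> f b" using fmono[of a b] b by auto
        then show False using m mb by simp
      qed
      then show "m \<in> f ` {..<a}" using mb by blast
    qed
    then have "card {..<f a} \<le> card (f ` {..<a})" by (intro card_mono) auto
    also have "\<dots> \<le> a" using card_image_le[of "{..<a}" f] by simp
    finally show ?thesis by simp
  qed
  have fk: "f k = k" using ge[OF k] le[OF k] by simp
  show kn: "k < n" using f(1)[OF k] fk by simp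
  show nk: "\<bar>\<delta> k - d k\<bar> \<le> e" using f(2)[OF k] fk by simp
  show c: "1 - (ip n (v k) (u k))\<^sup>2 \<le> (2 * e / g)\<^sup>2" by (rule conc[OF k kn nk])
  fix a assume a: "a < K" "a \<noteq> k"
  have "(\<Sum>b\<in>{a, k}. (ip n (v b) (u k))\<^sup>2) \<le> ip n (u k) (u k)"
    by (rule Bessel) (use orthV a k in auto)
  then show "(ip n (v a) (u k))\<^sup>2 \<le> (2 * e / g)\<^sup>2" using a c orthU[OF kn kn] by simp
qed

lemma eigvec_expansion:
  fixes K n :: nat
  assumes Hx: "\<And>l. l < n \<Longrightarrow> mv n H u l = (\<Sum>b<K. (d b * ip n (v b) u) * v b l)"
    and X: "\<And>l m. l < n \<Longrightarrow> m < n \<Longrightarrow> X l m = H l m + W l m"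
    and U: "\<And>l. l < n \<Longrightarrow> mv n X u l = \<delta> * u l" and nz: "\<delta> \<noteq> 0" and l: "l < n"
  shows "u l = (\<Sum>p<N. \<Sum>a<K. d a * ip n (v a) u / \<delta> ^ Suc p * (mv n W ^^ p) (v a) l) + (mv n W ^^ N) u l / \<delta> ^ N"
proof (induction N)
  case (Suc N)
  \<comment> \<open>One more substitution of \<open>u = (H u + W u) / \<delta>\<close>. The two
    summands are indexed by \<open>{0, Suc 0}\<close> so that \<open>mv_pow_linear\<close> applies
    to them.\<close>
  have "u m = (\<Sum>a\<in>{0, Suc 0}. 1 / \<delta> * (if a = 0 then (\<lambda>l. \<Sum>b<K. (d b * ip n (v b) u) * v b l) else mv n W u) m)"
    if "m < n" for m
  proof -
    have "mv n X u m = mv n H u m + mv n W u m"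
      using X that by (simp add: mv_def sum.distrib[symmetric] algebra_simps)
    then show ?thesis using U[OF that] Hx[OF that] nz by (simp add: field_simps)
  qed
  from mv_pow_linear[OF _ l this, where W = W and p = N]
  have "(mv n W ^^ N) u l = 1 / \<delta> * (mv n W ^^ N) (\<lambda>l. \<Sum>b<K. (d b * ip n (v b) u) * v b l) l + 1 / \<delta> * (mv n W ^^ N) (mv n W u) l"
    by simp
  also have "(mv n W ^^ N) (mv n W u) l = (mv n W ^^ Suc N) u l" by (simp add: funpow_swap1)
  also have "(mv n W ^^ N) (\<lambda>l. \<Sum>b<K. (d b * ip n (v b) u) * v b l) l = (\<Sum>b<K. (d b * ip n (v b) u) * (mv n W ^^ N) (v b) l)"
    by (rule mv_pow_linear[OF _ l]) auto
  finally have "(mv n W ^^ N) u l / \<delta> ^ N = (\<Sum>a<K. d a * ip n (v a) u / \<delta> ^ Suc N * (mv n W ^^ N) (v a) l) + (mv n W ^^ Suc N) u l / \<delta> ^ Suc N"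
    by (simp add: sum_distrib_left add_divide_distrib sum_divide_distrib field_simps del: funpow.simps)
  then show ?case using Suc by (simp del: funpow.simps power_Suc)
qed simp

section \<open>Whitening\<close>

text \<open>A Gram-Schmidt step for the inner product given by \<open>S\<close>, started from a
  coordinate vector outside the span of the \<open>k\<close> vectors already found.\<close>

lemma bil_orthonormal_extend:
  assumes sym: "\<And>a b. a < K \<Longrightarrow> b < K \<Longrightarrow> S a b = S b a"
    and pos: "\<And>x. c * ip K x x \<le> qform K S x" and c: "0 < c"
    and orth: "\<And>a b. a < k \<Longrightarrow> b < k \<Longrightarrow> bil K S (r a) (r b) = of_bool (a = b)" and k: "k < K"
  shows "\<exists>y. bil K S y y = 1 \<and> (\<forall>a<k. bil K S (r a) y = 0)"
proof -
  define ev where "ev = (\<lambda>(m::nat) l. of_bool (l = m) :: real)"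
  define x where "x = (\<lambda>m l. ev m l - (\<Sum>a<k. bil K S (r a) (ev m) * r a l))"
  have bev: "bil K S y (ev m) = (\<Sum>a<K. y a * S a m)" if "m < K" for y m
    using that by (simp add: bil_def ev_def of_bool_def if_distrib sum.delta cong: if_cong)
  have "\<exists>m<K. \<exists>l<K. x m l \<noteq> 0"
  proof (rule ccontr)
    assume "\<not> ?thesis"
    then have z: "x m m = 0" if "m < K" for m using that by blast
    \<comment> \<open>If every coordinate vector equalled its projection onto the span, the
      projection would be the identity; its trace is K on one side and \<open>k\<close> on the
      other.\<close>
    have "real K = (\<Sum>m<K. \<Sum>a<k. bil K S (r a) (ev m) * r a m)"
      using z by (simp add: x_def ev_def)
    also have "\<dots> = (\<Sum>a<k. \<Sum>m<K. bil K S (r a) (ev m) * r a m)" by (rule sum.swap)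
    also have "\<dots> = (\<Sum>a<k. bil K S (r a) (r a))"
    proof (rule sum.cong[OF refl])
      fix a
      have "(\<Sum>m<K. bil K S (r a) (ev m) * r a m) = (\<Sum>m<K. \<Sum>l<K. r a l * S l m * r a m)"
        by (intro sum.cong refl) (simp add: bev sum_distrib_right)
      also have "\<dots> = bil K S (r a) (r a)" unfolding bil_def by (rule sum.swap)
      finally show "(\<Sum>m<K. bil K S (r a) (ev m) * r a m) = bil K S (r a) (r a)" .
    qed
    also have "\<dots> = real k" by (simp add: orth)
    finally show False using k by simp
  qed
  then obtain m l where ml: "m < K" "l < K" "x m l \<noteq> 0" by blast
  define s where "s = bil K S (x m) (x m)"
  have "ip K (x m) (x m) \<noteq> 0" using ip_eq_0D[of K "x m" l] ml by blast
  then have "0 < c * ip K (x m) (x m)" using ip_nonneg[of K "x m"] c by (simp add: less_le)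
  then have s: "s > 0" using pos[of "x m"] by (simp add: s_def qform_eq_bil)
  have rx: "bil K S (r b) (x m) = 0" if b: "b < k" for b
  proof -
    have "bil K S (r b) (x m) = bil K S (r b) (ev m) - (\<Sum>a<k. bil K S (r a) (ev m) * bil K S (r b) (r a))"
      unfolding x_def by (simp add: bil_linear)
    also have "(\<Sum>a<k. bil K S (r a) (ev m) * bil K S (r b) (r a)) = (\<Sum>a<k. if a = b then bil K S (r b) (ev m) else 0)"
      by (intro sum.cong refl) (auto simp: orth b)
    finally show ?thesis using b by (simp add: sum.delta)
  qed
  have "bil K S (\<lambda>l. (1 / sqrt s) * x m l) (\<lambda>l. (1 / sqrt s) * x m l) = 1"
    unfolding bil_scale_left bil_scale_right using s by (simp add: s_def[symmetric] field_simps)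
  moreover have "bil K S (r a) (\<lambda>l. (1 / sqrt s) * x m l) = 0" if "a < k" for a
    unfolding bil_scale_right using rx[OF that] by simp
  ultimately show ?thesis by blast
qed

lemma bil_orthonormal_basis:
  assumes sym: "\<And>a b. a < K \<Longrightarrow> b < K \<Longrightarrow> S a b = S b a"
    and pos: "\<And>x. c * ip K x x \<le> qform K S x" and c: "0 < c"
    and r0: "bil K S r0 r0 = 1" and k: "1 \<le> k" "k \<le> K"
  shows "\<exists>r. r 0 = r0 \<and> (\<forall>a<k. \<forall>b<k. bil K S (r a) (r b) = of_bool (a = b))"
  using k
proof (induction k rule: dec_induct)
  case base
  then show ?case using r0 by (intro exI[of _ "\<lambda>_. r0"]) auto
next
  case (step k)
  then obtain r where r: "r 0 = r0" "\<And>a b. a < k \<Longrightarrow> b < k \<Longrightarrow> bil K S (r a) (r b) = of_bool (a = b)" by auto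
  obtain y where y: "bil K S y y = 1" "\<And>a. a < k \<Longrightarrow> bil K S (r a) y = 0"
    using bil_orthonormal_extend[of K S c k r, OF sym pos c r(2)] step by auto
  have y': "bil K S y (r a) = 0" if "a < k" for a
    using y(2)[OF that] bil_commute[of K S y "r a", OF sym] by simp
  show ?case using r y y' step
    by (intro exI[of _ "r(k := y)"]) (auto simp: less_Suc_eq)
qed

text \<open>Basis vectors \<open>r a\<close> diagonalising \<open>S\<inverse>\<close>, the first of which points along the shift \<open>D\<close>: the
  noncentral chi-square law then has its noncentrality in the first coordinate.\<close>

lemma whitening_basis:
  assumes K: "1 \<le> K" and sym: "\<And>a b. a < K \<Longrightarrow> b < K \<Longrightarrow> S a b = S b a"
    and pos: "\<And>x. c * ip K x x \<le> qform K S x" and c: "0 < c"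
    and inv: "\<And>a b. a < K \<Longrightarrow> b < K \<Longrightarrow> (\<Sum>m<K. S a m * T m b) = of_bool (a = b)"
  obtains r where "\<And>a b. a < K \<Longrightarrow> b < K \<Longrightarrow> bil K S (r a) (r b) = of_bool (a = b)"
    "\<And>a. a < K \<Longrightarrow> ip K (r a) D = (if a = 0 then sqrt (qform K T D) else 0)"
    "\<And>x. qform K T x = (\<Sum>a<K. (ip K (r a) x)\<^sup>2)"
    "0 \<le> qform K T D"
proof -
  define Ti where "Ti = (\<lambda>x a. \<Sum>b<K. T a b * x b)"
  have STi: "(\<Sum>m<K. S a m * Ti x m) = x a" if "a < K" for a x
  proof -
    have "(\<Sum>m<K. S a m * Ti x m) = (\<Sum>m<K. \<Sum>b<K. S a m * T m b * x b)"
      by (simp add: Ti_def sum_distrib_left mult.assoc)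
    also have "\<dots> = (\<Sum>b<K. \<Sum>m<K. S a m * T m b * x b)" by (rule sum.swap)
    also have "\<dots> = (\<Sum>b<K. if b = a then x a else 0)"
      using that by (intro sum.cong refl) (auto simp: sum_distrib_right[symmetric] inv)
    finally show ?thesis using that by (simp add: sum.delta)
  qed
  have qT: "qform K T x = ip K x (Ti x)" for x
    by (simp add: qform_eq_bil bil_eq_ip Ti_def)
  have bTi: "bil K S y (Ti x) = ip K y x" for x y
    unfolding bil_eq_ip by (rule ip_cong) (auto simp: STi)
  have qTb: "qform K T x = bil K S (Ti x) (Ti x)" for x
    by (simp add: qT bTi ip_commute)
  have qT0: "0 \<le> qform K T x" for x
  proof -
    have "0 \<le> c * ip K (Ti x) (Ti x)" using c by simp
    also have "\<dots> \<le> qform K T x" using pos[of "Ti x"] by (simp add: qTb qform_eq_bil[of K S])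
    finally show ?thesis .
  qed
  define q where "q = qform K T D"
  \<comment> \<open>The vector wanted is S^-1 D divided by its \<open>S\<close>-norm: being
    \<open>S\<close>-orthogonal to it is the same as being orthogonal to \<open>D\<close>. If
    \<open>q = 0\<close> then \<open>D\<close> vanishes and any \<open>S\<close>-unit vector
    serves.\<close>
  have "\<exists>r0. bil K S r0 r0 = 1 \<and> ip K r0 D = sqrt q \<and> (\<forall>y. bil K S y r0 = 0 \<longrightarrow> ip K y D = 0)"
  proof (cases "q = 0")
    case True
    then have "ip K (Ti D) (Ti D) = 0"
      using pos[of "Ti D"] c ip_nonneg[of K "Ti D"] by (simp add: q_def qTb qform_eq_bil[of K S] mult_le_0_iff)
    then have "Ti D a = 0" if "a < K" for a using ip_eq_0D that by blast
    then have D0: "D a = 0" if "a < K" for a using STi[OF that, of D] by simp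
    have ipD: "ip K y D = 0" for y using D0 by (simp add: ip_def)
    obtain y where "bil K S y y = 1"
      using bil_orthonormal_extend[of K S c 0 "\<lambda>_ _. 0", OF sym pos c] K by auto
    then show ?thesis using ipD True by auto
  next
    case False
    then have q: "q > 0" using qT0[of D] by (simp add: q_def)
    define r0 where "r0 = (\<lambda>l. (1 / sqrt q) * Ti D l)"
    have br: "bil K S y r0 = (1 / sqrt q) * ip K y D" for y
      unfolding r0_def bil_scale_right bTi ..
    have ipD: "ip K r0 D = sqrt q"
      unfolding r0_def ip_scale_left using q qT[of D] by (simp add: ip_commute q_def[symmetric] real_div_sqrt)
    have "bil K S r0 r0 = 1" unfolding br ipD using q by simp
    then show ?thesis using ipD br q by (intro exI[of _ r0]) auto
  qed
  then obtain r0 where r0: "bil K S r0 r0 = 1" "ip K r0 D = sqrt q" "\<And>y. bil K S y r0 = 0 \<Longrightarrow> ip K y D = 0" by blast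
  obtain r where r: "r 0 = r0" "\<And>a b. a < K \<Longrightarrow> b < K \<Longrightarrow> bil K S (r a) (r b) = of_bool (a = b)"
    using bil_orthonormal_basis[of K S c r0 K, OF sym pos c r0(1) K] by auto
  have "ip K (r a) D = (if a = 0 then sqrt (qform K T D) else 0)" if "a < K" for a
    using r0(2,3) r(1) r(2)[OF that, of 0] K by (auto simp: q_def)
  moreover have "qform K T x = (\<Sum>a<K. (ip K (r a) x)\<^sup>2)" for x
  proof -
    \<comment> \<open>Column \<open>b\<close> of \<open>B\<close> is \<open>S\<close> applied to
      \<open>r b\<close>. Orthonormality says that these columns form the basis dual to
      \<open>r\<close>, and both triangular orders of the inverse hold, so every \<open>x\<close>
      expands as the sum of \<open>ip K (r b) x\<close> times column \<open>b\<close>.\<close>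
    define B where "B = (\<lambda>k b. \<Sum>l<K. S k l * r b l)"
    have "(\<Sum>l<K. r a l * B l b) = of_bool (a = b)" if "a < K" "b < K" for a b
      using r(2)[OF that] by (simp add: bil_eq_ip ip_def B_def)
    from left_right_inverse[OF this]
    have BA: "(\<Sum>l<K. B a l * r l b) = of_bool (a = b)" if "a < K" "b < K" for a b using that by auto
    have xB: "x k = (\<Sum>b<K. B k b * ip K (r b) x)" if "k < K" for k
    proof -
      have "(\<Sum>b<K. B k b * ip K (r b) x) = (\<Sum>b<K. \<Sum>m<K. B k b * r b m * x m)"
        by (simp add: ip_def sum_distrib_left mult.assoc)
      also have "\<dots> = (\<Sum>m<K. \<Sum>b<K. B k b * r b m * x m)" by (rule sum.swap)
      also have "\<dots> = (\<Sum>m<K. if m = k then x k else 0)"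
        using that by (intro sum.cong refl) (auto simp: sum_distrib_right[symmetric] BA)
      finally show ?thesis using that by (simp add: sum.delta)
    qed
    have "qform K T x = ip K (Ti x) (\<lambda>k. \<Sum>b<K. ip K (r b) x * B k b)"
      unfolding qT ip_commute[of K x] by (rule ip_cong) (use xB in \<open>auto simp: mult.commute\<close>)
    also have "\<dots> = (\<Sum>b<K. ip K (r b) x * ip K (Ti x) (\<lambda>k. B k b))" by (simp add: ip_linear)
    also have "\<dots> = (\<Sum>b<K. (ip K (r b) x)\<^sup>2)"
    proof (rule sum.cong[OF refl])
      fix b
      have "ip K (Ti x) (\<lambda>k. B k b) = bil K S (Ti x) (r b)" by (simp add: bil_eq_ip B_def)
      also have "\<dots> = bil K S (r b) (Ti x)" by (rule bil_commute) (rule sym)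
      also have "\<dots> = ip K (r b) x" by (rule bTi)
      finally show "ip K (r b) x * ip K (Ti x) (\<lambda>k. B k b) = (ip K (r b) x)\<^sup>2" by (simp add: power2_eq_square)
    qed
    finally show ?thesis .
  qed
  ultimately show thesis using that[of r] r(2) qT0[of D] by blast
qed

text \<open>An upper bound \<open>S \<le> c\<close> gives a lower bound 1 / c for the inverse:
  evaluate the nonnegative form of \<open>S\<close> at \<open>x - c * y\<close> with
  \<open>y = T x\<close>. Only semidefiniteness of \<open>S\<close> is assumed, so the bound is
  available for the diverging alternative, where (C3) is not imposed.\<close>

lemma norm_sq_le_qform_inverse:
  assumes sym: "\<And>a b. a < K \<Longrightarrow> b < K \<Longrightarrow> S a b = S b a"
    and psd: "\<And>x. 0 \<le> qform K S x" and up: "\<And>x. qform K S x \<le> c * ip K x x"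
    and inv: "\<And>a b. a < K \<Longrightarrow> b < K \<Longrightarrow> (\<Sum>m<K. S a m * T m b) = of_bool (a = b)" and c: "0 < c"
  shows "ip K x x \<le> c * qform K T x"
proof -
  define y where "y = (\<lambda>a. \<Sum>b<K. T a b * x b)"
  have Sy: "(\<Sum>m<K. S a m * y m) = x a" if "a < K" for a
  proof -
    have "(\<Sum>m<K. S a m * y m) = (\<Sum>m<K. \<Sum>b<K. S a m * T m b * x b)"
      by (simp add: y_def sum_distrib_left mult.assoc)
    also have "\<dots> = (\<Sum>b<K. \<Sum>m<K. S a m * T m b * x b)" by (rule sum.swap)
    also have "\<dots> = (\<Sum>b<K. if b = a then x a else 0)"
      using that by (intro sum.cong refl) (auto simp: sum_distrib_right[symmetric] inv)
    finally show ?thesis using that by (simp add: sum.delta)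
  qed
  have qT: "qform K T x = ip K x y" by (simp add: qform_eq_bil bil_eq_ip y_def)
  have zy: "bil K S z y = ip K z x" for z unfolding bil_eq_ip by (rule ip_cong) (auto simp: Sy)
  have yb: "bil K S y z = ip K z x" for z using zy[of z] bil_commute[of K S y z, OF sym] by simp
  have "0 \<le> qform K S (\<lambda>l. x l - c * y l)" by (rule psd)
  also have "\<dots> = qform K S x - 2 * c * ip K x x + c * c * qform K T x"
    by (simp add: qform_eq_bil bil_linear zy yb qT[unfolded qform_eq_bil] ip_commute[of K y x])
  also have "\<dots> \<le> c * ip K x x - 2 * c * ip K x x + c * c * qform K T x" using up by simp
  finally have "c * ip K x x \<le> c * (c * qform K T x)" by simp
  then show ?thesis using c by simp
qed

section \<open>The mixed membership model\<close>

text \<open>The model at one fixed \<open>n\<close>, with (C2) in the form of coercivity.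
  \<open>theta\<close> may exceed 1; the bound 1 on the entries of H is added separately where it is
  used.\<close>

locale mm_model =
  fixes n K :: nat and theta :: real and Pm P V :: "nat \<Rightarrow> nat \<Rightarrow> real" and d :: "nat \<Rightarrow> real" and c0 :: real
  assumes theta_pos: "0 < theta" and c0: "0 < c0" and n0: "0 < n"
    and Pi_nonneg: "\<And>l k. l < n \<Longrightarrow> k < K \<Longrightarrow> 0 \<le> Pm l k"
    and Pi_sum: "\<And>l. l < n \<Longrightarrow> (\<Sum>k<K. Pm l k) = 1"
    and P01: "\<And>a b. a < K \<Longrightarrow> b < K \<Longrightarrow> 0 \<le> P a b \<and> P a b \<le> 1"
    and P_sym: "\<And>a b. a < K \<Longrightarrow> b < K \<Longrightarrow> P a b = P b a"
    and P_coercive: "\<And>x. c0 * ip K x x \<le> qform K P x"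
    and G_coercive: "\<And>x. c0 * real n * ip K x x \<le> qform K (\<lambda>a b. \<Sum>l<n. Pm l a * Pm l b) x"
    and decomp: "H_eigdecomp n K (Hmat K theta Pm P) V d"
begin

abbreviation "H \<equiv> Hmat K theta Pm P"
abbreviation "v k \<equiv> (\<lambda>l. V l k)"

lemma H_bounds: assumes "l < n" "m < n" shows "0 \<le> H l m" "H l m \<le> theta"
proof -
  have "0 \<le> (\<Sum>a<K. \<Sum>b<K. Pm l a * P a b * Pm m b)"
    using assms by (intro sum_nonneg mult_nonneg_nonneg) (auto simp: Pi_nonneg P01)
  then show "0 \<le> H l m" using theta_pos by (simp add: Hmat_def)
  have "(\<Sum>a<K. \<Sum>b<K. Pm l a * P a b * Pm m b) \<le> (\<Sum>a<K. \<Sum>b<K. Pm l a * 1 * Pm m b)"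
    using assms by (intro sum_mono mult_right_mono mult_left_mono) (auto simp: Pi_nonneg P01)
  also have "\<dots> = (\<Sum>a<K. Pm l a) * (\<Sum>b<K. Pm m b)" by (simp add: sum_product)
  also have "\<dots> = 1" using assms by (simp add: Pi_sum)
  finally show "H l m \<le> theta" using theta_pos by (simp add: Hmat_def)
qed

lemma H_sym: "H l m = H m l"
proof -
  have "(\<Sum>a<K. \<Sum>b<K. Pm l a * P a b * Pm m b) = (\<Sum>a<K. \<Sum>b<K. Pm m b * P b a * Pm l a)"
    by (intro sum.cong refl) (auto simp: P_sym)
  also have "\<dots> = (\<Sum>b<K. \<Sum>a<K. Pm m b * P b a * Pm l a)" by (rule sum.swap)
  finally show ?thesis by (simp add: Hmat_def)
qed

lemma orthV: "a < K \<Longrightarrow> b < K \<Longrightarrow> ip n (v a) (v b) = of_bool (a = b)"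
  using decomp by (auto simp: H_eigdecomp_def ip_def)

lemma H_decomp: "l < n \<Longrightarrow> m < n \<Longrightarrow> H l m = (\<Sum>k<K. V l k * d k * V m k)"
  using decomp by (auto simp: H_eigdecomp_def)

lemma mv_H: assumes "l < n" shows "mv n H x l = (\<Sum>b<K. (d b * ip n (v b) x) * v b l)"
proof -
  have "mv n H x l = (\<Sum>m<n. \<Sum>k<K. V l k * d k * V m k * x m)"
    using assms by (simp add: mv_def H_decomp sum_distrib_right)
  also have "\<dots> = (\<Sum>k<K. \<Sum>m<n. V l k * d k * V m k * x m)" by (rule sum.swap)
  also have "\<dots> = (\<Sum>b<K. (d b * ip n (v b) x) * v b l)"
    by (intro sum.cong refl) (simp add: ip_def sum_distrib_left sum_distrib_right mult_ac)
  finally show ?thesis .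
qed

lemma H_eigvec: assumes "l < n" "k < K" shows "mv n H (v k) l = d k * V l k"
proof -
  have "mv n H (v k) l = (\<Sum>b<K. if b = k then d k * V l k else 0)"
    unfolding mv_H[OF assms(1)] by (intro sum.cong refl) (use assms in \<open>auto simp: orthV\<close>)
  then show ?thesis using assms by (simp add: sum.delta)
qed

lemma mv_H_Pi: "mv n H x l = theta * (\<Sum>a<K. Pm l a * (\<Sum>b<K. P a b * (\<Sum>m<n. Pm m b * x m)))"
proof -
  have "mv n H x l = theta * (\<Sum>m<n. \<Sum>a<K. \<Sum>b<K. Pm l a * P a b * Pm m b * x m)"
    by (simp add: mv_def Hmat_def sum_distrib_left sum_distrib_right mult_ac)
  also have "(\<Sum>m<n. \<Sum>a<K. \<Sum>b<K. Pm l a * P a b * Pm m b * x m) = (\<Sum>a<K. \<Sum>m<n. \<Sum>b<K. Pm l a * P a b * Pm m b * x m)"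
    by (rule sum.swap)
  also have "\<dots> = (\<Sum>a<K. \<Sum>b<K. \<Sum>m<n. Pm l a * P a b * Pm m b * x m)"
    by (rule sum.cong[OF refl]) (rule sum.swap)
  finally show ?thesis by (simp add: sum_distrib_left mult.assoc)
qed

lemma Pi_sq: "(\<Sum>l<n. (\<Sum>a<K. Pm l a * y a)\<^sup>2) = qform K (\<lambda>a b. \<Sum>l<n. Pm l a * Pm l b) y"
proof -
  have "(\<Sum>l<n. (\<Sum>a<K. Pm l a * y a)\<^sup>2) = (\<Sum>l<n. \<Sum>a<K. \<Sum>b<K. y a * (Pm l a * Pm l b) * y b)"
    by (simp add: power2_eq_square sum_product mult_ac)
  also have "\<dots> = (\<Sum>a<K. \<Sum>l<n. \<Sum>b<K. y a * (Pm l a * Pm l b) * y b)" by (rule sum.swap)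
  also have "\<dots> = (\<Sum>a<K. \<Sum>b<K. \<Sum>l<n. y a * (Pm l a * Pm l b) * y b)"
    by (rule sum.cong[OF refl]) (rule sum.swap)
  finally show ?thesis by (simp add: qform_def sum_distrib_left sum_distrib_right)
qed

text \<open>With u = Pi^T v_k the eigenvalue is theta * u^T P u, at least \<open>theta * c0\<close>
  times the squared norm of u. As v_k lies in the column space of Pi, v_k = Pi b; then u and b have
  inner product 1 while \<open>c0 * n\<close> times the squared norm of b is at most 1, so u has
  squared norm at least \<open>c0 * n\<close>. Positivity of the eigenvalue comes for free.\<close>

lemma d_lower: assumes k: "k < K" shows "c0\<^sup>2 * (real n * theta) \<le> d k"
proof -
  define u where "u = (\<lambda>a. \<Sum>l<n. Pm l a * V l k)"
  define y where "y = (\<lambda>a. \<Sum>b<K. P a b * u b)"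
  have mvH: "mv n H (v k) l = theta * (\<Sum>a<K. Pm l a * y a)" for l
    by (simp add: mv_H_Pi y_def u_def)
  have vk: "ip n (v k) (v k) = 1" using orthV[OF k k] by simp
  have vy: "(\<Sum>l<n. V l k * (\<Sum>a<K. Pm l a * x a)) = ip K u x" for x
  proof -
    have "(\<Sum>l<n. V l k * (\<Sum>a<K. Pm l a * x a)) = (\<Sum>l<n. \<Sum>a<K. Pm l a * V l k * x a)"
      by (simp add: sum_distrib_left mult_ac)
    also have "\<dots> = (\<Sum>a<K. \<Sum>l<n. Pm l a * V l k * x a)" by (rule sum.swap)
    finally show ?thesis by (simp add: ip_def u_def sum_distrib_right)
  qed
  have "d k = ip n (v k) (mv n H (v k))"
  proof -
    have "ip n (v k) (mv n H (v k)) = ip n (v k) (\<lambda>l. d k * V l k)"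
      by (rule ip_cong) (auto simp: H_eigvec k)
    then show ?thesis using vk by (simp add: ip_scale_right)
  qed
  also have "\<dots> = theta * ip K u y"
    unfolding ip_def[of n] mvH vy[of y, symmetric] sum_distrib_left[of theta _ "{..<n}"]
    by (simp only: mult.left_commute)
  also have "ip K u y = qform K P u" by (simp add: qform_eq_bil bil_eq_ip y_def)
  finally have dk: "d k = theta * qform K P u" .
  have dpos: "d k \<noteq> 0" using decomp k by (auto simp: H_eigdecomp_def)
  define b where "b = (\<lambda>a. theta / d k * y a)"
  have Vb: "V l k = (\<Sum>a<K. Pm l a * b a)" if "l < n" for l
  proof -
    have "d k * V l k = theta * (\<Sum>a<K. Pm l a * y a)" using H_eigvec[OF that k] mvH by simp
    then have "V l k = theta / d k * (\<Sum>a<K. Pm l a * y a)" using dpos by (simp add: field_simps)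
    then show ?thesis by (simp add: b_def sum_distrib_left mult_ac)
  qed
  have "ip n (v k) (v k) = (\<Sum>l<n. V l k * (\<Sum>a<K. Pm l a * b a))"
    unfolding ip_def by (intro sum.cong refl) (use Vb in auto)
  then have ub: "ip K u b = 1" using vk vy[of b] by simp
  have "ip n (v k) (v k) = (\<Sum>l<n. (\<Sum>a<K. Pm l a * b a)\<^sup>2)"
    unfolding ip_def by (intro sum.cong refl) (use Vb in \<open>auto simp: power2_eq_square\<close>)
  then have b1: "c0 * real n * ip K b b \<le> 1" using G_coercive[of b] vk by (simp add: Pi_sq)
  have "1 \<le> ip K u u * ip K b b" using ip_Cauchy_Schwarz[of K u b] ub by simp
  then have "c0 * real n * 1 \<le> c0 * real n * (ip K u u * ip K b b)" using c0 by (intro mult_left_mono) auto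
  also have "\<dots> = ip K u u * (c0 * real n * ip K b b)" by simp
  also have "\<dots> \<le> ip K u u * 1" using b1 by (intro mult_left_mono) auto
  finally have u: "c0 * real n \<le> ip K u u" by simp
  have "c0\<^sup>2 * (real n * theta) = theta * (c0 * (c0 * real n))" by (simp add: power2_eq_square)
  also have "\<dots> \<le> theta * (c0 * ip K u u)" using u c0 theta_pos by (intro mult_left_mono) auto
  also have "\<dots> \<le> theta * qform K P u" using P_coercive[of u] theta_pos by (intro mult_left_mono) auto
  finally show ?thesis using dk by simp
qed

lemma nt_pos: "0 < real n * theta" using n0 theta_pos by simp

lemma d_pos: "k < K \<Longrightarrow> 0 < d k"
  using d_lower[of k] c0 nt_pos by (meson less_le_trans mult_pos_pos zero_less_power)

lemma mv_H_sq_le: assumes "l < n" "k < K" shows "(d k * V l k)\<^sup>2 \<le> real n * theta\<^sup>2"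
proof -
  have "(d k * V l k)\<^sup>2 = (ip n (H l) (v k))\<^sup>2" using H_eigvec[OF assms] by (simp add: ip_def mv_def)
  also have "\<dots> \<le> ip n (H l) (H l) * ip n (v k) (v k)" by (rule ip_Cauchy_Schwarz)
  also have "\<dots> = (\<Sum>m<n. H l m * H l m)" using orthV[OF assms(2,2)] by (simp add: ip_def)
  also have "\<dots> \<le> (\<Sum>m<n. theta * theta)" using assms H_bounds theta_pos by (intro sum_mono mult_mono) auto
  finally show ?thesis by (simp add: power2_eq_square)
qed

lemma d_upper: assumes k: "k < K" shows "d k \<le> real n * theta"
proof -
  have "(d k)\<^sup>2 = (d k)\<^sup>2 * ip n (v k) (v k)" using orthV[OF k k] by simp
  also have "\<dots> = (\<Sum>l<n. (d k * V l k)\<^sup>2)"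
    by (simp add: ip_def sum_distrib_left power2_eq_square mult_ac)
  also have "\<dots> \<le> (\<Sum>l<n. real n * theta\<^sup>2)" using k by (intro sum_mono mv_H_sq_le) auto
  also have "\<dots> = (real n * theta)\<^sup>2" by (simp add: power2_eq_square)
  finally have "(d k)\<^sup>2 \<le> (real n * theta)\<^sup>2" .
  then show ?thesis by (rule power2_le_imp_le) (use nt_pos in linarith)
qed

text \<open>Delocalisation: a row of H has norm at most theta * sqrt n, which bounds
  \<open>d k * V l k\<close>, and \<open>d k\<close> is at least of order n * theta.\<close>

lemma V_sq_le: assumes "l < n" "k < K" shows "(V l k)\<^sup>2 \<le> 1 / (c0 ^ 4 * real n)"
proof -
  have "(c0\<^sup>2 * (real n * theta))\<^sup>2 * (V l k)\<^sup>2 \<le> (d k)\<^sup>2 * (V l k)\<^sup>2"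
    using d_lower[OF assms(2)] c0 nt_pos by (intro mult_right_mono power_mono) auto
  also have "\<dots> \<le> real n * theta\<^sup>2" using mv_H_sq_le[OF assms] by (simp add: power_mult_distrib)
  finally have "(real n * theta\<^sup>2) * (c0 ^ 4 * real n * (V l k)\<^sup>2) \<le> (real n * theta\<^sup>2) * 1"
    by (simp add: power_mult_distrib power2_eq_square power4_eq_xxxx mult_ac)
  then have "c0 ^ 4 * real n * (V l k)\<^sup>2 \<le> 1" using n0 theta_pos by (subst (asm) mult_le_cancel_left_pos) auto
  then show ?thesis using c0 n0 by (simp add: field_simps)
qed

lemma abs_V_le: assumes "l < n" "k < K" shows "\<bar>V l k\<bar> \<le> 1 / (c0\<^sup>2 * sqrt (real n))"
proof -
  have "(V l k)\<^sup>2 \<le> (1 / (c0\<^sup>2 * sqrt (real n)))\<^sup>2"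
    using V_sq_le[OF assms] n0 by (simp add: power_divide power_mult_distrib)
  then have "\<bar>V l k\<bar>\<^sup>2 \<le> (1 / (c0\<^sup>2 * sqrt (real n)))\<^sup>2" by simp
  then show ?thesis by (rule power2_le_imp_le) (use c0 in simp)
qed

text \<open>The squared norm of the difference of rows i and j of H is computed twice: in the
  eigenbasis, where \<open>d_upper\<close> applies, and as theta^2 |Pi P w|^2 for the membership
  difference w. Of the factor \<open>c0 ^ 3\<close>, one power comes from Pi^T Pi and two come from
  P.\<close>

lemma V_diff_lower:
  assumes "i < n" "j < n"
  shows "c0 ^ 3 * (\<Sum>k<K. (Pm i k - Pm j k)\<^sup>2) \<le> real n * (\<Sum>k<K. (V i k - V j k)\<^sup>2)"
proof -
  define w where "w = (\<lambda>a. Pm i a - Pm j a)"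
  define y where "y = (\<lambda>b. \<Sum>a<K. P b a * w a)"
  define D where "D = (\<lambda>k. V i k - V j k)"
  have Hd: "H i m - H j m = theta * (\<Sum>b<K. Pm m b * y b)" if "m < n" for m
  proof -
    have "H m i - H m j = theta * (\<Sum>a<K. \<Sum>b<K. Pm m a * P a b * w b)"
      by (simp add: Hmat_def w_def right_diff_distrib sum_subtractf)
    then show ?thesis using H_sym by (simp add: y_def sum_distrib_left mult.assoc)
  qed
  have Hd2: "H i m - H j m = (\<Sum>k<K. (d k * D k) * v k m)" if "m < n" for m
    using assms that by (simp add: H_decomp D_def sum_subtractf[symmetric] algebra_simps)
  have "(\<Sum>m<n. (H i m - H j m)\<^sup>2) = theta\<^sup>2 * qform K (\<lambda>a b. \<Sum>l<n. Pm l a * Pm l b) y"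
    unfolding Pi_sq[symmetric] sum_distrib_left by (intro sum.cong refl) (simp add: Hd power_mult_distrib)
  moreover have "(\<Sum>m<n. (H i m - H j m)\<^sup>2) = (\<Sum>k<K. (d k * D k)\<^sup>2)"
  proof -
    have "(\<Sum>m<n. (H i m - H j m)\<^sup>2) = ip n (\<lambda>m. \<Sum>k<K. (d k * D k) * v k m) (\<lambda>m. \<Sum>k<K. (d k * D k) * v k m)"
      unfolding ip_def by (intro sum.cong refl) (simp add: Hd2 power2_eq_square)
    also have "\<dots> = (\<Sum>k<K. (d k * D k) * (d k * D k))" by (rule ip_sum_orthonormal) (auto simp: orthV)
    finally show ?thesis by (simp add: power2_eq_square)
  qed
  moreover have "(\<Sum>k<K. (d k * D k)\<^sup>2) \<le> (\<Sum>k<K. (real n * theta)\<^sup>2 * (D k)\<^sup>2)"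
    unfolding power_mult_distrib[of "d _"]
    using d_upper d_pos by (intro sum_mono mult_right_mono power_mono) (auto simp: less_imp_le)
  ultimately have le: "theta\<^sup>2 * qform K (\<lambda>a b. \<Sum>l<n. Pm l a * Pm l b) y \<le> (real n * theta)\<^sup>2 * (\<Sum>k<K. (D k)\<^sup>2)"
    by (simp add: sum_distrib_left)
  have wy: "c0 * ip K w w \<le> ip K w y" using P_coercive[of w] by (simp add: qform_eq_bil bil_eq_ip y_def)
  have ww: "c0\<^sup>2 * ip K w w \<le> ip K y y"
  proof (cases "ip K w w = 0")
    case False
    then have p: "0 < ip K w w" using ip_nonneg[of K w] by linarith
    have "(c0 * ip K w w)\<^sup>2 \<le> (ip K w y)\<^sup>2" using wy c0 by (intro power_mono) auto
    also have "\<dots> \<le> ip K w w * ip K y y" by (rule ip_Cauchy_Schwarz)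
    finally have "ip K w w * (c0\<^sup>2 * ip K w w) \<le> ip K w w * ip K y y" by (simp add: power2_eq_square mult_ac)
    then show ?thesis using p by simp
  qed simp
  have "(real n * theta\<^sup>2) * (c0 ^ 3 * ip K w w) = theta\<^sup>2 * (c0 * real n * (c0\<^sup>2 * ip K w w))"
    by (simp add: power2_eq_square power3_eq_cube mult_ac)
  also have "\<dots> \<le> theta\<^sup>2 * (c0 * real n * ip K y y)" using ww c0 by (intro mult_left_mono) auto
  also have "\<dots> \<le> theta\<^sup>2 * qform K (\<lambda>a b. \<Sum>l<n. Pm l a * Pm l b) y" by (intro mult_left_mono G_coercive) auto
  also have "\<dots> \<le> (real n * theta)\<^sup>2 * (\<Sum>k<K. (D k)\<^sup>2)" by (rule le)
  also have "\<dots> = (real n * theta\<^sup>2) * (real n * (\<Sum>k<K. (D k)\<^sup>2))" by (simp add: power2_eq_square mult_ac)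
  finally have "c0 ^ 3 * ip K w w \<le> real n * (\<Sum>k<K. (D k)\<^sup>2)"
    using n0 theta_pos by (subst (asm) mult_le_cancel_left_pos) auto
  then show ?thesis by (simp add: ip_def w_def D_def power2_eq_square)
qed

lemma V_eq_of_Pi_eq:
  assumes "i < n" "j < n" "k < K" "\<And>a. a < K \<Longrightarrow> Pm i a = Pm j a"
  shows "V i k = V j k"
proof -
  have "mv n H (v k) i = mv n H (v k) j" unfolding mv_H_Pi using assms(4) by simp
  then show ?thesis using H_eigvec assms d_pos[of k] by simp
qed

end

section \<open>Expansion of row differences\<close>

context mm_model
begin

text \<open>Deterministic form of the expansion. The error at p = 0 is a coefficient error of order
  \<open>eta\<close> times V(i) - V(j); at p = 1 it is a coefficient error of order
  \<open>eta / D\<close> times noise of size \<open>M * D\<close>; the higher terms and the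
  remainder are small by assumption. The three summands of the constant correspond to these three
  cases. \<open>s\<close> is to be n * sqrt theta, the inverse of the noise scale.\<close>

lemma eigvec_row_difference:
  fixes c eta M s :: real and N :: nat
  defines "D \<equiv> real n * theta"
  assumes X: "\<And>l m. l < n \<Longrightarrow> m < n \<Longrightarrow> X l m = H l m + W l m"
    and symX: "\<And>l m. l < n \<Longrightarrow> m < n \<Longrightarrow> X l m = X m l"
    and orthU: "\<And>a b. a < n \<Longrightarrow> b < n \<Longrightarrow> ip n (u a) (u b) = of_bool (a = b)"
    and U: "\<And>k l. k < n \<Longrightarrow> l < n \<Longrightarrow> mv n X (u k) l = \<delta> k * u k l"
    and ord: "\<And>a b. a \<le> b \<Longrightarrow> b < n \<Longrightarrow> \<bar>\<delta> b\<bar> \<le> \<bar>\<delta> a\<bar>"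
    and sign: "0 \<le> ip n (v k) (u k)"
    and c: "0 < c" "c \<le> 1" and low: "\<And>k. k < K \<Longrightarrow> c * D \<le> d k"
    and gap: "\<And>a b. a < b \<Longrightarrow> b < K \<Longrightarrow> d b + c * D \<le> d a"
    and eta: "0 \<le> eta" "eta \<le> c / 4" and k: "k < K" and N: "2 \<le> N" and s: "0 \<le> s" and M: "0 \<le> M"
    and ij: "i < n" "j < n"
    and W: "\<And>x. ip n (mv n W x) (mv n W x) \<le> (eta * D)\<^sup>2 * ip n x x"
    and G1: "\<And>r a. r \<in> {i, j} \<Longrightarrow> a < K \<Longrightarrow> s * \<bar>mv n W (v a) r\<bar> \<le> M * D"
    and Gp: "\<And>r a p. r \<in> {i, j} \<Longrightarrow> a < K \<Longrightarrow> 2 \<le> p \<Longrightarrow> p < N \<Longrightarrow> s * \<bar>(mv n W ^^ p) (v a) r\<bar> \<le> eta * D ^ p"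
    and GN: "\<And>r. r \<in> {i, j} \<Longrightarrow> s * \<bar>(mv n W ^^ N) (u k) r\<bar> \<le> eta * D ^ N"
  shows "s * \<bar>(u k i - u k j) - (V i k - V j k) - (mv n W (v k) i - mv n W (v k) j) / d k\<bar>
    \<le> (6 / c\<^sup>2 + 28 * K / c ^ 3 + (2 * N * K + 2) * (2 / c) ^ N) * eta * (1 + M + s * (\<Sum>a<K. \<bar>V i a - V j a\<bar>))"
proof -
  have D: "0 < D" using nt_pos by (simp add: D_def)
  have pert: "k < n" "\<bar>\<delta> k - d k\<bar> \<le> eta * D" "1 - (ip n (v k) (u k))\<^sup>2 \<le> (2 * (eta * D) / (c * D))\<^sup>2"
    "\<And>a. a < K \<Longrightarrow> a \<noteq> k \<Longrightarrow> (ip n (v a) (u k))\<^sup>2 \<le> (2 * (eta * D) / (c * D))\<^sup>2"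
    using eigen_perturbation[where n = n and K = K and v = "\<lambda>k l. V l k" and H = H and X = X and W = W and u = u
        and \<delta> = \<delta> and d = d and e = "eta * D" and g = "c * D" and k = k,
        OF orthV mv_H X symX W orthU U ord low gap _ _ _ k] eta D c
    by (simp_all add: mult_right_mono)
  define t where "t = 2 * eta / c"
  have t: "0 \<le> t" "t \<le> 1 / 2" "2 * (eta * D) / (c * D) = t" using eta c D by (auto simp: t_def field_simps)
  define ck where "ck = (\<lambda>a. ip n (v a) (u k))"
  have ck1: "\<bar>ck a\<bar> \<le> 1" if "a < K" for a
  proof -
    have "(ck a)\<^sup>2 \<le> 1" using ip_Cauchy_Schwarz[of n "v a" "u k"] orthV[OF that that] orthU[OF pert(1) pert(1)] by (simp add: ck_def)
    then show ?thesis using abs_square_le_1 by blast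
  qed
  have cka: "\<bar>ck a\<bar> \<le> t" if "a < K" "a \<noteq> k" for a
  proof -
    have "\<bar>ck a\<bar>\<^sup>2 \<le> t\<^sup>2" using pert(4)[OF that] unfolding t(3) by (simp add: ck_def)
    then show ?thesis by (rule power2_le_imp_le) (rule t(1))
  qed
  \<comment> \<open>The orientation of the eigenvector enters here: for an overlap in [0, 1] the
    deficit \<open>1 - ck k\<close> is at most \<open>1 - (ck k)\<^sup>2\<close>.\<close>
  have ckk: "\<bar>ck k - 1\<bar> \<le> t"
  proof -
    have 1: "0 \<le> ck k" "ck k \<le> 1" using sign ck1[OF k] by (auto simp: ck_def)
    have "1 - ck k \<le> 1 - (ck k)\<^sup>2" using 1 by (simp add: power2_eq_square mult_left_le)
    also have "\<dots> \<le> t\<^sup>2" using pert(3) unfolding t(3) by (simp add: ck_def)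
    also have "\<dots> \<le> t" using t by (simp add: power2_eq_square mult_left_le)
    finally show ?thesis using 1 by simp
  qed
  have dl: "c * D / 2 \<le> \<delta> k"
  proof -
    have "eta * D \<le> c / 4 * D" using eta D by (intro mult_right_mono) auto
    moreover have "c * D / 2 \<le> c * D - c / 4 * D" using c D by simp
    ultimately show ?thesis using pert(2) low[OF k] by linarith
  qed
  have cD: "0 < c * D / 2" using c D by simp
  then have dp: "0 < \<delta> k" using dl by linarith
  have dfrac: "\<bar>z / \<delta> k\<bar> \<le> \<bar>z\<bar> * (2 / (c * D))" for z
  proof -
    have "\<bar>z\<bar> / \<delta> k \<le> \<bar>z\<bar> / (c * D / 2)" using dl cD by (intro divide_left_mono) auto
    then show ?thesis using dp by (simp add: abs_divide)
  qed
  have dD: "\<bar>d a / \<delta> k\<bar> \<le> 2 / c" if "a < K" for a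
  proof -
    have "\<bar>d a\<bar> \<le> D" using d_upper[OF that] d_pos[OF that] by (simp add: D_def)
    then have "\<bar>d a\<bar> * (2 / (c * D)) \<le> D * (2 / (c * D))" using c D by (intro mult_right_mono) auto
    then show ?thesis using dfrac[of "d a"] D by simp
  qed
  \<comment> \<open>The coefficient of \<open>W ^ p\<close> applied to \<open>v a\<close> is
    \<open>x a / \<delta> k ^ p\<close>, so one family of coefficients controls all orders.\<close>
  define x where "x = (\<lambda>a. d a * ck a / \<delta> k)"
  have xabs: "\<bar>x a\<bar> \<le> 2 / c" if "a < K" for a
  proof -
    have "\<bar>x a\<bar> = \<bar>d a / \<delta> k\<bar> * \<bar>ck a\<bar>" by (simp add: x_def abs_mult abs_divide)
    also have "\<dots> \<le> 2 / c * 1" using dD[OF that] ck1[OF that] c by (intro mult_mono) auto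
    finally show ?thesis by simp
  qed
  have c2: "t \<le> 2 * eta / c\<^sup>2" "0 \<le> eta / c\<^sup>2"
  proof -
    have "c\<^sup>2 \<le> c" using c by (simp add: power2_eq_square mult_left_le)
    then show "t \<le> 2 * eta / c\<^sup>2" unfolding t_def using c eta by (intro divide_left_mono) auto
  qed (use eta in simp)
  \<comment> \<open>For \<open>a = k\<close> the eigenvalue ratio and the overlap each err by at
    most \<open>t\<close>; otherwise the overlap is at most \<open>t\<close> and the ratio at most
    \<open>2 / c\<close>.\<close>
  have xd: "\<bar>x a - of_bool (a = k)\<bar> \<le> 6 * eta / c\<^sup>2" if "a < K" for a
  proof (cases "a = k")
    case True
    have "\<bar>d k / \<delta> k - 1\<bar> = \<bar>(d k - \<delta> k) / \<delta> k\<bar>" using dp by (simp add: field_simps)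
    also have "\<dots> \<le> \<bar>d k - \<delta> k\<bar> * (2 / (c * D))" by (rule dfrac)
    also have "\<dots> \<le> (eta * D) * (2 / (c * D))" using pert(2) c D by (intro mult_right_mono) (auto simp: abs_minus_commute)
    also have "\<dots> = t" using D by (simp add: t_def)
    finally have 1: "\<bar>d k / \<delta> k - 1\<bar> \<le> t" .
    have "x k - 1 = (d k / \<delta> k - 1) * ck k + (ck k - 1)" by (simp add: x_def algebra_simps)
    then have "\<bar>x k - 1\<bar> \<le> \<bar>d k / \<delta> k - 1\<bar> * \<bar>ck k\<bar> + \<bar>ck k - 1\<bar>" by (metis abs_mult abs_triangle_ineq)
    also have "\<dots> \<le> t * 1 + t" using 1 ck1[OF k] ckk t by (intro add_mono mult_mono) auto
    also have "\<dots> \<le> 6 * eta / c\<^sup>2" using c2 by simp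
    finally show ?thesis using True by simp
  next
    case False
    have "\<bar>x a\<bar> = \<bar>d a / \<delta> k\<bar> * \<bar>ck a\<bar>" by (simp add: x_def abs_mult abs_divide)
    also have "\<dots> \<le> 2 / c * t" using dD[OF that] cka[OF that False] c by (intro mult_mono) auto
    also have "\<dots> = 4 * eta / c\<^sup>2" by (simp add: t_def power2_eq_square)
    also have "\<dots> \<le> 6 * eta / c\<^sup>2" using c2 by simp
    finally show ?thesis using False by simp
  qed
  define y where "y = (\<lambda>p a. (mv n W ^^ p) (v a) i - (mv n W ^^ p) (v a) j)"
  define R where "R = ((mv n W ^^ N) (u k) i - (mv n W ^^ N) (u k) j) / \<delta> k ^ N"
  have ex: "u k l = (\<Sum>p<N. \<Sum>a<K. d a * ip n (v a) (u k) / \<delta> k ^ Suc p * (mv n W ^^ p) (v a) l) + (mv n W ^^ N) (u k) l / \<delta> k ^ N"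
    if "l < n" for l
    by (rule eigvec_expansion[OF mv_H X U[OF pert(1)] _ that]) (use dp in auto)
  have coef: "d a * ip n (v a) (u k) / \<delta> k ^ Suc p = x a / \<delta> k ^ p" for a p
    by (simp add: x_def ck_def mult_ac)
  have uij: "u k i - u k j = (\<Sum>p<N. \<Sum>a<K. x a / \<delta> k ^ p * y p a) + R"
    unfolding ex[OF ij(1)] ex[OF ij(2)] coef R_def y_def
    by (simp add: sum_subtractf right_diff_distrib diff_divide_distrib)
  have sumN: "(\<Sum>p<N. f p) = f 0 + f 1 + (\<Sum>p\<in>{2..<N}. f p)" for f :: "nat \<Rightarrow> real"
  proof -
    have "{..<N} = {0, 1} \<union> {2..<N}" using N by auto
    then have "(\<Sum>p<N. f p) = (\<Sum>p\<in>{0, 1} \<union> {2..<N}. f p)" by simp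
    also have "\<dots> = f 0 + f 1 + (\<Sum>p\<in>{2..<N}. f p)" by (subst sum.union_disjoint) auto
    finally show ?thesis .
  qed
  have delta: "(\<Sum>a<K. of_bool (a = k) * f a) = f k" for f :: "nat \<Rightarrow> real"
  proof -
    have "(\<Sum>a<K. of_bool (a = k) * f a) = (\<Sum>a<K. if a = k then f a else 0)" by (intro sum.cong) auto
    then show ?thesis using k by (simp add: sum.delta)
  qed
  define E0 where "E0 = (\<Sum>a<K. (x a - of_bool (a = k)) * y 0 a)"
  define E1 where "E1 = (\<Sum>a<K. (x a / \<delta> k - of_bool (a = k) / d k) * y 1 a)"
  define E2 where "E2 = (\<Sum>p\<in>{2..<N}. \<Sum>a<K. x a / \<delta> k ^ p * y p a)"
  have main: "(u k i - u k j) - (V i k - V j k) - (mv n W (v k) i - mv n W (v k) j) / d k = E0 + E1 + E2 + R"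
  proof -
    have "E0 = (\<Sum>a<K. x a * y 0 a) - y 0 k" unfolding E0_def left_diff_distrib sum_subtractf delta ..
    moreover have "E1 = (\<Sum>a<K. x a / \<delta> k * y 1 a) - y 1 k / d k"
    proof -
      have "(\<Sum>a<K. of_bool (a = k) / d k * y 1 a) = (\<Sum>a<K. of_bool (a = k) * (y 1 a / d k))" by simp
      then show ?thesis unfolding E1_def left_diff_distrib sum_subtractf delta by simp
    qed
    ultimately show ?thesis unfolding uij sumN E2_def by (simp add: y_def)
  qed
  let ?Z = "s * (\<Sum>a<K. \<bar>V i a - V j a\<bar>)"
  have Z0: "0 \<le> ?Z" using s by (simp add: sum_nonneg)
  have E0: "s * \<bar>E0\<bar> \<le> 6 * eta / c\<^sup>2 * ?Z"
  proof -
    have "\<bar>E0\<bar> \<le> (\<Sum>a<K. \<bar>(x a - of_bool (a = k)) * y 0 a\<bar>)" unfolding E0_def by (rule sum_abs)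
    also have "\<dots> \<le> (\<Sum>a<K. 6 * eta / c\<^sup>2 * \<bar>V i a - V j a\<bar>)"
      unfolding abs_mult using xd by (intro sum_mono mult_mono) (auto simp: y_def eta)
    finally have "s * \<bar>E0\<bar> \<le> s * (\<Sum>a<K. 6 * eta / c\<^sup>2 * \<bar>V i a - V j a\<bar>)" using s by (rule mult_left_mono)
    also have "\<dots> = 6 * eta / c\<^sup>2 * ?Z" by (simp add: sum_distrib_left mult_ac)
    finally show ?thesis .
  qed
  have y1: "s * \<bar>y 1 a\<bar> \<le> 2 * M * D" if "a < K" for a
  proof -
    have "s * \<bar>y 1 a\<bar> \<le> s * (\<bar>mv n W (v a) i\<bar> + \<bar>mv n W (v a) j\<bar>)" unfolding y_def using s by (intro mult_left_mono) auto
    then show ?thesis using G1[of i a] G1[of j a] that by (simp add: distrib_left)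
  qed
  have yp: "s * \<bar>y p a\<bar> \<le> 2 * (eta * D ^ p)" if "a < K" "2 \<le> p" "p < N" for a p
  proof -
    have "s * \<bar>y p a\<bar> \<le> s * (\<bar>(mv n W ^^ p) (v a) i\<bar> + \<bar>(mv n W ^^ p) (v a) j\<bar>)" unfolding y_def using s by (intro mult_left_mono) auto
    then show ?thesis using Gp[of i a p] Gp[of j a p] that by (simp add: distrib_left)
  qed
  \<comment> \<open>The 14 is 12 + 2: replacing \<open>x a\<close> by its limit costs 12, replacing
    \<open>\<delta> k\<close> by \<open>d k\<close> in the denominator costs 2.\<close>
  have coef1: "\<bar>x a / \<delta> k - of_bool (a = k) / d k\<bar> \<le> 14 * eta / (c ^ 3 * D)" if a: "a < K" for a
  proof -
    have dk: "0 < d k" by (rule d_pos[OF k])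
    have "\<bar>x a / \<delta> k - of_bool (a = k) / d k\<bar> \<le> \<bar>(x a - of_bool (a = k)) / \<delta> k\<bar> + \<bar>of_bool (a = k) * ((d k - \<delta> k) / \<delta> k / d k)\<bar>"
    proof -
      have "x a / \<delta> k - of_bool (a = k) / d k = (x a - of_bool (a = k)) / \<delta> k + of_bool (a = k) * ((d k - \<delta> k) / \<delta> k / d k)"
        using dp dk by (cases "a = k") (auto simp: field_simps)
      then show ?thesis using abs_triangle_ineq by metis
    qed
    also have "\<dots> \<le> 6 * eta / c\<^sup>2 * (2 / (c * D)) + eta * D * (2 / (c * D)) * (1 / (c * D))"
    proof (rule add_mono)
      show "\<bar>(x a - of_bool (a = k)) / \<delta> k\<bar> \<le> 6 * eta / c\<^sup>2 * (2 / (c * D))"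
        using xd[OF a] c D by (intro order_trans[OF dfrac] mult_right_mono) auto
      have "\<bar>(d k - \<delta> k) / \<delta> k\<bar> \<le> eta * D * (2 / (c * D))"
        using pert(2) c D by (intro order_trans[OF dfrac] mult_right_mono) (auto simp: abs_minus_commute)
      moreover have "1 / d k \<le> 1 / (c * D)" using low[OF k] c D dk by (intro divide_left_mono) auto
      ultimately have "\<bar>(d k - \<delta> k) / \<delta> k\<bar> * (1 / d k) \<le> eta * D * (2 / (c * D)) * (1 / (c * D))"
        using dk eta D c by (intro mult_mono) auto
      moreover have "\<bar>of_bool (a = k) * ((d k - \<delta> k) / \<delta> k / d k)\<bar> \<le> \<bar>(d k - \<delta> k) / \<delta> k\<bar> * (1 / d k)"
        using dk by (simp add: abs_mult abs_divide)
      ultimately show "\<bar>of_bool (a = k) * ((d k - \<delta> k) / \<delta> k / d k)\<bar> \<le> eta * D * (2 / (c * D)) * (1 / (c * D))" by linarith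
    qed
    also have "6 * eta / c\<^sup>2 * (2 / (c * D)) = 12 * eta / (c ^ 3 * D)" by (simp add: power2_eq_square power3_eq_cube)
    also have "eta * D * (2 / (c * D)) * (1 / (c * D)) = 2 * eta / (c\<^sup>2 * D)" using D by (simp add: power2_eq_square mult_ac)
    also have "2 * eta / (c\<^sup>2 * D) \<le> 2 * eta / (c ^ 3 * D)"
    proof -
      have "c ^ 3 \<le> c\<^sup>2" using c by (intro power_decreasing) auto
      then show ?thesis using c D eta by (intro divide_left_mono mult_right_mono) auto
    qed
    also have "12 * eta / (c ^ 3 * D) + 2 * eta / (c ^ 3 * D) = 14 * eta / (c ^ 3 * D)" by (simp add: add_divide_distrib[symmetric])
    finally show ?thesis by simp
  qed
  have E1: "s * \<bar>E1\<bar> \<le> 28 * K / c ^ 3 * eta * M"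
  proof -
    have "\<bar>E1\<bar> \<le> (\<Sum>a<K. \<bar>(x a / \<delta> k - of_bool (a = k) / d k) * y 1 a\<bar>)" unfolding E1_def by (rule sum_abs)
    then have "s * \<bar>E1\<bar> \<le> s * (\<Sum>a<K. \<bar>(x a / \<delta> k - of_bool (a = k) / d k) * y 1 a\<bar>)" using s by (rule mult_left_mono)
    also have "\<dots> = (\<Sum>a<K. \<bar>x a / \<delta> k - of_bool (a = k) / d k\<bar> * (s * \<bar>y 1 a\<bar>))"
      by (simp add: sum_distrib_left abs_mult mult_ac)
    also have "\<dots> \<le> (\<Sum>a<K. 14 * eta / (c ^ 3 * D) * (2 * M * D))"
    proof (rule sum_mono)
      fix a assume "a \<in> {..<K}"
      then have a: "a < K" by simp
      show "\<bar>x a / \<delta> k - of_bool (a = k) / d k\<bar> * (s * \<bar>y 1 a\<bar>) \<le> 14 * eta / (c ^ 3 * D) * (2 * M * D)"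
        by (rule mult_mono[OF coef1[OF a] y1[OF a]]) (use s eta c D in auto)
    qed
    also have "\<dots> = 28 * K / c ^ 3 * eta * M" using D by simp
    finally show ?thesis .
  qed
  have DN: "D ^ p / \<delta> k ^ p \<le> (2 / c) ^ p" for p
  proof -
    have "D / \<delta> k \<le> D / (c * D / 2)" using dl cD D by (intro divide_left_mono) auto
    then have "D / \<delta> k \<le> 2 / c" using D by simp
    then have "(D / \<delta> k) ^ p \<le> (2 / c) ^ p" using D dp by (intro power_mono) auto
    then show ?thesis by (simp add: power_divide)
  qed
  have E2: "s * \<bar>E2\<bar> \<le> 2 * N * K * (2 / c) ^ N * eta"
  proof -
    have "\<bar>E2\<bar> \<le> (\<Sum>p\<in>{2..<N}. \<bar>\<Sum>a<K. x a / \<delta> k ^ p * y p a\<bar>)" unfolding E2_def by (rule sum_abs)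
    also have "\<dots> \<le> (\<Sum>p\<in>{2..<N}. \<Sum>a<K. \<bar>x a / \<delta> k ^ p * y p a\<bar>)" by (intro sum_mono sum_abs)
    finally have "s * \<bar>E2\<bar> \<le> s * (\<Sum>p\<in>{2..<N}. \<Sum>a<K. \<bar>x a / \<delta> k ^ p * y p a\<bar>)" using s by (rule mult_left_mono)
    also have "\<dots> = (\<Sum>p\<in>{2..<N}. \<Sum>a<K. \<bar>x a\<bar> / \<delta> k ^ p * (s * \<bar>y p a\<bar>))"
      using dp by (simp add: sum_distrib_left abs_mult abs_divide mult_ac)
    also have "\<dots> \<le> (\<Sum>p\<in>{2..<N}. \<Sum>a<K. 2 * (2 / c) ^ N * eta)"
    proof (intro sum_mono)
      fix p a assume p: "p \<in> {2..<N}" and a: "a \<in> {..<K}"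
      have "\<bar>x a\<bar> / \<delta> k ^ p * (s * \<bar>y p a\<bar>) \<le> (2 / c) / \<delta> k ^ p * (2 * (eta * D ^ p))"
      proof (rule mult_mono)
        show "\<bar>x a\<bar> / \<delta> k ^ p \<le> (2 / c) / \<delta> k ^ p" using xabs[of a] a dp by (intro divide_right_mono) auto
        show "s * \<bar>y p a\<bar> \<le> 2 * (eta * D ^ p)" using yp[of a p] a p by simp
      qed (use s c dp in auto)
      also have "\<dots> = 2 * eta * (2 / c) * (D ^ p / \<delta> k ^ p)" by simp
      also have "\<dots> \<le> 2 * eta * (2 / c) * (2 / c) ^ p" using DN eta c by (intro mult_left_mono) auto
      also have "\<dots> = 2 * eta * (2 / c) ^ Suc p" by simp
      also have "\<dots> \<le> 2 * eta * (2 / c) ^ N" using p c eta by (intro mult_left_mono power_increasing) auto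
      finally show "\<bar>x a\<bar> / \<delta> k ^ p * (s * \<bar>y p a\<bar>) \<le> 2 * (2 / c) ^ N * eta" by (simp add: mult_ac)
    qed
    also have "\<dots> = real (N - 2) * (K * (2 * (2 / c) ^ N * eta))" by simp
    also have "\<dots> \<le> real N * (K * (2 * (2 / c) ^ N * eta))" using c eta by (intro mult_right_mono) auto
    finally show ?thesis by (simp add: mult_ac)
  qed
  have R: "s * \<bar>R\<bar> \<le> 2 * (2 / c) ^ N * eta"
  proof -
    have "s * \<bar>R\<bar> = s * \<bar>(mv n W ^^ N) (u k) i - (mv n W ^^ N) (u k) j\<bar> / \<delta> k ^ N"
      using dp by (simp add: R_def abs_divide)
    also have "\<dots> \<le> (2 * (eta * D ^ N)) / \<delta> k ^ N"
    proof (rule divide_right_mono)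
      have "s * \<bar>(mv n W ^^ N) (u k) i - (mv n W ^^ N) (u k) j\<bar> \<le> s * (\<bar>(mv n W ^^ N) (u k) i\<bar> + \<bar>(mv n W ^^ N) (u k) j\<bar>)"
        using s by (intro mult_left_mono) auto
      then show "s * \<bar>(mv n W ^^ N) (u k) i - (mv n W ^^ N) (u k) j\<bar> \<le> 2 * (eta * D ^ N)"
        using GN[of i] GN[of j] by (simp add: distrib_left)
    qed (use dp in simp)
    also have "\<dots> = 2 * eta * (D ^ N / \<delta> k ^ N)" by simp
    also have "\<dots> \<le> 2 * eta * (2 / c) ^ N" using DN eta by (intro mult_left_mono) auto
    finally show ?thesis by (simp add: mult_ac)
  qed
  define C0 where "C0 = 6 / c\<^sup>2"
  define C1 where "C1 = 28 * K / c ^ 3"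
  define C2 where "C2 = (2 * N * K + 2) * (2 / c) ^ N"
  have C: "0 \<le> C0" "0 \<le> C1" "0 \<le> C2" using c by (auto simp: C0_def C1_def C2_def)
  have "s * \<bar>E0 + E1 + E2 + R\<bar> \<le> s * (\<bar>E0\<bar> + \<bar>E1\<bar> + \<bar>E2\<bar> + \<bar>R\<bar>)" using s by (intro mult_left_mono) auto
  also have "\<dots> \<le> C0 * eta * ?Z + C1 * eta * M + C2 * eta * 1"
    using E0 E1 E2 R by (simp add: C0_def C1_def C2_def algebra_simps)
  also have "\<dots> \<le> C0 * eta * (1 + M + ?Z) + C1 * eta * (1 + M + ?Z) + C2 * eta * (1 + M + ?Z)"
    using C eta M Z0 by (intro add_mono mult_left_mono) auto
  also have "\<dots> = (C0 + C1 + C2) * eta * (1 + M + ?Z)" by (simp add: algebra_simps)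
  finally show ?thesis unfolding main C0_def C1_def C2_def .
qed

end

section \<open>The high-probability event on which the expansion is valid\<close>

context mm_model
begin

text \<open>The bounds control, in this order, the operator norm of W, the remainder at rows in
  \<open>R\<close>, the term p = 1 and the terms with 2 \<le> p < N. Everything is squared so that
  second moments suffice; \<open>(real n)\<^sup>2 * theta\<close> is the square of the scale n *
  sqrt theta.\<close>

definition good :: "nat \<Rightarrow> real \<Rightarrow> real \<Rightarrow> nat set \<Rightarrow> (nat \<Rightarrow> nat \<Rightarrow> real) \<Rightarrow> bool" where
  "good N eta M R W \<longleftrightarrow>
     (\<Sum>l<n. rowsq n W N l) \<le> (eta * (real n * theta))\<^sup>2 ^ N \<and>
     (\<forall>r\<in>R. (real n)\<^sup>2 * theta * rowsq n W N r \<le> (eta * (real n * theta) ^ N)\<^sup>2 \<and>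
       (\<forall>a<K. (real n)\<^sup>2 * theta * (mv n W (v a) r)\<^sup>2 \<le> (M * (real n * theta))\<^sup>2 \<and>
         (\<forall>p\<in>{2..<N}. (real n)\<^sup>2 * theta * ((mv n W ^^ p) (v a) r)\<^sup>2 \<le> (eta * (real n * theta) ^ p)\<^sup>2)))"

text \<open>Markov's inequality and the union bound in one: \<open>F\<close> sums all squared
  quantities divided by their thresholds, so it is at least 1 off the event, and its expectation is
  estimated term by term.\<close>

lemma prob_not_good_le:
  fixes N :: nat and eta M :: real and R :: "nat set"
  defines "D \<equiv> real n * theta" and "CN \<equiv> real (N + 1) ^ (2 * N + 1)"
  assumes H1: "\<And>l m. l < n \<Longrightarrow> m < n \<Longrightarrow> H l m \<le> 1" and nq: "1 \<le> real n * min 1 theta"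
    and eta: "0 < eta" and M: "0 < M" and R: "R \<subseteq> {..<n}"
  shows "measure_pmf.prob (edge_pmf n H) {s. \<not> good N eta M R (Wmat loops H s)}
    \<le> CN / (eta\<^sup>2) ^ N * (real n * D / D ^ N) + card R * (CN / eta\<^sup>2 * (real n * D / D ^ N)
       + K * (8 / (c0 ^ 4 * M\<^sup>2) + N * (CN / (c0 ^ 4 * eta\<^sup>2 * D))))"
proof -
  let ?E = "measure_pmf.expectation (edge_pmf n H)"
  let ?W = "\<lambda>s. Wmat loops H s"
  \<comment> \<open>The entries of H are bounded by \<open>theta\<close> and by 1; the walk moments
    need a bound that is at most 1.\<close>
  define q where "q = min 1 theta"
  have q: "0 \<le> q" "q \<le> 1" "1 \<le> real n * q" using theta_pos nq by (auto simp: q_def)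
  have Hq: "0 \<le> H l m \<and> H l m \<le> q" if "l < n" "m < n" for l m
    using H_bounds[OF that] H1[OF that] by (simp add: q_def)
  have finR: "finite R" using R by (rule finite_subset) simp
  have D1: "1 \<le> D"
  proof -
    have "1 \<le> real n * q" by (rule q(3))
    also have "\<dots> \<le> D" unfolding D_def q_def by (intro mult_left_mono) auto
    finally show ?thesis .
  qed
  then have D: "0 < D" by simp
  have nqD: "(real n * q) ^ p \<le> D ^ p" for p
    unfolding D_def q_def using theta_pos by (intro power_mono mult_left_mono) auto
  define Cp where "Cp = (\<lambda>p::nat. real (p + 1) ^ (2 * p + 1))"
  have CpN: "Cp p \<le> CN" if "p \<le> N" for p
  proof -
    have "Cp p \<le> real (N + 1) ^ (2 * p + 1)" unfolding Cp_def using that by (intro power_mono) auto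
    also have "\<dots> \<le> CN" unfolding CN_def using that by (intro power_increasing) auto
    finally show ?thesis .
  qed
  have CN: "0 \<le> CN" by (simp add: CN_def)
  have row: "?E (\<lambda>s. rowsq n (?W s) N r) \<le> CN * D ^ N" if "r < n" for r
  proof -
    have "?E (\<lambda>s. rowsq n (?W s) N r) \<le> CN * (real n * q) ^ N"
      unfolding rowsq_def CN_def by (rule expectation_mv_pow_row_le[OF H_sym Hq q that])
    also have "\<dots> \<le> CN * D ^ N" by (intro mult_left_mono nqD CN)
    finally show ?thesis .
  qed
  have sq: "(real n)\<^sup>2 * theta * ?E (\<lambda>s. ((mv n (?W s) ^^ p) (v a) r)\<^sup>2) \<le> D * (Cp p * D ^ p) / c0 ^ 4" if "r < n" "a < K" for r a p
  proof -
    have "?E (\<lambda>s. ((mv n (?W s) ^^ p) (v a) r)\<^sup>2) \<le> (1 / (c0\<^sup>2 * sqrt (real n)))\<^sup>2 * (Cp p * (real n * q) ^ p)"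
      unfolding Cp_def using abs_V_le that(2) by (intro expectation_mv_pow_sq_le[OF H_sym Hq q that(1)]) auto
    also have "(1 / (c0\<^sup>2 * sqrt (real n)))\<^sup>2 = 1 / (c0 ^ 4 * real n)"
      by (simp add: power_divide power_mult_distrib)
    also have "1 / (c0 ^ 4 * real n) * (Cp p * (real n * q) ^ p) \<le> 1 / (c0 ^ 4 * real n) * (Cp p * D ^ p)"
      using c0 by (intro mult_left_mono nqD) (auto simp: Cp_def)
    finally have "(real n)\<^sup>2 * theta * ?E (\<lambda>s. ((mv n (?W s) ^^ p) (v a) r)\<^sup>2) \<le> (real n)\<^sup>2 * theta * (1 / (c0 ^ 4 * real n) * (Cp p * D ^ p))"
      using theta_pos by (intro mult_left_mono) auto
    also have "\<dots> = D * (Cp p * D ^ p) / c0 ^ 4" using n0 by (simp add: D_def power2_eq_square)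
    finally show ?thesis .
  qed
  define F1 where "F1 = (\<lambda>s. (\<Sum>l<n. rowsq n (?W s) N l) / (eta * D)\<^sup>2 ^ N)"
  define F3 where "F3 = (\<lambda>r s. (real n)\<^sup>2 * theta * rowsq n (?W s) N r / (eta * D ^ N)\<^sup>2)"
  define F4 where "F4 = (\<lambda>r a s. (real n)\<^sup>2 * theta * (mv n (?W s) (v a) r)\<^sup>2 / (M * D)\<^sup>2)"
  define F2 where "F2 = (\<lambda>r a p s. (real n)\<^sup>2 * theta * ((mv n (?W s) ^^ p) (v a) r)\<^sup>2 / (eta * D ^ p)\<^sup>2)"
  define F where "F = (\<lambda>s. F1 s + (\<Sum>r\<in>R. F3 r s + (\<Sum>a<K. F4 r a s + (\<Sum>p\<in>{2..<N}. F2 r a p s))))"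
  have nn: "0 \<le> F1 s" "0 \<le> F3 r s" "0 \<le> F4 r a s" "0 \<le> F2 r a p s" for r a p s
    using theta_pos by (auto simp: F1_def F2_def F3_def F4_def rowsq_def intro!: sum_nonneg divide_nonneg_nonneg mult_nonneg_nonneg)
  have le: "F1 s \<le> F s" "r \<in> R \<Longrightarrow> F3 r s \<le> F s" "r \<in> R \<Longrightarrow> a < K \<Longrightarrow> F4 r a s \<le> F s"
    "r \<in> R \<Longrightarrow> a < K \<Longrightarrow> p \<in> {2..<N} \<Longrightarrow> F2 r a p s \<le> F s" for r a p s
  proof -
    let ?A = "\<lambda>r a. F4 r a s + (\<Sum>p\<in>{2..<N}. F2 r a p s)"
    let ?B = "\<lambda>r. F3 r s + (\<Sum>a<K. ?A r a)"
    have A: "0 \<le> ?A r a" "F4 r a s \<le> ?A r a" for r a using nn by (auto intro!: add_nonneg_nonneg sum_nonneg)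
    have B: "0 \<le> ?B r" "F3 r s \<le> ?B r" for r using nn A by (auto intro!: add_nonneg_nonneg sum_nonneg)
    have AB: "?A r a \<le> ?B r" if "a < K" for r a
      using member_le_sum[of a "{..<K}" "?A r"] that A nn(2)[of r s] by auto
    have BF: "?B r \<le> F s" if "r \<in> R" for r
      using member_le_sum[of r R ?B] that B nn(1)[of s] finR by (auto simp: F_def)
    show "F1 s \<le> F s" using B by (simp add: F_def sum_nonneg)
    show "F3 r s \<le> F s" if "r \<in> R" using BF[OF that] B(2)[of r] by linarith
    show "F4 r a s \<le> F s" if "r \<in> R" "a < K" using BF[OF that(1)] AB[OF that(2), of r] A(2)[of r a] by linarith
    assume *: "r \<in> R" "a < K" "p \<in> {2..<N}"
    have "F2 r a p s \<le> (\<Sum>p\<in>{2..<N}. F2 r a p s)" by (rule member_le_sum[OF *(3)]) (auto simp: nn)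
    then have "F2 r a p s \<le> ?A r a" using nn(3)[of r a s] by linarith
    then show "F2 r a p s \<le> F s" using BF[OF *(1)] AB[OF *(2), of r] by linarith
  qed
  have F0: "0 \<le> F s" for s using le(1)[of s] nn(1)[of s] by linarith
  have bad: "1 \<le> F s" if "\<not> good N eta M R (?W s)" for s
  proof (rule ccontr)
    assume "\<not> 1 \<le> F s"
    then have l: "F1 s \<le> 1" "r \<in> R \<Longrightarrow> F3 r s \<le> 1" "r \<in> R \<Longrightarrow> a < K \<Longrightarrow> F4 r a s \<le> 1"
      "r \<in> R \<Longrightarrow> a < K \<Longrightarrow> p \<in> {2..<N} \<Longrightarrow> F2 r a p s \<le> 1" for r a p
      using le(1)[of s] le(2)[of r s] le(3)[of r a s] le(4)[of r a p s] by linarith+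
    have div: "x / y \<le> 1 \<Longrightarrow> 0 < y \<Longrightarrow> x \<le> y" for x y :: real by (simp add: field_simps)
    have "good N eta M R (?W s)"
      unfolding good_def D_def[symmetric] 
      using l[unfolded F1_def F2_def F3_def F4_def, THEN div] eta M D by simp
    then show False using that by simp
  qed
  have "measure_pmf.prob (edge_pmf n H) {s. \<not> good N eta M R (?W s)} = ?E (indicat_real {s. \<not> good N eta M R (?W s)})"
    by simp
  also have "\<dots> \<le> ?E F"
    using bad F0 by (intro integral_mono) (auto simp: indicator_def)
  also have "?E F = ?E F1 + (\<Sum>r\<in>R. ?E (F3 r) + (\<Sum>a<K. ?E (F4 r a) + (\<Sum>p\<in>{2..<N}. ?E (F2 r a p))))"
    unfolding F_def by (simp add: Bochner_Integration.integral_sum)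
  also have "\<dots> \<le> CN / (eta\<^sup>2) ^ N * (real n * D / D ^ N) + (\<Sum>r\<in>R. CN / eta\<^sup>2 * (real n * D / D ^ N)
       + (\<Sum>a<K. 8 / (c0 ^ 4 * M\<^sup>2) + (\<Sum>p\<in>{2..<N}. CN / (c0 ^ 4 * eta\<^sup>2 * D))))"
  proof (intro add_mono sum_mono)
    have "?E F1 = (\<Sum>l<n. ?E (\<lambda>s. rowsq n (?W s) N l)) / (eta * D)\<^sup>2 ^ N"
      by (simp add: F1_def Bochner_Integration.integral_sum)
    also have "\<dots> \<le> (\<Sum>l<n. CN * D ^ N) / (eta * D)\<^sup>2 ^ N"
      by (intro divide_right_mono sum_mono row) auto
    also have "\<dots> = CN / (eta\<^sup>2) ^ N * (real n * 1 / D ^ N)"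
      using D by (simp add: power_mult_distrib power2_eq_square mult_ac)
    \<comment> \<open>The factor \<open>D \<ge> 1\<close> is given away so that this term has the
      same rate as \<open>F3\<close>.\<close>
    also have "\<dots> \<le> CN / (eta\<^sup>2) ^ N * (real n * D / D ^ N)"
      using D1 CN by (intro mult_left_mono divide_right_mono) auto
    finally show "?E F1 \<le> CN / (eta\<^sup>2) ^ N * (real n * D / D ^ N)" .
  next
    fix r assume "r \<in> R"
    then have r: "r < n" using R by auto
    have "?E (F3 r) = (real n)\<^sup>2 * theta * ?E (\<lambda>s. rowsq n (?W s) N r) / (eta * D ^ N)\<^sup>2"
      by (simp add: F3_def)
    also have "\<dots> \<le> (real n)\<^sup>2 * theta * (CN * D ^ N) / (eta * D ^ N)\<^sup>2"
      using theta_pos by (intro divide_right_mono mult_left_mono row[OF r]) auto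
    also have "\<dots> = CN / eta\<^sup>2 * (real n * D / D ^ N)"
      using D by (simp add: power2_eq_square D_def mult_ac)
    finally show "?E (F3 r) \<le> CN / eta\<^sup>2 * (real n * D / D ^ N)" .
    fix a assume "a \<in> {..<K}"
    then have a: "a < K" by simp
    have "?E (F4 r a) = (real n)\<^sup>2 * theta * ?E (\<lambda>s. ((mv n (?W s) ^^ 1) (v a) r)\<^sup>2) / (M * D)\<^sup>2"
      by (simp add: F4_def)
    also have "\<dots> \<le> D * (Cp 1 * D ^ 1) / c0 ^ 4 / (M * D)\<^sup>2"
      by (intro divide_right_mono sq r a) auto
    \<comment> \<open>\<open>Cp 1\<close> is 2 ^ 3. This is the one term that does not vanish as n
      grows; it is made small by a large \<open>M\<close>.\<close>
    also have "\<dots> = 8 / (c0 ^ 4 * M\<^sup>2)" using D by (simp add: power2_eq_square Cp_def power3_eq_cube)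
    finally show "?E (F4 r a) \<le> 8 / (c0 ^ 4 * M\<^sup>2)" .
    fix p assume p: "p \<in> {2..<N}"
    have "?E (F2 r a p) = (real n)\<^sup>2 * theta * ?E (\<lambda>s. ((mv n (?W s) ^^ p) (v a) r)\<^sup>2) / (eta * D ^ p)\<^sup>2"
      by (simp add: F2_def)
    also have "\<dots> \<le> D * (Cp p * D ^ p) / c0 ^ 4 / (eta * D ^ p)\<^sup>2"
      by (intro divide_right_mono sq r a) auto
    also have "\<dots> = Cp p / (c0 ^ 4 * eta\<^sup>2) * (D / D ^ p)" using D by (simp add: power2_eq_square mult_ac)
    also have "\<dots> \<le> CN / (c0 ^ 4 * eta\<^sup>2) * (1 / D)"
    proof (intro mult_mono divide_right_mono CpN)
      have "D * D \<le> D ^ p" using p D1 power_increasing[of 2 p D] by (simp add: power2_eq_square)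
      then show "D / D ^ p \<le> 1 / D" using D by (simp add: field_simps)
    qed (use p c0 CN D in auto)
    also have "\<dots> = CN / (c0 ^ 4 * eta\<^sup>2 * D)" by simp
    finally show "?E (F2 r a p) \<le> CN / (c0 ^ 4 * eta\<^sup>2 * D)" .
  qed
  also have "\<dots> = CN / (eta\<^sup>2) ^ N * (real n * D / D ^ N) + card R * (CN / eta\<^sup>2 * (real n * D / D ^ N)
       + K * (8 / (c0 ^ 4 * M\<^sup>2) + real (N - 2) * (CN / (c0 ^ 4 * eta\<^sup>2 * D))))"
    by simp
  also have "\<dots> \<le> CN / (eta\<^sup>2) ^ N * (real n * D / D ^ N) + card R * (CN / eta\<^sup>2 * (real n * D / D ^ N)
       + K * (8 / (c0 ^ 4 * M\<^sup>2) + N * (CN / (c0 ^ 4 * eta\<^sup>2 * D))))"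
    using CN c0 D by (intro add_left_mono mult_left_mono add_mono mult_right_mono) auto
  finally show ?thesis .
qed

lemma good_imp_row_difference:
  assumes "\<And>l m. l < n \<Longrightarrow> m < n \<Longrightarrow> X l m = H l m + W l m"
    and symX: "\<And>l m. l < n \<Longrightarrow> m < n \<Longrightarrow> X l m = X m l"
    and X: "ordered_eigdecomp n X u \<delta>"
    and sign: "0 \<le> ip n (v k) (u k)"
    and c: "0 < c" "c \<le> 1" "\<And>k. k < K \<Longrightarrow> c * (real n * theta) \<le> d k"
      "\<And>a b. a < b \<Longrightarrow> b < K \<Longrightarrow> d b + c * (real n * theta) \<le> d a"
    and eta: "0 < eta" "eta \<le> c / 4" and k: "k < K" and N: "2 \<le> N" and M: "0 < M"
    and ij: "i < n" "j < n" and good: "good N eta M {i, j} W"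
  shows "(real n * sqrt theta) * \<bar>(u k i - u k j) - (V i k - V j k) - (mv n W (v k) i - mv n W (v k) j) / d k\<bar>
    \<le> (6 / c\<^sup>2 + 28 * K / c ^ 3 + (2 * N * K + 2) * (2 / c) ^ N) * eta
        * (1 + M + (real n * sqrt theta) * (\<Sum>a<K. \<bar>V i a - V j a\<bar>))"
    and "\<And>r a. r \<in> {i, j} \<Longrightarrow> a < K \<Longrightarrow> (real n * sqrt theta) * \<bar>mv n W (v a) r\<bar> \<le> M * (real n * theta)"
proof -
  define D where "D = real n * theta"
  define s where "s = real n * sqrt theta"
  have D: "0 < D" using nt_pos by (simp add: D_def)
  have s: "0 \<le> s" "s\<^sup>2 = (real n)\<^sup>2 * theta" using theta_pos by (auto simp: s_def power_mult_distrib)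
  have root: "s * \<bar>x\<bar> \<le> y" if "(real n)\<^sup>2 * theta * x\<^sup>2 \<le> y\<^sup>2" "0 \<le> y" for x y
  proof -
    have "(s * \<bar>x\<bar>)\<^sup>2 \<le> y\<^sup>2" using that(1) by (simp add: power_mult_distrib s)
    then show ?thesis by (rule power2_le_imp_le) (rule that(2))
  qed
  have symW: "W l m = W m l" if "l < n" "m < n" for l m
    using assms(1)[OF that] assms(1)[OF that(2) that(1)] symX[OF that] H_sym[of l m] by simp
  have orthU: "ip n (u a) (u b) = of_bool (a = b)" if "a < n" "b < n" for a b
    using X that by (auto simp: ordered_eigdecomp_def ip_def)
  have op: "ip n (mv n W x) (mv n W x) \<le> (eta * D)\<^sup>2 * ip n x x" for x
    by (rule mv_norm_le_of_frobenius[where N = N])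
      (use symW good N in \<open>auto simp: good_def D_def\<close>)
  have G1: "s * \<bar>mv n W (v a) r\<bar> \<le> M * D" if "r \<in> {i, j}" "a < K" for r a
    using good that M D by (intro root) (auto simp: good_def D_def)
  then show "\<And>r a. r \<in> {i, j} \<Longrightarrow> a < K \<Longrightarrow> (real n * sqrt theta) * \<bar>mv n W (v a) r\<bar> \<le> M * (real n * theta)"
    by (simp add: s_def D_def)
  have Gp: "s * \<bar>(mv n W ^^ p) (v a) r\<bar> \<le> eta * D ^ p" if "r \<in> {i, j}" "a < K" "2 \<le> p" "p < N" for r a p
    using good that eta D by (intro root) (auto simp: good_def D_def)
  \<comment> \<open>Squared entries in a row of \<open>V\<close> sum to at most 1 by
    \<open>Bessel\<close>; summing over the rows gives \<open>K \<le> n\<close>.\<close>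
  have kn: "k < n"
  proof -
    have "(\<Sum>a<K. (ip n (v a) (\<lambda>l. of_bool (l = m)))\<^sup>2) \<le> 1" if "m < n" for m
      using Bessel[of "{..<K}" n "\<lambda>k l. V l k" "\<lambda>l. of_bool (l = m)"] orthV that
      by (simp add: ip_def of_bool_def if_distrib sum.delta cong: if_cong)
    then have "(\<Sum>a<K. (V m a)\<^sup>2) \<le> 1" if "m < n" for m
      using that by (simp add: ip_def of_bool_def if_distrib sum.delta cong: if_cong)
    then have "(\<Sum>m<n. \<Sum>a<K. (V m a)\<^sup>2) \<le> (\<Sum>m<n. 1)" by (intro sum_mono) auto
    moreover have "(\<Sum>m<n. \<Sum>a<K. (V m a)\<^sup>2) = (\<Sum>a<K. ip n (v a) (v a))"
      unfolding ip_def power2_eq_square by (rule sum.swap)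
    ultimately have "K \<le> n" by (simp add: orthV)
    then show ?thesis using k by simp
  qed
  \<comment> \<open>The eigenvector depends on W, so the moment bound for fixed vectors does not
    apply; Cauchy-Schwarz against the row norm of \<open>W ^ N\<close> replaces it.\<close>
  have GN: "s * \<bar>(mv n W ^^ N) (u k) r\<bar> \<le> eta * D ^ N" if "r \<in> {i, j}" for r
  proof (rule root)
    have r: "r < n" using that ij by auto
    have "(real n)\<^sup>2 * theta * ((mv n W ^^ N) (u k) r)\<^sup>2 \<le> (real n)\<^sup>2 * theta * rowsq n W N r"
      using mv_pow_sq_le_rowsq[where W = W and p = N and x = "u k", OF r] orthU[OF kn kn] theta_pos by (intro mult_left_mono) auto
    also have "\<dots> \<le> (eta * D ^ N)\<^sup>2" using good that by (auto simp: good_def D_def)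
    finally show "(real n)\<^sup>2 * theta * ((mv n W ^^ N) (u k) r)\<^sup>2 \<le> (eta * D ^ N)\<^sup>2" .
  qed (use eta D in simp)
  show "(real n * sqrt theta) * \<bar>(u k i - u k j) - (V i k - V j k) - (mv n W (v k) i - mv n W (v k) j) / d k\<bar>
    \<le> (6 / c\<^sup>2 + 28 * K / c ^ 3 + (2 * N * K + 2) * (2 / c) ^ N) * eta
        * (1 + M + (real n * sqrt theta) * (\<Sum>a<K. \<bar>V i a - V j a\<bar>))"
    unfolding s_def[symmetric]
  proof (rule eigvec_row_difference[where X = X and \<delta> = \<delta>, OF assms(1) symX orthU _ _ sign c(1,2) c(3,4) _ _ k N s(1) _ ij])
    show "mv n X (u k) l = \<delta> k * u k l" if "k < n" "l < n" for k l
      using X that by (simp add: ordered_eigdecomp_def mv_def)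
    show "\<bar>\<delta> b\<bar> \<le> \<bar>\<delta> a\<bar>" if "a \<le> b" "b < n" for a b using X that by (simp add: ordered_eigdecomp_def)
  qed (use op G1 Gp GN eta M in \<open>auto simp: D_def\<close>)
qed

end

section \<open>Weak convergence from Laplace transforms\<close>

text \<open>As \<open>Q n\<close> is nonnegative for large n, \<open>exp (- Q n x)\<close> lies in
  [0, 1], and its moments are the Laplace transform at natural numbers. Polynomial approximation
  passes from moments to continuous functions on [0, 1].\<close>

lemma weak_conv_of_Laplace:
  fixes Q :: "nat \<Rightarrow> 'a \<Rightarrow> real" and M :: "nat \<Rightarrow> 'a measure" and Z :: "'b \<Rightarrow> real" and L :: "'b measure"
  assumes M: "\<And>n. prob_space (M n)" and L: "prob_space L"
    and Q [measurable]: "\<And>n. Q n \<in> borel_measurable (M n)" and Z [measurable]: "Z \<in> borel_measurable L"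
    and Q0: "\<forall>\<^sub>F n in sequentially. \<forall>x\<in>space (M n). 0 \<le> Q n x" and Z0: "\<And>x. x \<in> space L \<Longrightarrow> 0 \<le> Z x"
    and lim: "\<And>k::nat. (\<lambda>n. \<integral>x. exp (- real k * Q n x) \<partial>M n) \<longlonglongrightarrow> (\<integral>x. exp (- real k * Z x) \<partial>L)"
  shows "weak_conv_m (\<lambda>n. distr (M n) borel (Q n)) (distr L borel Z)"
proof -
  interpret L: prob_space L by (rule L)
  have poly: "(\<lambda>n. \<integral>x. g (exp (- Q n x)) \<partial>M n) \<longlonglongrightarrow> (\<integral>x. g (exp (- Z x)) \<partial>L)"
    if gp: "real_polynomial_function g" for g :: "real \<Rightarrow> real"
  proof -
    obtain a m where g: "g = (\<lambda>x. \<Sum>i\<le>m. a i * x ^ i)"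
      using gp unfolding real_polynomial_function_iff_sum by auto
    have pw: "exp (- q) ^ i = exp (- real i * q)" for q :: real and i
      by (simp add: exp_of_nat_mult[symmetric])
    have intL: "integrable L (\<lambda>x. exp (- real i * Z x))" for i
      using Z0 by (intro L.integrable_const_bound[where B = 1] AE_I2) auto
    have eqL: "(\<integral>x. g (exp (- Z x)) \<partial>L) = (\<Sum>i\<le>m. a i * (\<integral>x. exp (- real i * Z x) \<partial>L))"
      unfolding g pw using intL by (simp add: Bochner_Integration.integral_sum)
    have eqM: "\<forall>\<^sub>F n in sequentially. (\<Sum>i\<le>m. a i * (\<integral>x. exp (- real i * Q n x) \<partial>M n)) = (\<integral>x. g (exp (- Q n x)) \<partial>M n)"
      using Q0
    proof eventually_elim
      case (elim n)
      interpret Mn: prob_space "M n" by (rule M)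
      have "integrable (M n) (\<lambda>x. exp (- real i * Q n x))" for i
        using elim by (intro Mn.integrable_const_bound[where B = 1] AE_I2) auto
      then show ?case unfolding g pw by (simp add: Bochner_Integration.integral_sum)
    qed
    have "(\<lambda>n. \<Sum>i\<le>m. a i * (\<integral>x. exp (- real i * Q n x) \<partial>M n)) \<longlonglongrightarrow> (\<Sum>i\<le>m. a i * (\<integral>x. exp (- real i * Z x) \<partial>L))"
      by (intro tendsto_sum tendsto_mult tendsto_const lim)
    then show ?thesis unfolding eqL by (rule Lim_transform_eventually) (rule eqM)
  qed
  have cont: "(\<lambda>n. \<integral>x. f (exp (- Q n x)) \<partial>M n) \<longlonglongrightarrow> (\<integral>x. f (exp (- Z x)) \<partial>L)"
    if f: "continuous_on {0..1} f" and fb [measurable]: "f \<in> borel_measurable borel" and bd: "\<And>x. \<bar>f x\<bar> \<le> 1" for f :: "real \<Rightarrow> real"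
  proof (rule LIMSEQ_I)
    fix e :: real assume e: "0 < e"
    then have "0 < e / 3" by simp
    from Stone_Weierstrass_real_polynomial_function[OF compact_Icc f this]
    obtain g where g: "real_polynomial_function g" "\<And>x. x \<in> {0..1} \<Longrightarrow> \<bar>f x - g x\<bar> < e / 3" by blast
    have [measurable]: "g \<in> borel_measurable borel"
      using continuous_real_polymonial_function[OF g(1)] by (intro borel_measurable_continuous_onI continuous_at_imp_continuous_on) auto
    have gb: "\<bar>g x\<bar> \<le> 1 + e / 3" if "x \<in> {0..1}" for x using g(2)[OF that] bd[of x] by linarith
    have close: "\<bar>(\<integral>x. f (exp (- X x)) \<partial>N) - (\<integral>x. g (exp (- X x)) \<partial>N)\<bar> \<le> e / 3"
      if N: "prob_space N" and X [measurable]: "X \<in> borel_measurable N" and X0: "\<And>x. x \<in> space N \<Longrightarrow> 0 \<le> X x"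
      for N :: "'c measure" and X
    proof -
      interpret N: prob_space N by (rule N)
      have if': "integrable N (\<lambda>x. f (exp (- X x)))" using bd by (intro N.integrable_const_bound[where B = 1] AE_I2) auto
      have ig: "integrable N (\<lambda>x. g (exp (- X x)))"
        using gb X0 by (intro N.integrable_const_bound[where B = "1 + e / 3"] AE_I2) auto
      have "\<bar>(\<integral>x. f (exp (- X x)) \<partial>N) - (\<integral>x. g (exp (- X x)) \<partial>N)\<bar> = \<bar>\<integral>x. f (exp (- X x)) - g (exp (- X x)) \<partial>N\<bar>"
        using if' ig by simp
      also have "\<dots> \<le> (\<integral>x. \<bar>f (exp (- X x)) - g (exp (- X x))\<bar> \<partial>N)" by (rule integral_abs_bound)
      also have "\<dots> \<le> (\<integral>x. e / 3 \<partial>N)"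
        using if' ig X0 g(2) by (intro integral_mono) (auto intro!: less_imp_le)
      finally show ?thesis by (simp add: N.prob_space)
    qed
    from LIMSEQ_D[OF poly[OF g(1)] \<open>0 < e / 3\<close>]
    obtain n0 where n0: "\<And>n. n \<ge> n0 \<Longrightarrow> \<bar>(\<integral>x. g (exp (- Q n x)) \<partial>M n) - (\<integral>x. g (exp (- Z x)) \<partial>L)\<bar> < e / 3" by auto
    obtain n1 where n1: "\<And>n x. n \<ge> n1 \<Longrightarrow> x \<in> space (M n) \<Longrightarrow> 0 \<le> Q n x"
      using Q0 unfolding eventually_sequentially by blast
    show "\<exists>n0. \<forall>n\<ge>n0. norm ((\<integral>x. f (exp (- Q n x)) \<partial>M n) - (\<integral>x. f (exp (- Z x)) \<partial>L)) < e"
    proof (intro exI[of _ "max n0 n1"] allI impI)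
      fix n assume n: "max n0 n1 \<le> n"
      have "\<bar>(\<integral>x. f (exp (- Q n x)) \<partial>M n) - (\<integral>x. g (exp (- Q n x)) \<partial>M n)\<bar> \<le> e / 3"
        using n1 n by (intro close M Q) auto
      moreover have "\<bar>(\<integral>x. f (exp (- Z x)) \<partial>L) - (\<integral>x. g (exp (- Z x)) \<partial>L)\<bar> \<le> e / 3"
        using Z0 by (intro close L Z) auto
      ultimately show "norm ((\<integral>x. f (exp (- Q n x)) \<partial>M n) - (\<integral>x. f (exp (- Z x)) \<partial>L)) < e"
        using n0[of n] n by (simp add: abs_if split: if_splits)
    qed
  qed
  have rd: "real_distribution (distr N borel X)" if "prob_space N" "X \<in> borel_measurable N" for N :: "'c measure" and X
    using that by (intro prob_space.real_distribution_distr) auto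
  show ?thesis
  proof (rule integral_cts_step_conv_imp_weak_conv)
    show "real_distribution (distr (M n) borel (Q n))" for n using rd[OF M Q] .
    show "real_distribution (distr L borel Z)" using rd[OF L Z] .
    fix a b :: real assume ab: "a < b"
    \<comment> \<open>The ramp that tests weak convergence, in the variable
      \<open>u = exp (- x)\<close>. Since \<open>cts_step a b\<close> vanishes beyond
      \<open>b\<close>, \<open>f\<close> is 0 below \<open>exp (- b)\<close> and therefore
      continuous at 0, the image of infinity.\<close>
    define f where "f = (\<lambda>u. if u \<le> 0 then 0 else cts_step a b (- ln u))"
    have cs: "continuous_on UNIV (cts_step a b)"
      using cts_step_uniformly_continuous[OF ab] uniformly_continuous_imp_continuous by blast
    have [measurable]: "cts_step a b \<in> borel_measurable borel"
      by (rule borel_measurable_continuous_onI[OF cs])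
    have fm: "f \<in> borel_measurable borel" unfolding f_def by measurable
    have f1: "\<bar>f x\<bar> \<le> 1" for x using ab by (auto simp: f_def cts_step_def field_simps)
    have fc: "continuous_on {0..1} f"
    proof (rule continuous_at_imp_continuous_on, rule ballI)
      fix u :: real assume u: "u \<in> {0..1}"
      show "isCont f u"
      proof (cases "u = 0")
        case True
        have "\<forall>\<^sub>F x in nhds u. f x = 0"
          unfolding eventually_nhds
        proof (intro exI[of _ "{..< exp (- b)}"] conjI ballI)
          fix x assume x: "x \<in> {..< exp (- b)}"
          show "f x = 0"
          proof (cases "x \<le> 0")
            case False
            then have "ln x < - b" using x by (simp add: ln_less_cancel_iff[symmetric, of x "exp (- b)"] del: ln_less_cancel_iff)
            then show ?thesis using False ab by (auto simp: f_def cts_step_def)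
          qed (simp add: f_def)
        qed (use True in auto)
        then show ?thesis by (subst isCont_cong[where g = "\<lambda>_. 0"]) auto
      next
        case False
        then have up: "0 < u" using u by simp
        have "isCont (\<lambda>u. cts_step a b (- ln u)) u"
        proof (rule isCont_o2[where f = "\<lambda>u. - ln u"])
          show "isCont (\<lambda>u. - ln u) u" using up by (intro continuous_intros) auto
          show "isCont (cts_step a b) (- ln u)" using cs by (simp add: continuous_on_eq_continuous_at)
        qed
        moreover have "\<forall>\<^sub>F x in nhds u. f x = cts_step a b (- ln x)"
          unfolding eventually_nhds using up by (intro exI[of _ "{0<..}"]) (auto simp: f_def)
        ultimately show ?thesis by (subst isCont_cong[where g = "\<lambda>u. cts_step a b (- ln u)"]) auto
      qed
    qed
    have fe: "f (exp (- x)) = cts_step a b x" for x by (simp add: f_def)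
    have "(\<lambda>n. \<integral>x. cts_step a b (Q n x) \<partial>M n) \<longlonglongrightarrow> (\<integral>x. cts_step a b (Z x) \<partial>L)"
      using cont[OF fc fm f1] unfolding fe .
    then show "(\<lambda>n. integral\<^sup>L (distr (M n) borel (Q n)) (cts_step a b)) \<longlonglongrightarrow> integral\<^sup>L (distr L borel Z) (cts_step a b)"
      by (simp add: integral_distr)
  qed
qed

subsection \<open>Characteristic functions of centred Bernoulli sums\<close>

text \<open>Second-order Taylor expansion at the two values of a centred Bernoulli variable; the
  linear terms cancel. Keeping the variance \<open>v\<close> as a factor of the error is the point,
  as the errors are to be summed over many edges of small probability.\<close>

lemma cmod_bernoulli_char_le:
  fixes p x :: real
  assumes p: "0 \<le> p" "p \<le> 1"
  defines "v \<equiv> p * (1 - p)"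
  shows "cmod (p * iexp (x * (1 - p)) + (1 - p) * iexp (- x * p) - exp (- (x\<^sup>2 * v) / 2)) \<le> (\<bar>x\<bar> ^ 3 + x ^ 4) * v"
proof -
  let ?T = "\<lambda>y::real. 1 + \<i> * y - y\<^sup>2 / 2 :: complex"
  have app: "cmod (iexp y - ?T y) \<le> \<bar>y\<bar> ^ 3 / 6" for y :: real
    using iexp_approx1[of y 2] by (simp add: numeral_2_eq_2 numeral_3_eq_3 power_mult_distrib fact_numeral algebra_simps)
  have v: "0 \<le> v" "v \<le> 1" using p by (auto simp: v_def mult_le_one)
  have "complex_of_real p * ?T (x * (1 - p)) + (1 - p) * ?T (- x * p) = of_real (1 - x\<^sup>2 * v / 2)"
    by (simp add: v_def complex_eq_iff power2_eq_square field_simps)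
  then have "p * iexp (x * (1 - p)) + (1 - p) * iexp (- x * p) - exp (- (x\<^sup>2 * v) / 2) =
     complex_of_real p * (iexp (x * (1 - p)) - ?T (x * (1 - p))) + (1 - p) * (iexp (- x * p) - ?T (- x * p))
      + of_real (1 - x\<^sup>2 * v / 2 - exp (- (x\<^sup>2 * v) / 2))"
    by (simp add: algebra_simps exp_of_real)
  also have "cmod \<dots> \<le> p * (\<bar>x * (1 - p)\<bar> ^ 3 / 6) + (1 - p) * (\<bar>- x * p\<bar> ^ 3 / 6) + (x\<^sup>2 * v / 2)\<^sup>2"
  proof (intro order_trans[OF norm_triangle_ineq] add_mono)
    show "cmod (complex_of_real p * (iexp (x * (1 - p)) - ?T (x * (1 - p)))) \<le> p * (\<bar>x * (1 - p)\<bar> ^ 3 / 6)"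
      unfolding norm_mult by (rule mult_mono[OF _ app]) (use p in simp_all)
    show "cmod (complex_of_real (1 - p) * (iexp (- x * p) - ?T (- x * p))) \<le> (1 - p) * (\<bar>- x * p\<bar> ^ 3 / 6)"
      unfolding norm_mult norm_of_real by (rule mult_mono[OF _ app]) (use p in simp_all)
    have "\<bar>1 - y - exp (- y)\<bar> \<le> y\<^sup>2" if "0 \<le> y" for y :: real
    proof -
      have "1 - y \<le> exp (- y)" using exp_ge_add_one_self[of "- y"] by simp
      moreover have "exp (- y) \<le> 1 - y + y\<^sup>2"
      proof -
        have "(1 + y) * exp (- y) \<le> 1" using exp_ge_add_one_self[of y] by (simp add: exp_minus field_simps)
        also have "\<dots> \<le> (1 + y) * (1 - y + y\<^sup>2)" using that by (simp add: algebra_simps power2_eq_square)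
        finally show ?thesis using that by simp
      qed
      ultimately show ?thesis by linarith
    qed
    from this[of "x\<^sup>2 * v / 2"] show "cmod (complex_of_real (1 - x\<^sup>2 * v / 2 - exp (- (x\<^sup>2 * v) / 2))) \<le> (x\<^sup>2 * v / 2)\<^sup>2"
      using v unfolding norm_of_real by simp
  qed
  also have "\<dots> \<le> \<bar>x\<bar> ^ 3 * v + x ^ 4 * v"
  proof (intro add_mono)
    have a: "p * (1 - p) ^ 3 \<le> v"
      using p power_decreasing[of 1 3 "1 - p"] by (auto simp: v_def intro!: mult_left_mono)
    have b: "(1 - p) * p ^ 3 \<le> v"
      using p power_decreasing[of 1 3 p] by (subst v_def, subst mult.commute[of p]) (auto intro!: mult_left_mono)
    have "p * (\<bar>x * (1 - p)\<bar> ^ 3 / 6) + (1 - p) * (\<bar>- x * p\<bar> ^ 3 / 6) = \<bar>x\<bar> ^ 3 / 6 * (p * (1 - p) ^ 3 + (1 - p) * p ^ 3)"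
    proof -
      have eq: "\<bar>x * (1 - p)\<bar> = \<bar>x\<bar> * (1 - p)" "\<bar>- x * p\<bar> = \<bar>x\<bar> * p" using p by (auto simp: abs_mult)
      show ?thesis unfolding eq power_mult_distrib by (simp add: field_simps)
    qed
    also have "\<dots> \<le> \<bar>x\<bar> ^ 3 / 6 * (v + v)" using a b by (intro mult_left_mono add_mono) auto
    also have "\<dots> \<le> \<bar>x\<bar> ^ 3 * v" using v by simp
    finally show "p * (\<bar>x * (1 - p)\<bar> ^ 3 / 6) + (1 - p) * (\<bar>- x * p\<bar> ^ 3 / 6) \<le> \<bar>x\<bar> ^ 3 * v" .
    have "(x\<^sup>2 * v / 2)\<^sup>2 = x ^ 4 * (v * v / 4)" by (simp add: power2_eq_square power4_eq_xxxx)
    also have "\<dots> \<le> x ^ 4 * (v * 1)"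
    proof (rule mult_left_mono)
      have "v * v \<le> v * 1" using v by (intro mult_left_mono) auto
      then show "v * v / 4 \<le> v * 1" using v by simp
    qed simp
    finally show "(x\<^sup>2 * v / 2)\<^sup>2 \<le> x ^ 4 * v" by simp
  qed
  finally show ?thesis by (simp add: distrib_right)
qed

text \<open>Lindeberg-type telescoping over factors of modulus at most 1. The error is the total
  variance times a function of the largest coefficient, so uniformly small coefficients give the
  central limit theorem.\<close>

lemma char_edge_sum_approx:
  fixes a :: "nat \<times> nat \<Rightarrow> real" and H :: "nat \<Rightarrow> nat \<Rightarrow> real"
  defines "v \<equiv> \<lambda>e. H (fst e) (snd e) * (1 - H (fst e) (snd e))"
  assumes H: "\<And>e. e \<in> edges n \<Longrightarrow> 0 \<le> H (fst e) (snd e) \<and> H (fst e) (snd e) \<le> 1"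
    and a: "\<And>e. e \<in> edges n \<Longrightarrow> \<bar>a e\<bar> \<le> m"
  shows "cmod ((\<integral>s. iexp (\<Sum>e\<in>edges n. a e * (of_bool (s e) - H (fst e) (snd e))) \<partial>edge_pmf n H)
      - exp (- (\<Sum>e\<in>edges n. (a e)\<^sup>2 * v e) / 2)) \<le> (m + m\<^sup>2) * (\<Sum>e\<in>edges n. (a e)\<^sup>2 * v e)"
proof -
  let ?h = "\<lambda>e. H (fst e) (snd e)"
  define z where "z = (\<lambda>e. ?h e * iexp (a e * (1 - ?h e)) + (1 - ?h e) * iexp (- a e * ?h e))"
  define w where "w = (\<lambda>e. complex_of_real (exp (- ((a e)\<^sup>2 * v e) / 2)))"
  have v0: "0 \<le> v e" if "e \<in> edges n" for e using H[OF that] by (simp add: v_def)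
  have "(\<integral>s. iexp (\<Sum>e\<in>edges n. a e * (of_bool (s e) - ?h e)) \<partial>edge_pmf n H) =
     (\<integral>s. (\<Prod>e\<in>edges n. iexp (a e * (of_bool (s e) - ?h e))) \<partial>edge_pmf n H)"
    by (simp add: exp_sum sum_distrib_left)
  also have "\<dots> = (\<Prod>e\<in>edges n. measure_pmf.expectation (bernoulli_pmf (?h e)) (\<lambda>b. iexp (a e * (of_bool b - ?h e))))"
    by (rule expectation_prod_edges)
  also have "\<dots> = (\<Prod>e\<in>edges n. z e)"
  proof (rule prod.cong[OF refl])
    fix e assume "e \<in> edges n"
    then show "measure_pmf.expectation (bernoulli_pmf (?h e)) (\<lambda>b. iexp (a e * (of_bool b - ?h e))) = z e"
      using H[of e] by (subst integral_measure_pmf[where A = UNIV]) (auto simp: z_def scaleR_conv_of_real UNIV_bool)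
  qed
  finally have E: "(\<integral>s. iexp (\<Sum>e\<in>edges n. a e * (of_bool (s e) - ?h e)) \<partial>edge_pmf n H) = (\<Prod>e\<in>edges n. z e)" .
  have "exp (- (\<Sum>e\<in>edges n. (a e)\<^sup>2 * v e) / 2) = (\<Prod>e\<in>edges n. exp (- ((a e)\<^sup>2 * v e) / 2))"
    by (simp add: exp_sum[symmetric] sum_negf sum_divide_distrib)
  then have W: "complex_of_real (exp (- (\<Sum>e\<in>edges n. (a e)\<^sup>2 * v e) / 2)) = (\<Prod>e\<in>edges n. w e)"
    by (simp add: w_def)
  have "cmod ((\<Prod>e\<in>edges n. z e) - (\<Prod>e\<in>edges n. w e)) \<le> (\<Sum>e\<in>edges n. cmod (z e - w e))"
  proof (rule norm_prod_diff)
    fix e assume e: "e \<in> edges n"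
    have "cmod (z e) \<le> ?h e * 1 + (1 - ?h e) * 1"
      unfolding z_def using H[OF e]
      by (intro order_trans[OF norm_triangle_ineq] add_mono) (auto simp: norm_mult simp del: of_real_diff)
    then show "cmod (z e) \<le> 1" by simp
    show "cmod (w e) \<le> 1" using v0[OF e] by (simp add: w_def)
  qed
  also have "\<dots> \<le> (\<Sum>e\<in>edges n. (m + m\<^sup>2) * ((a e)\<^sup>2 * v e))"
  proof (rule sum_mono)
    fix e assume e: "e \<in> edges n"
    have m: "0 \<le> m" using a[OF e] by linarith
    have "cmod (z e - w e) \<le> (\<bar>a e\<bar> ^ 3 + (a e) ^ 4) * v e"
      unfolding z_def w_def v_def using H[OF e] by (intro cmod_bernoulli_char_le) auto
    also have "\<dots> = (\<bar>a e\<bar> + \<bar>a e\<bar>\<^sup>2) * ((a e)\<^sup>2 * v e)"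
      by (simp add: power2_eq_square power3_eq_cube power4_eq_xxxx algebra_simps)
    also have "\<dots> \<le> (m + m\<^sup>2) * ((a e)\<^sup>2 * v e)"
      using a[OF e] v0[OF e] m by (intro mult_right_mono add_mono power_mono) auto
    finally show "cmod (z e - w e) \<le> (m + m\<^sup>2) * ((a e)\<^sup>2 * v e)" .
  qed
  finally show ?thesis unfolding E W by (simp add: sum_distrib_left)
qed

section \<open>Convergence to the chi-square law\<close>

lemma prob_space_std_normal: "prob_space std_normal"
  unfolding std_normal_def by (rule prob_space_normal_density) simp

lemma sets_std_normal [simp, measurable_cong]: "sets std_normal = sets borel"
  by (simp add: std_normal_def)

lemma space_std_normal [simp]: "space std_normal = UNIV"
  by (simp add: std_normal_def)

lemma integral_iexp_std_normal: "(\<integral>g. iexp (t * g) \<partial>std_normal) = of_real (exp (- t\<^sup>2 / 2))"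
  using char_std_normal_distribution by (simp add: char_def std_normal_def fun_eq_iff)

text \<open>Fubini for exp (i sqrt t g (z + m)) with independent normal g and z: integrating over z
  leaves one side, integrating over g the other.\<close>

lemma std_normal_Laplace_square:
  fixes t m :: real
  assumes t: "0 \<le> t"
  shows "(\<integral>g. iexp (sqrt t * g * m) * of_real (exp (- (t * g\<^sup>2) / 2)) \<partial>std_normal)
    = of_real (\<integral>z. exp (- (t * (z + m)\<^sup>2) / 2) \<partial>std_normal)"
proof -
  interpret N: prob_space std_normal by (rule prob_space_std_normal)
  interpret NN: pair_prob_space std_normal std_normal ..
  let ?f = "\<lambda>g z. iexp (sqrt t * g * (z + m))"
  have int: "integrable (std_normal \<Otimes>\<^sub>M std_normal) (\<lambda>(g, z). ?f g z)"
    by (intro NN.integrable_const_bound[where B = 1] AE_I2) (auto simp: case_prod_beta)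
  have "(\<integral>g. iexp (sqrt t * g * m) * of_real (exp (- (t * g\<^sup>2) / 2)) \<partial>std_normal) = (\<integral>g. (\<integral>z. ?f g z \<partial>std_normal) \<partial>std_normal)"
  proof (rule Bochner_Integration.integral_cong[OF refl])
    fix g
    have "(\<integral>z. ?f g z \<partial>std_normal) = (\<integral>z. iexp (sqrt t * g * m) * iexp (sqrt t * g * z) \<partial>std_normal)"
      by (intro Bochner_Integration.integral_cong refl) (simp add: exp_add[symmetric] algebra_simps)
    also have "\<dots> = iexp (sqrt t * g * m) * (\<integral>z. iexp (sqrt t * g * z) \<partial>std_normal)" by simp
    also have "(\<integral>z. iexp (sqrt t * g * z) \<partial>std_normal) = of_real (exp (- (t * g\<^sup>2) / 2))"
      unfolding integral_iexp_std_normal using t by (simp add: power_mult_distrib)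
    finally show "iexp (sqrt t * g * m) * of_real (exp (- (t * g\<^sup>2) / 2)) = (\<integral>z. ?f g z \<partial>std_normal)" by simp
  qed
  also have "\<dots> = (\<integral>z. (\<integral>g. ?f g z \<partial>std_normal) \<partial>std_normal)"
    by (rule NN.Fubini_integral[OF int, symmetric])
  also have "\<dots> = (\<integral>z. complex_of_real (exp (- (t * (z + m)\<^sup>2) / 2)) \<partial>std_normal)"
  proof (rule Bochner_Integration.integral_cong[OF refl])
    fix z
    have "(\<integral>g. ?f g z \<partial>std_normal) = (\<integral>g. iexp ((sqrt t * (z + m)) * g) \<partial>std_normal)"
      by (intro Bochner_Integration.integral_cong refl) (simp add: mult_ac)
    then show "(\<integral>g. ?f g z \<partial>std_normal) = complex_of_real (exp (- (t * (z + m)\<^sup>2) / 2))"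
      unfolding integral_iexp_std_normal using t by (simp add: power_mult_distrib)
  qed
  finally show ?thesis by simp
qed

text \<open>The derivative is bounded because |x| \<le> 1 + x^2 \<le> exp (j x^2) for j \<ge> 1.
  Closeness of the coordinates thus transfers to the Laplace transform of their squares without any
  tightness argument.\<close>

lemma exp_neg_sq_Lipschitz:
  fixes a b :: real and j :: nat
  shows "\<bar>exp (- real j * a\<^sup>2) - exp (- real j * b\<^sup>2)\<bar> \<le> 2 * real j * \<bar>a - b\<bar>"
proof -
  have bd: "\<bar>exp (- real j * x\<^sup>2) * (- real j * (2 * x))\<bar> \<le> 2 * real j" for x :: real
  proof (cases "j = 0")
    case False
    have "x\<^sup>2 \<le> real j * x\<^sup>2" using False by (simp add: mult_le_cancel_right1 Suc_le_eq)
    then have "1 + x\<^sup>2 \<le> exp (real j * x\<^sup>2)" using exp_ge_add_one_self[of "real j * x\<^sup>2"] by linarith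
    moreover have "\<bar>x\<bar> \<le> 1 + x\<^sup>2"
    proof -
      have "0 \<le> (\<bar>x\<bar> - 1 / 2)\<^sup>2" by simp
      then show ?thesis by (simp add: power2_eq_square algebra_simps abs_mult[symmetric])
    qed
    ultimately have "\<bar>x\<bar> \<le> exp (real j * x\<^sup>2)" by linarith
    then have "exp (- real j * x\<^sup>2) * \<bar>x\<bar> \<le> 1" by (simp add: exp_minus field_simps)
    then have "2 * real j * (exp (- real j * x\<^sup>2) * \<bar>x\<bar>) \<le> 2 * real j * 1" by (intro mult_left_mono) auto
    then show ?thesis by (simp add: abs_mult mult_ac)
  qed simp
  have "norm (exp (- real j * a\<^sup>2) - exp (- real j * b\<^sup>2)) \<le> 2 * real j * norm (a - b)"
  proof (rule field_differentiable_bound[where S = UNIV])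
    show "((\<lambda>x. exp (- real j * x\<^sup>2)) has_field_derivative exp (- real j * z\<^sup>2) * (- real j * (2 * z))) (at z within UNIV)" for z :: real
      by (auto intro!: derivative_eq_intros)
  qed (use bd in auto)
  then show ?thesis by simp
qed

text \<open>The Gaussian average \<open>E exp (i \<surd>t g \<cdot> y) = exp (- t |y|\<^sup>2 / 2)\<close> over an independent \<open>g\<close> turns the
  Laplace transform of \<open>|Y|\<^sup>2\<close> into an average of characteristic functions of \<open>Y\<close>, so no multivariate
  continuity theorem is needed.\<close>

lemma weak_conv_chi_square:
  fixes Y A :: "nat \<Rightarrow> nat \<Rightarrow> 'a \<Rightarrow> real" and p :: "nat \<Rightarrow> 'a pmf" and \<rho> :: "nat \<Rightarrow> real" and mu :: real
  assumes fin: "\<And>n. finite (set_pmf (p n))"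
    and clt: "\<And>u. (\<lambda>n. \<integral>s. iexp (\<Sum>k<K. u k * Y n k s) \<partial>p n) \<longlonglongrightarrow> of_real (exp (- (\<Sum>k<K. (u k)\<^sup>2) / 2))"
    and rho: "\<rho> \<longlonglongrightarrow> sqrt mu" and K: "1 \<le> K"
    and approx: "\<And>e. 0 < e \<Longrightarrow> (\<lambda>n. measure_pmf.prob (p n) {s. \<exists>k<K. e < \<bar>A n k s - (Y n k s + (if k = 0 then \<rho> n else 0))\<bar>}) \<longlonglongrightarrow> 0"
  shows "weak_conv_m (\<lambda>n. distr (measure_pmf (p n)) borel (\<lambda>s. \<Sum>k<K. (A n k s)\<^sup>2)) (chi_square K mu)"
  unfolding chi_square_def
proof (rule weak_conv_of_Laplace)
  interpret N: prob_space std_normal by (rule prob_space_std_normal)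
  interpret P: finite_product_prob_space "\<lambda>_::nat. std_normal" "{..<K}" by unfold_locales auto
  let ?N = "PiM {..<K} (\<lambda>_. std_normal)"
  define mm where "mm = (\<lambda>k::nat. if k = 0 then sqrt mu else 0)"
  show "prob_space (measure_pmf (p n))" for n by (rule measure_pmf.prob_space_axioms)
  show "prob_space ?N" by (rule P.prob_space_axioms)
  show "(\<lambda>z. \<Sum>k<K. (z k + (if k = 0 then sqrt mu else 0))\<^sup>2) \<in> borel_measurable ?N" by measurable
  have int: "integrable (measure_pmf (p n)) f" for f :: "'a \<Rightarrow> 'c::{banach, second_countable_topology}" and n
    by (rule integrable_measure_pmf_finite) (rule fin)
  fix j :: nat
  \<comment> \<open>Chosen so that \<open>exp (- t * y\<^sup>2 / 2)\<close> is
    \<open>exp (- j * y\<^sup>2)\<close>.\<close>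
  define t where "t = 2 * real j"
  have t: "0 \<le> t" by (simp add: t_def)
  define B where "B = (\<lambda>n k s. Y n k s + (if k = 0 then \<rho> n else 0))"
  \<comment> \<open>Characteristic function of \<open>B n\<close> at the random point
    \<open>sqrt t * g\<close>; the deterministic shift sits in coordinate 0 and contributes only a
    phase.\<close>
  define \<Phi> where "\<Phi> = (\<lambda>n g. iexp (sqrt t * g 0 * \<rho> n) * (\<integral>s. iexp (\<Sum>k<K. (sqrt t * g k) * Y n k s) \<partial>p n))"
  have exE: "exp (- real j * (\<Sum>k<K. (f k)\<^sup>2)) = (\<Prod>k<K. exp (- (t * (f k)\<^sup>2) / 2))" for f :: "nat \<Rightarrow> real"
    by (simp add: exp_sum[symmetric] sum_distrib_left t_def)
  have sum0: "(\<Sum>k<K. g k * (if k = 0 then r else 0)) = g 0 * r" for g :: "nat \<Rightarrow> real" and r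
    using K by (simp add: if_distrib sum.delta cong: if_cong)
  have Bint: "of_real (\<integral>s. exp (- real j * (\<Sum>k<K. (B n k s)\<^sup>2)) \<partial>p n) = (\<integral>g. \<Phi> n g \<partial>?N)" for n
  proof -
    have pt: "complex_of_real (exp (- real j * (\<Sum>k<K. (B n k s)\<^sup>2))) = (\<integral>g. (\<Prod>k<K. iexp (sqrt t * B n k s * g k)) \<partial>?N)" for s
    proof -
      have "(\<integral>g. (\<Prod>k<K. iexp (sqrt t * B n k s * g k)) \<partial>?N) = (\<Prod>k<K. \<integral>g. iexp (sqrt t * B n k s * g) \<partial>std_normal)"
        by (intro P.product_integral_prod N.integrable_iexp) auto
      also have "\<dots> = (\<Prod>k<K. complex_of_real (exp (- (t * (B n k s)\<^sup>2) / 2)))"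
        unfolding integral_iexp_std_normal using t by (simp add: power_mult_distrib)
      finally show ?thesis unfolding exE by simp
    qed
    have intP: "integrable ?N (\<lambda>g. \<Prod>k<K. iexp (sqrt t * B n k s * g k))" for s
      by (intro P.product_integrable_prod N.integrable_iexp) auto
    have "complex_of_real (\<integral>s. exp (- real j * (\<Sum>k<K. (B n k s)\<^sup>2)) \<partial>p n) =
       (\<integral>s. (\<integral>g. (\<Prod>k<K. iexp (sqrt t * B n k s * g k)) \<partial>?N) \<partial>p n)"
      unfolding pt[symmetric] by simp
    \<comment> \<open>Finite support makes the outer integral a finite sum, which exchanges with the
      Gaussian integral.\<close>
    also have "\<dots> = (\<Sum>s\<in>set_pmf (p n). pmf (p n) s *\<^sub>R (\<integral>g. (\<Prod>k<K. iexp (sqrt t * B n k s * g k)) \<partial>?N))"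
      by (rule integral_measure_pmf[OF fin]) 
    also have "\<dots> = (\<integral>g. (\<Sum>s\<in>set_pmf (p n). pmf (p n) s *\<^sub>R (\<Prod>k<K. iexp (sqrt t * B n k s * g k))) \<partial>?N)"
      using intP by (subst Bochner_Integration.integral_sum) auto
    also have "\<dots> = (\<integral>g. \<Phi> n g \<partial>?N)"
    proof (rule Bochner_Integration.integral_cong[OF refl])
      fix g
      have "(\<Sum>s\<in>set_pmf (p n). pmf (p n) s *\<^sub>R (\<Prod>k<K. iexp (sqrt t * B n k s * g k))) = (\<integral>s. (\<Prod>k<K. iexp (sqrt t * B n k s * g k)) \<partial>p n)"
        by (rule integral_measure_pmf[OF fin, symmetric])
      also have "\<dots> = (\<integral>s. iexp (sqrt t * g 0 * \<rho> n) * iexp (\<Sum>k<K. (sqrt t * g k) * Y n k s) \<partial>p n)"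
      proof (rule Bochner_Integration.integral_cong[OF refl])
        fix s
        have "(\<Prod>k<K. iexp (sqrt t * B n k s * g k)) = iexp (\<Sum>k<K. sqrt t * B n k s * g k)"
          by (simp add: exp_sum sum_distrib_left)
        also have "(\<Sum>k<K. sqrt t * B n k s * g k) = sqrt t * g 0 * \<rho> n + (\<Sum>k<K. (sqrt t * g k) * Y n k s)"
          unfolding sum0[of "\<lambda>k. sqrt t * g k", symmetric] sum.distrib[symmetric]
          by (intro sum.cong refl) (simp add: B_def algebra_simps)
        finally show "(\<Prod>k<K. iexp (sqrt t * B n k s * g k)) = iexp (sqrt t * g 0 * \<rho> n) * iexp (\<Sum>k<K. (sqrt t * g k) * Y n k s)"
          by (simp add: exp_add[symmetric] algebra_simps)
      qed
      also have "\<dots> = \<Phi> n g" unfolding \<Phi>_def by simp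
      finally show "(\<Sum>s\<in>set_pmf (p n). pmf (p n) s *\<^sub>R (\<Prod>k<K. iexp (sqrt t * B n k s * g k))) = \<Phi> n g" .
    qed
    finally show ?thesis .
  qed
  define \<Psi> where "\<Psi> = (\<lambda>g. \<Prod>k<K. iexp (sqrt t * g k * mm k) * of_real (exp (- (t * (g k)\<^sup>2) / 2)))"
  have c1: "cmod (\<integral>s. iexp (f s) \<partial>p n) \<le> 1" for f :: "'a \<Rightarrow> real" and n
  proof -
    have "cmod (\<integral>s. iexp (f s) \<partial>p n) \<le> (\<integral>s. cmod (iexp (f s)) \<partial>p n)" by (rule integral_norm_bound)
    then show ?thesis by simp
  qed
  have "(\<lambda>n. \<integral>g. \<Phi> n g \<partial>?N) \<longlonglongrightarrow> (\<integral>g. \<Psi> g \<partial>?N)"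
  proof (rule integral_dominated_convergence[where w = "\<lambda>_. 1"])
    have comp: "(\<lambda>g. g k) \<in> borel_measurable ?N" if "k < K" for k
    proof -
      have "(\<lambda>g. g k) \<in> measurable ?N std_normal" by (rule measurable_component_singleton) (use that in simp)
      moreover have "measurable ?N std_normal = measurable ?N borel" by (rule measurable_cong_sets) simp_all
      ultimately show ?thesis by simp
    qed
    have [measurable]: "(\<lambda>g. g 0) \<in> borel_measurable ?N" using K by (intro comp) simp
    show "\<Psi> \<in> borel_measurable ?N"
      unfolding \<Psi>_def
    proof (rule borel_measurable_prod)
      fix k assume "k \<in> {..<K}"
      then have [measurable]: "(\<lambda>g. g k) \<in> borel_measurable ?N" by (intro comp) simp
      show "(\<lambda>g. iexp (sqrt t * g k * mm k) * of_real (exp (- (t * (g k)\<^sup>2) / 2))) \<in> borel_measurable ?N"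
        by measurable
    qed
    show "\<Phi> n \<in> borel_measurable ?N" for n
    proof -
      have eq: "(\<integral>s. f s \<partial>p n) = (\<Sum>s\<in>set_pmf (p n). pmf (p n) s *\<^sub>R f s)" for f :: "'a \<Rightarrow> complex"
        by (rule integral_measure_pmf[OF fin])
      have [measurable]: "(\<lambda>g. \<Sum>k<K. (sqrt t * g k) * Y n k s) \<in> borel_measurable ?N" for s
        by (intro borel_measurable_sum borel_measurable_times comp borel_measurable_const) auto
      show ?thesis unfolding \<Phi>_def eq by measurable
    qed
    show "integrable ?N (\<lambda>_. 1 :: real)" by simp
    show "AE g in ?N. cmod (\<Phi> n g) \<le> 1" for n
    proof (rule AE_I2)
      fix g :: "nat \<Rightarrow> real"
      have "cmod (iexp (sqrt t * g 0 * \<rho> n)) \<le> 1" by simp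
      from mult_mono[OF this c1[of n "\<lambda>s. \<Sum>k<K. (sqrt t * g k) * Y n k s"]]
      show "cmod (\<Phi> n g) \<le> 1" unfolding \<Phi>_def norm_mult by (simp only: mult_1_left norm_ge_zero zero_le_one)
    qed
    show "AE g in ?N. (\<lambda>n. \<Phi> n g) \<longlonglongrightarrow> \<Psi> g"
    proof (rule AE_I2)
      fix g :: "nat \<Rightarrow> real"
      have "(\<lambda>n. \<Phi> n g) \<longlonglongrightarrow> iexp (sqrt t * g 0 * sqrt mu) * of_real (exp (- (\<Sum>k<K. (sqrt t * g k)\<^sup>2) / 2))"
        unfolding \<Phi>_def by (intro tendsto_mult clt tendsto_intros rho)
      also have "iexp (sqrt t * g 0 * sqrt mu) * of_real (exp (- (\<Sum>k<K. (sqrt t * g k)\<^sup>2) / 2)) = \<Psi> g"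
      proof -
        have "iexp (sqrt t * g 0 * sqrt mu) = iexp (\<Sum>k<K. sqrt t * g k * mm k)"
          unfolding mm_def sum0[of "\<lambda>k. sqrt t * g k"] ..
        also have "\<dots> = (\<Prod>k<K. iexp (sqrt t * g k * mm k))" by (simp add: exp_sum sum_distrib_left)
        finally have 1: "iexp (sqrt t * g 0 * sqrt mu) = (\<Prod>k<K. iexp (sqrt t * g k * mm k))" .
        have "exp (- (\<Sum>k<K. (sqrt t * g k)\<^sup>2) / 2) = (\<Prod>k<K. exp (- (t * (g k)\<^sup>2) / 2))"
          using t by (simp add: exp_sum[symmetric] power_mult_distrib sum_negf sum_divide_distrib)
        then show ?thesis unfolding 1 \<Psi>_def prod.distrib by simp
      qed
      finally show "(\<lambda>n. \<Phi> n g) \<longlonglongrightarrow> \<Psi> g" .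
    qed
  qed
  also have "(\<integral>g. \<Psi> g \<partial>?N) = of_real (\<integral>z. exp (- real j * (\<Sum>k<K. (z k + mm k)\<^sup>2)) \<partial>?N)"
  proof -
    have "(\<integral>g. \<Psi> g \<partial>?N) = (\<Prod>k<K. \<integral>g. iexp (sqrt t * g * mm k) * of_real (exp (- (t * g\<^sup>2) / 2)) \<partial>std_normal)"
      unfolding \<Psi>_def using t
      by (intro P.product_integral_prod N.integrable_const_bound[where B = 1] AE_I2) (auto simp: norm_mult)
    also have "\<dots> = of_real (\<Prod>k<K. \<integral>z. exp (- (t * (z + mm k)\<^sup>2) / 2) \<partial>std_normal)"
      unfolding std_normal_Laplace_square[OF t] by simp
    also have "(\<Prod>k<K. \<integral>z. exp (- (t * (z + mm k)\<^sup>2) / 2) \<partial>std_normal) = (\<integral>z. (\<Prod>k<K. exp (- (t * (z k + mm k)\<^sup>2) / 2)) \<partial>?N)"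
      using t by (intro P.product_integral_prod[symmetric] N.integrable_const_bound[where B = 1] AE_I2) auto
    finally show ?thesis unfolding exE .
  qed
  finally have limB: "(\<lambda>n. \<integral>s. exp (- real j * (\<Sum>k<K. (B n k s)\<^sup>2)) \<partial>p n) \<longlonglongrightarrow> (\<integral>z. exp (- real j * (\<Sum>k<K. (z k + mm k)\<^sup>2)) \<partial>?N)"
    unfolding Bint[symmetric] tendsto_of_real_iff .
  have diff: "(\<lambda>n. (\<integral>s. exp (- real j * (\<Sum>k<K. (A n k s)\<^sup>2)) \<partial>p n) - (\<integral>s. exp (- real j * (\<Sum>k<K. (B n k s)\<^sup>2)) \<partial>p n)) \<longlonglongrightarrow> 0"
  proof (rule LIMSEQ_I)
    fix e :: real assume e: "0 < e"
    \<comment> \<open>On the good event K coordinates contribute \<open>2 * j * e'\<close> each, at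
      most \<open>e / 2\<close> in total; the summand 1 in the denominator covers
      \<open>j = 0\<close>.\<close>
    define e' where "e' = e / (2 * (2 * real j * K + 1))"
    have e': "0 < e'" using e by (simp add: e'_def add_nonneg_pos)
    have e'2: "2 * real j * K * e' \<le> e / 2"
    proof -
      have "2 * real j * K * e' \<le> (2 * real j * K + 1) * e'" using e' by (simp add: distrib_right)
      also have "\<dots> = e / 2" unfolding e'_def by (simp add: field_simps add_nonneg_eq_0_iff)
      finally show ?thesis .
    qed
    define bad where "bad = (\<lambda>n. {s. \<exists>k<K. e' < \<bar>A n k s - B n k s\<bar>})"
    have "(\<lambda>n. measure_pmf.prob (p n) (bad n)) \<longlonglongrightarrow> 0" using approx[OF e'] by (simp add: bad_def B_def)
    from LIMSEQ_D[OF this, of "e / 2"] e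
    obtain n0 where n0: "\<And>n. n \<ge> n0 \<Longrightarrow> measure_pmf.prob (p n) (bad n) < e / 2" by auto
    have le: "\<bar>exp (- real j * (\<Sum>k<K. (A n k s)\<^sup>2)) - exp (- real j * (\<Sum>k<K. (B n k s)\<^sup>2))\<bar> \<le> 2 * real j * K * e' + indicator (bad n) s" for n s
    proof (cases "s \<in> bad n")
      case True
      have b01: "0 \<le> exp (- real j * (\<Sum>k<K. (X k)\<^sup>2))" "exp (- real j * (\<Sum>k<K. (X k)\<^sup>2)) \<le> 1" for X :: "nat \<Rightarrow> real"
        by (auto intro!: mult_nonneg_nonneg sum_nonneg)
      then have "\<bar>exp (- real j * (\<Sum>k<K. (A n k s)\<^sup>2)) - exp (- real j * (\<Sum>k<K. (B n k s)\<^sup>2))\<bar> \<le> 1"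
        using b01[of "\<lambda>k. A n k s"] b01[of "\<lambda>k. B n k s"] by linarith
      moreover have "0 \<le> 2 * real j * K * e'" using e' by simp
      moreover have "indicator (bad n) s = (1 :: real)" using True by simp
      ultimately show ?thesis by linarith
    next
      case False
      have b: "\<bar>A n k s - B n k s\<bar> \<le> e'" if "k < K" for k using False that unfolding bad_def by force
      have "norm ((\<Prod>k<K. exp (- (t * (A n k s)\<^sup>2) / 2)) - (\<Prod>k<K. exp (- (t * (B n k s)\<^sup>2) / 2)))
        \<le> (\<Sum>k<K. norm (exp (- (t * (A n k s)\<^sup>2) / 2) - exp (- (t * (B n k s)\<^sup>2) / 2)))"
        using t by (intro norm_prod_diff) auto
      also have "\<dots> \<le> (\<Sum>k<K. 2 * real j * e')"
      proof (rule sum_mono)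
        fix k assume k: "k \<in> {..<K}"
        have "norm (exp (- (t * (A n k s)\<^sup>2) / 2) - exp (- (t * (B n k s)\<^sup>2) / 2)) \<le> 2 * real j * \<bar>A n k s - B n k s\<bar>"
          using exp_neg_sq_Lipschitz[of j "A n k s" "B n k s"] by (simp add: t_def)
        also have "\<dots> \<le> 2 * real j * e'" using b[of k] k by (intro mult_left_mono) auto
        finally show "norm (exp (- (t * (A n k s)\<^sup>2) / 2) - exp (- (t * (B n k s)\<^sup>2) / 2)) \<le> 2 * real j * e'" .
      qed
      finally show ?thesis unfolding exE using False by (simp add: mult_ac)
    qed
    show "\<exists>n0. \<forall>n\<ge>n0. norm ((\<integral>s. exp (- real j * (\<Sum>k<K. (A n k s)\<^sup>2)) \<partial>p n) - (\<integral>s. exp (- real j * (\<Sum>k<K. (B n k s)\<^sup>2)) \<partial>p n) - 0) < e"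
    proof (intro exI[of _ n0] allI impI)
      fix n assume n: "n0 \<le> n"
      have "norm ((\<integral>s. exp (- real j * (\<Sum>k<K. (A n k s)\<^sup>2)) \<partial>p n) - (\<integral>s. exp (- real j * (\<Sum>k<K. (B n k s)\<^sup>2)) \<partial>p n) - 0)
        = \<bar>\<integral>s. exp (- real j * (\<Sum>k<K. (A n k s)\<^sup>2)) - exp (- real j * (\<Sum>k<K. (B n k s)\<^sup>2)) \<partial>p n\<bar>"
        using int by (subst Bochner_Integration.integral_diff) auto
      also have "\<dots> \<le> (\<integral>s. \<bar>exp (- real j * (\<Sum>k<K. (A n k s)\<^sup>2)) - exp (- real j * (\<Sum>k<K. (B n k s)\<^sup>2))\<bar> \<partial>p n)"
        by (rule integral_abs_bound)
      also have "\<dots> \<le> (\<integral>s. 2 * real j * K * e' + indicator (bad n) s \<partial>p n)"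
        by (intro integral_mono int le)
      also have "\<dots> = 2 * real j * K * e' + measure_pmf.prob (p n) (bad n)"
        using int by (subst Bochner_Integration.integral_add) auto
      also have "\<dots> < e" using e'2 n0[OF n] by simp
      finally show "norm ((\<integral>s. exp (- real j * (\<Sum>k<K. (A n k s)\<^sup>2)) \<partial>p n) - (\<integral>s. exp (- real j * (\<Sum>k<K. (B n k s)\<^sup>2)) \<partial>p n) - 0) < e" .
    qed
  qed
  show "(\<lambda>n. \<integral>s. exp (- real j * (\<Sum>k<K. (A n k s)\<^sup>2)) \<partial>p n) \<longlonglongrightarrow>
      (\<integral>z. exp (- real j * (\<Sum>k<K. (z k + (if k = 0 then sqrt mu else 0))\<^sup>2)) \<partial>?N)"
    using tendsto_add[OF diff limB] by (simp add: mm_def)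
qed (auto intro!: sum_nonneg always_eventually)

section \<open>Row differences of the noise as sums over edges\<close>

text \<open>Coefficient of the edge \<open>e\<close> in the sum of \<open>W r l * c l\<close> over
  \<open>l\<close>: an edge at \<open>r\<close> receives the weight of its other end. On the loop at
  \<open>r\<close> the first case applies, so the loop is counted once.\<close>

definition row_coef :: "nat \<Rightarrow> (nat \<Rightarrow> real) \<Rightarrow> nat \<times> nat \<Rightarrow> real" where
  "row_coef r c e = (if fst e = r then c (snd e) else if snd e = r then c (fst e) else 0)"

definition edge_free :: "bool \<Rightarrow> nat \<times> nat \<Rightarrow> real" where
  "edge_free loops e = (if \<not> loops \<and> fst e = snd e then 0 else 1)"

definition diff_coef :: "bool \<Rightarrow> nat \<Rightarrow> nat \<Rightarrow> (nat \<Rightarrow> real) \<Rightarrow> nat \<times> nat \<Rightarrow> real" where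
  "diff_coef loops i j c e = edge_free loops e * (row_coef i c e - row_coef j c e)"

definition centred :: "(nat \<Rightarrow> nat \<Rightarrow> real) \<Rightarrow> sample \<Rightarrow> nat \<times> nat \<Rightarrow> real" where
  "centred H s e = of_bool (s e) - H (fst e) (snd e)"

definition edge_var :: "(nat \<Rightarrow> nat \<Rightarrow> real) \<Rightarrow> nat \<times> nat \<Rightarrow> real" where
  "edge_var H e = H (fst e) (snd e) * (1 - H (fst e) (snd e))"

text \<open>The edges at \<open>r\<close> are parametrised by their other end, \<open>l = r\<close>
  giving the loop.\<close>

lemma sum_edges_at:
  fixes g :: "nat \<times> nat \<Rightarrow> real"
  assumes r: "r < n" and g: "\<And>e. fst e \<noteq> r \<Longrightarrow> snd e \<noteq> r \<Longrightarrow> g e = 0"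
  shows "(\<Sum>e\<in>edges n. g e) = (\<Sum>l<n. g (min r l, max r l))"
proof -
  let ?m = "\<lambda>l. (min r l, max r l)"
  have inj: "inj_on ?m {..<n}" by (auto simp: inj_on_def min_def max_def split: if_splits)
  have "(\<Sum>e\<in>edges n. g e) = (\<Sum>e\<in>?m ` {..<n}. g e)"
  proof (rule sum.mono_neutral_right)
    show "?m ` {..<n} \<subseteq> edges n" using r by (auto simp: edges_def)
    show "\<forall>e\<in>edges n - ?m ` {..<n}. g e = 0"
    proof
      fix e assume e: "e \<in> edges n - ?m ` {..<n}"
      obtain a b where ab: "e = (a, b)" by (cases e)
      have le: "a \<le> b" "b < n" using e by (auto simp: ab edges_def)
      have "a \<noteq> r" 
      proof
        assume "a = r"
        then have "e = ?m b" using le by (simp add: ab)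
        then show False using e le by auto
      qed
      moreover have "b \<noteq> r"
      proof
        assume "b = r"
        then have "e = ?m a" using le by (simp add: ab)
        then show False using e le by auto
      qed
      ultimately show "g e = 0" using g[of e] by (simp add: ab)
    qed
  qed simp
  also have "\<dots> = (\<Sum>l<n. g (?m l))" using inj by (simp add: sum.reindex)
  finally show ?thesis .
qed

lemma row_coef_at [simp]: "row_coef r c (min r l, max r l) = c l"
  by (auto simp: row_coef_def min_def max_def)

lemma row_coef_eq_0: "fst e \<noteq> r \<Longrightarrow> snd e \<noteq> r \<Longrightarrow> row_coef r c e = 0"
  by (simp add: row_coef_def)

lemma row_coef_linear: "row_coef r (\<lambda>l. \<Sum>a\<in>F. x a * c a l) e = (\<Sum>a\<in>F. x a * row_coef r (c a) e)"
  by (auto simp: row_coef_def)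

lemma diff_coef_linear: "diff_coef loops i j (\<lambda>l. \<Sum>a\<in>F. x a * c a l) e = (\<Sum>a\<in>F. x a * diff_coef loops i j (c a) e)"
  unfolding diff_coef_def row_coef_linear by (simp add: sum_subtractf[symmetric] sum_distrib_left algebra_simps)

text \<open>Rows i and j share the entry at {i, j}, so independence is visible only after regrouping
  by edges. If loops are removed, the two diagonal entries are constants and give the deterministic
  correction.\<close>

lemma row_difference_eq_edge_sum:
  assumes sym: "\<And>l m. l < n \<Longrightarrow> m < n \<Longrightarrow> H l m = H m l" and ij: "i < n" "j < n"
  shows "(\<Sum>l<n. (Wmat loops H s i l - Wmat loops H s j l) * c l) =
    (\<Sum>e\<in>edges n. diff_coef loops i j c e * centred H s e) - of_bool (\<not> loops) * (H i i * c i - H j j * c j)"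
proof -
  have row: "(\<Sum>l<n. Wmat loops H s r l * c l) =
     (\<Sum>e\<in>edges n. edge_free loops e * row_coef r c e * centred H s e) - of_bool (\<not> loops) * (H r r * c r)" if r: "r < n" for r
  proof -
    have "(\<Sum>l<n. Wmat loops H s r l * c l) = (\<Sum>l<n. row_coef r c (min r l, max r l) * ew loops H (min r l, max r l) (s (min r l, max r l)))"
      by (intro sum.cong refl) (simp add: Wmat_eq_ew[where n = n, OF sym] r)
    also have "\<dots> = (\<Sum>e\<in>edges n. row_coef r c e * ew loops H e (s e))"
      by (rule sum_edges_at[OF r, symmetric]) (simp add: row_coef_eq_0)
    also have "\<dots> = (\<Sum>e\<in>edges n. edge_free loops e * row_coef r c e * centred H s e) - (\<Sum>e\<in>edges n. (1 - edge_free loops e) * row_coef r c e * H (fst e) (snd e))"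
      unfolding sum_subtractf[symmetric] by (intro sum.cong refl) (simp add: ew_def edge_free_def centred_def algebra_simps)
    also have "(\<Sum>e\<in>edges n. (1 - edge_free loops e) * row_coef r c e * H (fst e) (snd e)) =
       (\<Sum>l<n. (1 - edge_free loops (min r l, max r l)) * c l * H (min r l) (max r l))"
      by (subst sum_edges_at[OF r]) (auto simp: row_coef_eq_0)
    also have "\<dots> = (\<Sum>l<n. if l = r then of_bool (\<not> loops) * (H r r * c r) else 0)"
      by (intro sum.cong refl) (auto simp: edge_free_def min_def max_def)
    also have "\<dots> = of_bool (\<not> loops) * (H r r * c r)" using r by (simp add: sum.delta)
    finally show ?thesis .
  qed
  have "(\<Sum>l<n. (Wmat loops H s i l - Wmat loops H s j l) * c l) = (\<Sum>l<n. Wmat loops H s i l * c l) - (\<Sum>l<n. Wmat loops H s j l * c l)"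
    by (simp add: left_diff_distrib sum_subtractf)
  also have "\<dots> = (\<Sum>e\<in>edges n. edge_free loops e * row_coef i c e * centred H s e) - (\<Sum>e\<in>edges n. edge_free loops e * row_coef j c e * centred H s e)
     - of_bool (\<not> loops) * (H i i * c i - H j j * c j)"
    unfolding row[OF ij(1)] row[OF ij(2)] by (simp add: right_diff_distrib)
  also have "(\<Sum>e\<in>edges n. edge_free loops e * row_coef i c e * centred H s e) - (\<Sum>e\<in>edges n. edge_free loops e * row_coef j c e * centred H s e)
      = (\<Sum>e\<in>edges n. diff_coef loops i j c e * centred H s e)"
    unfolding sum_subtractf[symmetric] by (intro sum.cong refl) (simp add: diff_coef_def algebra_simps)
  finally show ?thesis .
qed

lemma expectation_centred_mult:
  assumes H: "\<And>e. e \<in> edges n \<Longrightarrow> 0 \<le> H (fst e) (snd e) \<and> H (fst e) (snd e) \<le> 1"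
    and e: "e \<in> edges n" "e' \<in> edges n"
  shows "measure_pmf.expectation (edge_pmf n H) (\<lambda>s. centred H s e * centred H s e') = of_bool (e = e') * edge_var H e"
proof -
  let ?x = "\<lambda>e b. of_bool b - H (fst e) (snd e) :: real"
  let ?B = "\<lambda>e. bernoulli_pmf (H (fst e) (snd e))"
  define f where "f = (\<lambda>k b. (if k = e then ?x e b else 1) * (if k = e' then ?x e' b else 1))"
  have "(\<Prod>k\<in>edges n. f k (s k)) = centred H s e * centred H s e'" for s
    using e by (simp add: f_def prod.distrib prod.delta centred_def)
  then have E: "measure_pmf.expectation (edge_pmf n H) (\<lambda>s. centred H s e * centred H s e') = (\<Prod>k\<in>edges n. measure_pmf.expectation (?B k) (f k))"
    using expectation_prod_edges[of n H f] by simp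
  show ?thesis
  proof (cases "e = e'")
    case True
    have "(\<Prod>k\<in>edges n. measure_pmf.expectation (?B k) (f k)) = (\<Prod>k\<in>edges n. if k = e then edge_var H e else 1)"
      using H[OF e(1)] True by (intro prod.cong refl) (auto simp: f_def edge_var_def algebra_simps)
    then show ?thesis using E True e by (simp add: prod.delta)
  next
    case False
    have "measure_pmf.expectation (?B e) (f e) = 0"
      using H[OF e(1)] False by (simp add: f_def algebra_simps)
    then have "(\<Prod>k\<in>edges n. measure_pmf.expectation (?B k) (f k)) = 0" using e by (intro prod_zero) auto
    then show ?thesis using E False by simp
  qed
qed

lemma expectation_centred:
  assumes H: "\<And>e. e \<in> edges n \<Longrightarrow> 0 \<le> H (fst e) (snd e) \<and> H (fst e) (snd e) \<le> 1" and e: "e \<in> edges n"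
  shows "measure_pmf.expectation (edge_pmf n H) (\<lambda>s. centred H s e) = 0"
proof -
  let ?B = "\<lambda>e. bernoulli_pmf (H (fst e) (snd e))"
  define f where "f = (\<lambda>k b. if k = e then of_bool b - H (fst e) (snd e) else 1 :: real)"
  have "(\<Prod>k\<in>edges n. f k (s k)) = centred H s e" for s
    using e by (simp add: f_def prod.delta centred_def)
  then have "measure_pmf.expectation (edge_pmf n H) (\<lambda>s. centred H s e) = (\<Prod>k\<in>edges n. measure_pmf.expectation (?B k) (f k))"
    using expectation_prod_edges[of n H f] by simp
  also have "\<dots> = 0" using e H[OF e] by (intro prod_zero bexI[of _ e]) (auto simp: f_def algebra_simps)
  finally show ?thesis .
qed

lemma cov_edge_sums:
  assumes H: "\<And>e. e \<in> edges n \<Longrightarrow> 0 \<le> H (fst e) (snd e) \<and> H (fst e) (snd e) \<le> 1"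
  shows "cov_pmf (edge_pmf n H) (\<lambda>s. (\<Sum>e\<in>edges n. f e * centred H s e) - x) (\<lambda>s. (\<Sum>e\<in>edges n. g e * centred H s e) - y)
    = (\<Sum>e\<in>edges n. f e * g e * edge_var H e)"
proof -
  let ?E = "measure_pmf.expectation (edge_pmf n H)"
  have mean: "?E (\<lambda>s. (\<Sum>e\<in>edges n. f e * centred H s e) - x) = - x" for f x
    by (simp add: Bochner_Integration.integral_sum expectation_centred[where n = n and H = H, OF H])
  have "cov_pmf (edge_pmf n H) (\<lambda>s. (\<Sum>e\<in>edges n. f e * centred H s e) - x) (\<lambda>s. (\<Sum>e\<in>edges n. g e * centred H s e) - y)
    = ?E (\<lambda>s. \<Sum>e\<in>edges n. \<Sum>e'\<in>edges n. f e * g e' * (centred H s e * centred H s e'))"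
    unfolding cov_pmf_def mean by (simp add: sum_product mult_ac)
  also have "\<dots> = (\<Sum>e\<in>edges n. \<Sum>e'\<in>edges n. f e * g e' * (of_bool (e = e') * edge_var H e))"
    by (simp add: Bochner_Integration.integral_sum expectation_centred_mult[where n = n and H = H, OF H])
  also have "\<dots> = (\<Sum>e\<in>edges n. \<Sum>e'\<in>edges n. if e' = e then f e * g e * edge_var H e else 0)"
    by (intro sum.cong refl) auto
  also have "\<dots> = (\<Sum>e\<in>edges n. f e * g e * edge_var H e)" by (simp add: sum.delta)
  finally show ?thesis .
qed

section \<open>Covariance, coefficients and bias of the noise row difference\<close>

locale mm_pair = mm_model +
  fixes i j :: nat and loops :: bool
  assumes ij: "i < n" "j < n" and H_le_1: "\<And>l m. l < n \<Longrightarrow> m < n \<Longrightarrow> H l m \<le> 1"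
begin

abbreviation "S \<equiv> Sigma1 loops n H V d i j"

definition xi :: "sample \<Rightarrow> nat \<Rightarrow> real" where
  "xi s a = (\<Sum>l<n. (Wmat loops H s i l - Wmat loops H s j l) * V l a / d a)"

definition alpha :: "nat \<Rightarrow> nat \<times> nat \<Rightarrow> real" where
  "alpha a = diff_coef loops i j (\<lambda>l. V l a / d a)"

text \<open>Minus the mean of \<open>xi s a\<close>: the bias left by a removed diagonal.\<close>

definition kappa :: "nat \<Rightarrow> real" where
  "kappa a = of_bool (\<not> loops) * (H i i * (V i a / d a) - H j j * (V j a / d a))"

lemma edge_H: "e \<in> edges n \<Longrightarrow> 0 \<le> H (fst e) (snd e) \<and> H (fst e) (snd e) \<le> 1"
  using H_bounds H_le_1 by (auto simp: edges_def)

lemma edge_var_bounds: assumes "e \<in> edges n" shows "0 \<le> edge_var H e" "edge_var H e \<le> theta"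
proof -
  have h: "0 \<le> H (fst e) (snd e)" "H (fst e) (snd e) \<le> 1" using edge_H[OF assms] by auto
  show "0 \<le> edge_var H e" using h by (simp add: edge_var_def)
  have "edge_var H e \<le> H (fst e) (snd e) * 1" unfolding edge_var_def using h by (intro mult_left_mono) auto
  also have "\<dots> \<le> theta" using assms H_bounds(2) by (auto simp: edges_def)
  finally show "edge_var H e \<le> theta" .
qed

lemma xi_eq: "xi s a = (\<Sum>e\<in>edges n. alpha a e * centred H s e) - kappa a"
  using row_difference_eq_edge_sum[of n H i j loops s "\<lambda>l. V l a / d a", OF H_sym ij]
  by (simp add: xi_def alpha_def kappa_def)

lemma xi_eq_mv: "xi s a = (mv n (Wmat loops H s) (v a) i - mv n (Wmat loops H s) (v a) j) / d a"
  by (simp add: xi_def mv_def left_diff_distrib diff_divide_distrib sum_subtractf sum_divide_distrib)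

lemma S_eq: "S a b = (\<Sum>e\<in>edges n. alpha a e * alpha b e * edge_var H e)"
  unfolding Sigma1_def xi_def[symmetric] xi_eq by (rule cov_edge_sums[where n = n and H = H, OF edge_H])

lemma S_sym: "S a b = S b a"
  by (simp add: S_eq mult_ac)

lemma bil_S: "bil K S x y = (\<Sum>e\<in>edges n. (\<Sum>a<K. x a * alpha a e) * (\<Sum>a<K. y a * alpha a e) * edge_var H e)"
proof -
  have "bil K S x y = (\<Sum>a<K. \<Sum>b<K. \<Sum>e\<in>edges n. (x a * alpha a e) * (y b * alpha b e) * edge_var H e)"
    by (simp add: bil_def S_eq sum_distrib_left sum_distrib_right mult_ac)
  also have "\<dots> = (\<Sum>a<K. \<Sum>e\<in>edges n. \<Sum>b<K. (x a * alpha a e) * (y b * alpha b e) * edge_var H e)"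
    by (rule sum.cong[OF refl]) (rule sum.swap)
  also have "\<dots> = (\<Sum>e\<in>edges n. \<Sum>a<K. \<Sum>b<K. (x a * alpha a e) * (y b * alpha b e) * edge_var H e)"
    by (rule sum.swap)
  also have "\<dots> = (\<Sum>e\<in>edges n. (\<Sum>a<K. x a * alpha a e) * (\<Sum>a<K. y a * alpha a e) * edge_var H e)"
    by (intro sum.cong refl, simp only: sum_product, simp only: sum_distrib_right)
  finally show ?thesis .
qed

lemma S_psd: "0 \<le> qform K S x"
  unfolding qform_eq_bil bil_S using edge_var_bounds by (intro sum_nonneg) auto

text \<open>The vector V D^-1 x, whose weights give the linear combination of the noise coordinates
  with coefficients \<open>x\<close>.\<close>

definition cvec :: "(nat \<Rightarrow> real) \<Rightarrow> nat \<Rightarrow> real" where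
  "cvec x l = (\<Sum>a<K. x a * (V l a / d a))"

lemma sum_alpha: "(\<Sum>a<K. x a * alpha a e) = diff_coef loops i j (cvec x) e"
  unfolding alpha_def cvec_def[abs_def] diff_coef_linear ..

text \<open>Each edge variance is at most \<open>theta\<close>, and V D^-1 x has squared norm at
  most that of \<open>x\<close> over \<open>(c0\<^sup>2 * n * theta)\<^sup>2\<close>. The 4 comes
  from two rows and from \<open>(a - b)\<^sup>2 \<le> 2 * a\<^sup>2 + 2 * b\<^sup>2\<close>.\<close>

lemma S_upper: "qform K S x \<le> 4 / (c0 ^ 4 * (real n)\<^sup>2 * theta) * ip K x x"
proof -
  have row: "(\<Sum>e\<in>edges n. (row_coef r (cvec x) e)\<^sup>2) = ip n (cvec x) (cvec x)" if "r < n" for r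
    by (subst sum_edges_at[OF that]) (auto simp: row_coef_eq_0 ip_def power2_eq_square)
  have "ip n (cvec x) (cvec x) = ip n (\<lambda>l. \<Sum>a<K. (x a / d a) * v a l) (\<lambda>l. \<Sum>a<K. (x a / d a) * v a l)"
    by (rule ip_cong) (auto simp: cvec_def)
  also have "\<dots> = (\<Sum>a<K. (x a / d a) * (x a / d a))" by (rule ip_sum_orthonormal) (auto simp: orthV)
  also have "\<dots> \<le> (\<Sum>a<K. x a * x a / (c0\<^sup>2 * (real n * theta))\<^sup>2)"
  proof (rule sum_mono)
    fix a assume "a \<in> {..<K}"
    then have a: "a < K" by simp
    have p: "0 < c0\<^sup>2 * (real n * theta)" using c0 nt_pos by simp
    have "(c0\<^sup>2 * (real n * theta))\<^sup>2 \<le> (d a)\<^sup>2" using d_lower[OF a] p by (intro power_mono) auto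
    then have "x a * x a / (d a)\<^sup>2 \<le> x a * x a / (c0\<^sup>2 * (real n * theta))\<^sup>2"
      using p d_pos[OF a] c0 n0 theta_pos by (intro divide_left_mono mult_pos_pos zero_less_power) auto
    then show "(x a / d a) * (x a / d a) \<le> x a * x a / (c0\<^sup>2 * (real n * theta))\<^sup>2" by (simp add: power2_eq_square)
  qed
  also have "\<dots> = ip K x x / (c0 ^ 4 * (real n)\<^sup>2 * theta\<^sup>2)"
    by (simp add: ip_def sum_divide_distrib power_mult_distrib mult.assoc)
  finally have cc: "ip n (cvec x) (cvec x) \<le> ip K x x / (c0 ^ 4 * (real n)\<^sup>2 * theta\<^sup>2)" .
  have "qform K S x = (\<Sum>e\<in>edges n. (diff_coef loops i j (cvec x) e)\<^sup>2 * edge_var H e)"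
    by (simp add: qform_eq_bil bil_S sum_alpha power2_eq_square)
  also have "\<dots> \<le> (\<Sum>e\<in>edges n. (2 * (row_coef i (cvec x) e)\<^sup>2 + 2 * (row_coef j (cvec x) e)\<^sup>2) * theta)"
  proof (intro sum_mono mult_mono edge_var_bounds)
    fix e
    let ?a = "row_coef i (cvec x) e" and ?b = "row_coef j (cvec x) e"
    have "(diff_coef loops i j (cvec x) e)\<^sup>2 \<le> (?a - ?b)\<^sup>2" by (simp add: diff_coef_def edge_free_def)
    also have "\<dots> \<le> 2 * ?a\<^sup>2 + 2 * ?b\<^sup>2"
      using zero_le_power2[of "?a + ?b"] by (simp add: power2_eq_square algebra_simps)
    finally show "(diff_coef loops i j (cvec x) e)\<^sup>2 \<le> 2 * ?a\<^sup>2 + 2 * ?b\<^sup>2" .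
  qed auto
  also have "\<dots> = 4 * theta * ip n (cvec x) (cvec x)"
    by (simp add: sum_distrib_right[symmetric] sum.distrib sum_distrib_left[symmetric] row ij)
  also have "\<dots> \<le> 4 * theta * (ip K x x / (c0 ^ 4 * (real n)\<^sup>2 * theta\<^sup>2))"
    using cc theta_pos by (intro mult_left_mono) auto
  also have "\<dots> = 4 / (c0 ^ 4 * (real n)\<^sup>2 * theta) * ip K x x"
    using theta_pos by (simp add: power2_eq_square)
  finally show ?thesis .
qed

lemma abs_V_div_d_le: assumes "l < n" "a < K" shows "\<bar>V l a / d a\<bar> \<le> 1 / (c0 ^ 4 * sqrt (real n) * (real n * theta))"
proof -
  have p: "0 < c0\<^sup>2 * (real n * theta)" using c0 nt_pos by simp
  have "\<bar>V l a\<bar> / d a \<le> (1 / (c0\<^sup>2 * sqrt (real n))) / (c0\<^sup>2 * (real n * theta))"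
    using abs_V_le[OF assms] d_lower[OF assms(2)] p c0 by (intro frac_le) auto
  then show ?thesis using d_pos[OF assms(2)] by (simp add: abs_divide power2_eq_square power4_eq_xxxx mult_ac)
qed

text \<open>Delocalisation of \<open>V\<close> makes all edge coefficients of order n^(-3/2) /
  theta. With whitening vectors of size n * sqrt theta this becomes 1 / sqrt (n * theta), the
  smallness that the central limit theorem asks for.\<close>

lemma abs_sum_alpha_le:
  assumes "e \<in> edges n"
  shows "\<bar>\<Sum>a<K. x a * alpha a e\<bar> \<le> 2 * (\<Sum>a<K. \<bar>x a\<bar>) / (c0 ^ 4 * sqrt (real n) * (real n * theta))"
proof -
  let ?b = "(\<Sum>a<K. \<bar>x a\<bar>) / (c0 ^ 4 * sqrt (real n) * (real n * theta))"
  have b0: "0 \<le> ?b" using c0 nt_pos theta_pos by (intro divide_nonneg_nonneg sum_nonneg mult_nonneg_nonneg) auto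
  have c: "\<bar>cvec x l\<bar> \<le> ?b" if "l < n" for l
  proof -
    have "\<bar>cvec x l\<bar> \<le> (\<Sum>a<K. \<bar>x a * (V l a / d a)\<bar>)" unfolding cvec_def by (rule sum_abs)
    also have "\<dots> \<le> (\<Sum>a<K. \<bar>x a\<bar> * (1 / (c0 ^ 4 * sqrt (real n) * (real n * theta))))"
      unfolding abs_mult using that by (intro sum_mono mult_left_mono abs_V_div_d_le) auto
    finally show ?thesis by (simp add: sum_divide_distrib)
  qed
  have "\<bar>row_coef r (cvec x) e\<bar> \<le> ?b" for r
    using c[of "fst e"] c[of "snd e"] assms b0 by (auto simp: row_coef_def edges_def)
  from this[of i] this[of j]
  have "\<bar>row_coef i (cvec x) e - row_coef j (cvec x) e\<bar> \<le> 2 * ?b" by linarith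
  then show ?thesis unfolding sum_alpha using b0 by (auto simp: diff_coef_def edge_free_def)
qed

text \<open>The bias is below the noise scale by a factor of order sqrt n, because a diagonal entry
  of H is at most sqrt theta whether \<open>theta\<close> is below or above 1.\<close>

lemma kappa_le:
  assumes "a < K"
  shows "real n * sqrt theta * \<bar>kappa a\<bar> \<le> 2 / (c0 ^ 4 * sqrt (real n))"
proof -
  let ?b = "1 / (c0 ^ 4 * sqrt (real n) * (real n * theta))"
  have b0: "0 \<le> ?b" using c0 nt_pos theta_pos by (intro divide_nonneg_nonneg mult_nonneg_nonneg) auto
  have hh: "H r r \<le> sqrt theta" if "r < n" for r
  proof (cases "theta \<le> 1")
    case True
    have "theta * theta \<le> theta * 1" using True theta_pos by (intro mult_left_mono) auto
    then have "theta\<^sup>2 \<le> theta" by (simp add: power2_eq_square)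
    then have "theta \<le> sqrt theta" by (rule real_le_rsqrt)
    then show ?thesis using H_bounds(2)[OF that that] by linarith
  next
    case False
    then have "1 \<le> sqrt theta" by simp
    then show ?thesis using H_le_1[OF that that] by linarith
  qed
  have t: "\<bar>H r r * (V r a / d a)\<bar> \<le> sqrt theta * ?b" if "r < n" for r
    unfolding abs_mult using hh[OF that] H_bounds(1)[OF that that] abs_V_div_d_le[OF that assms] theta_pos
    by (intro mult_mono) auto
  have "\<bar>kappa a\<bar> \<le> \<bar>H i i * (V i a / d a)\<bar> + \<bar>H j j * (V j a / d a)\<bar>"
    unfolding kappa_def by (rule order_trans[OF _ abs_triangle_ineq4]) (auto simp: abs_mult)
  then have "\<bar>kappa a\<bar> \<le> 2 * (sqrt theta * ?b)" using t[OF ij(1)] t[OF ij(2)] by linarith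
  then have "real n * sqrt theta * \<bar>kappa a\<bar> \<le> real n * sqrt theta * (2 * (sqrt theta * ?b))"
    using theta_pos by (intro mult_left_mono) auto
  also have "\<dots> = (real n * (sqrt theta * sqrt theta)) * (2 * ?b)" by (simp only: mult_ac)
  also have "sqrt theta * sqrt theta = theta" using theta_pos by simp
  also have "(real n * theta) * (2 * ?b) = 2 / (c0 ^ 4 * sqrt (real n))" using theta_pos n0 by (simp add: field_simps)
  finally show ?thesis .
qed

end

section \<open>Asymptotics\<close>

lemma weak_conv_m_eventually_cong:
  assumes "weak_conv_m M N" "\<forall>\<^sub>F n in sequentially. M n = M' n"
  shows "weak_conv_m M' N"
  unfolding weak_conv_m_def weak_conv_def
proof (intro allI impI)
  fix x assume "isCont (cdf N) x"
  then have "(\<lambda>n. cdf (M n) x) \<longlonglongrightarrow> cdf N x"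
    using assms(1) by (simp add: weak_conv_m_def weak_conv_def)
  then show "(\<lambda>n. cdf (M' n) x) \<longlonglongrightarrow> cdf N x"
    by (rule Lim_transform_eventually) (use assms(2) in \<open>auto elim: eventually_mono\<close>)
qed

text \<open>The model along n: its properties hold eventually, with constants free of n.
  \<open>c0\<close> and \<open>c1\<close> are those of (C2); \<open>c\<close> bounds both the
  eigenvalues and their gaps from below in units of \<open>real n * theta n\<close>.\<close>

locale mm_sequence =
  fixes K :: nat and loops :: bool and i j :: nat and theta :: "nat \<Rightarrow> real"
    and Pim P V :: "nat \<Rightarrow> nat \<Rightarrow> nat \<Rightarrow> real" and d :: "nat \<Rightarrow> nat \<Rightarrow> real"
    and Vh :: "nat \<Rightarrow> sample \<Rightarrow> nat \<Rightarrow> nat \<Rightarrow> real" and dh :: "nat \<Rightarrow> sample \<Rightarrow> nat \<Rightarrow> real"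
    and Sinv :: "nat \<Rightarrow> nat \<Rightarrow> nat \<Rightarrow> real" and c0 c1 c :: real
  assumes K_pos: "1 \<le> K" and ij_ne: "i \<noteq> j"
    and model: "\<forall>\<^sub>F n in sequentially. mm_pair n K (theta n) (Pim n) (P n) (V n) (d n) c0 i j"
    and c0: "0 < c0" and c1: "c1 < 1" and theta_lower: "\<forall>\<^sub>F n in sequentially. real n powr (- c1) \<le> theta n"
    and c: "0 < c" "c \<le> 1"
    and low: "\<forall>\<^sub>F n in sequentially. \<forall>k<K. c * (real n * theta n) \<le> d n k"
    and gap: "\<forall>\<^sub>F n in sequentially. \<forall>a b. a < b \<longrightarrow> b < K \<longrightarrow> d n b + c * (real n * theta n) \<le> d n a"
    and X_decomp: "\<forall>\<^sub>F n in sequentially. \<forall>s.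
        ordered_eigdecomp n (Xobs loops s) (Vh n s) (dh n s) \<and>
        (\<forall>k<K. 0 \<le> (\<Sum>l<n. Vh n s k l * V n l k))"
    and Sinv_inv: "\<forall>\<^sub>F n in sequentially. \<forall>a<K. \<forall>b<K.
        (\<Sum>m<K. Sigma1 loops n (Hmat K (theta n) (Pim n) (P n)) (V n) (d n) i j a m * Sinv n m b)
          = (if a = b then 1 else 0)"
begin

abbreviation "Hn n \<equiv> Hmat K (theta n) (Pim n) (P n)"
abbreviation "Sn n \<equiv> Sigma1 loops n (Hn n) (V n) (d n) i j"
abbreviation "prb n \<equiv> measure_pmf.prob (edge_pmf n (Hn n))"

definition scal :: "nat \<Rightarrow> real" where "scal n = real n * sqrt (theta n)"
definition DV :: "nat \<Rightarrow> nat \<Rightarrow> real" where "DV n a = V n i a - V n j a"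
definition DVh :: "nat \<Rightarrow> sample \<Rightarrow> nat \<Rightarrow> real" where "DVh n s a = Vh n s a i - Vh n s a j"
definition Xi :: "nat \<Rightarrow> sample \<Rightarrow> nat \<Rightarrow> real" where
  "Xi n s a = (\<Sum>l<n. (Wmat loops (Hn n) s i l - Wmat loops (Hn n) s j l) * V n l a / d n a)"
definition zeta :: "nat \<Rightarrow> real" where "zeta n = scal n * (\<Sum>a<K. \<bar>DV n a\<bar>)"

text \<open>The tolerance is relative to \<open>1 + zeta n\<close>, where \<open>zeta\<close> is the
  signal in units of the noise scale. The same event therefore serves bounded signals, in the limit
  laws, and diverging ones, in the power statement.\<close>

definition deviates :: "real \<Rightarrow> real \<Rightarrow> nat \<Rightarrow> sample set" where
  "deviates e M n = {s. \<not> (\<forall>k<K. scal n * \<bar>DVh n s k - DV n k - Xi n s k\<bar> \<le> e * (1 + zeta n) \<and>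
     scal n * \<bar>Xi n s k\<bar> \<le> M)}"

lemma zeta_nonneg: "\<forall>\<^sub>F n in sequentially. 0 \<le> scal n \<and> 0 \<le> zeta n"
  using model
proof eventually_elim
  case (elim n)
  interpret mm_pair n K "theta n" "Pim n" "P n" "V n" "d n" c0 i j loops by (rule elim)
  show ?case using theta_pos by (auto simp: zeta_def scal_def intro!: mult_nonneg_nonneg sum_nonneg)
qed

lemma n_powr_le: "\<forall>\<^sub>F n in sequentially. real n powr (1 - c1) \<le> real n * theta n \<and> 1 \<le> real n * min 1 (theta n)"
  using theta_lower eventually_gt_at_top[of 0]
proof eventually_elim
  case (elim n)
  have eq: "real n powr (1 - c1) = real n * real n powr (- c1)"
    using elim(2) by (simp add: powr_diff powr_minus field_simps)
  have 1: "real n powr (1 - c1) \<le> real n * theta n" unfolding eq using elim(1) by (intro mult_left_mono) auto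
  have "1 \<le> real n powr (1 - c1)" using elim(2) c1 by (intro ge_one_powr_ge_zero) auto
  then have "1 \<le> real n * theta n" using 1 by linarith
  then show ?case using 1 elim(2) by (simp add: min_def)
qed

lemma nt_at_top: "filterlim (\<lambda>n. real n * theta n) at_top sequentially"
proof (rule filterlim_at_top_mono)
  show "filterlim (\<lambda>n. real n powr (1 - c1)) at_top sequentially" using c1 by real_asymp
  show "\<forall>\<^sub>F n in sequentially. real n powr (1 - c1) \<le> real n * theta n"
    using n_powr_le by eventually_elim simp
qed

text \<open>The ratio is the rate that multiplies the remainder bounds in
  \<open>prob_not_good_le\<close>.\<close>

lemma ex_walk_length: "\<exists>N\<ge>2. (\<lambda>n. real n * (real n * theta n) / (real n * theta n) ^ N) \<longlonglongrightarrow> 0"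
proof -
  \<comment> \<open>The length is \<open>Suc m\<close>. By choice of \<open>m\<close>, the power
    \<open>(n * theta) ^ m\<close> is at least n^2, which leaves a rate of 1 / n.\<close>
  obtain m :: nat where m: "2 / (1 - c1) \<le> real m" using real_arch_simple by blast
  have m2: "2 \<le> (1 - c1) * real m" using m c1 by (simp add: field_simps)
  have m0: "0 < m" using m2 by (cases m) auto
  have "(\<lambda>n. real n * (real n * theta n) / (real n * theta n) ^ Suc m) \<longlonglongrightarrow> 0"
  proof (rule tendsto_sandwich[where f = "\<lambda>_. 0" and h = "\<lambda>n. 1 / real n"])
    show "\<forall>\<^sub>F n in sequentially. real n * (real n * theta n) / (real n * theta n) ^ Suc m \<le> 1 / real n"
      using n_powr_le eventually_gt_at_top[of 0]
    proof eventually_elim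
      case (elim n)
      let ?D = "real n * theta n"
      have D: "0 < ?D" using elim powr_gt_zero[of "real n" "1 - c1"] by linarith
      have "real n ^ 2 = real n powr 2" using elim by (simp add: powr_numeral)
      also have "\<dots> \<le> real n powr ((1 - c1) * real m)" using m2 elim by (intro powr_mono) auto
      also have "\<dots> = (real n powr (1 - c1)) ^ m" using elim by (simp add: powr_powr[symmetric] powr_realpow)
      also have "\<dots> \<le> ?D ^ m" using elim by (intro power_mono) auto
      finally have le: "real n ^ 2 \<le> ?D ^ m" .
      have "x * y / y ^ Suc m = x / y ^ m" if "0 < y" for x y :: real using that by simp
      from this[OF D] have "real n * ?D / ?D ^ Suc m = real n / ?D ^ m" .
      also have "\<dots> \<le> real n / real n ^ 2" using le elim D by (intro divide_left_mono) auto
      also have "\<dots> = 1 / real n" by (simp add: power2_eq_square)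
      finally show ?case .
    qed
    show "\<forall>\<^sub>F n in sequentially. 0 \<le> real n * (real n * theta n) / (real n * theta n) ^ Suc m"
      using n_powr_le
    proof eventually_elim
      case (elim n)
      have "0 \<le> real n * theta n" using elim powr_ge_zero[of "real n" "1 - c1"] by linarith
      then show ?case by simp
    qed
    show "(\<lambda>n. 1 / real n) \<longlonglongrightarrow> 0" by real_asymp
  qed auto
  then show ?thesis using m0 by (intro exI[of _ "Suc m"]) auto
qed

lemma eventually_row_difference:
  assumes e: "0 < e" and delta: "0 < delta"
  shows "\<exists>M'. \<forall>\<^sub>F n in sequentially. prb n (deviates e M' n) \<le> delta"
proof -
  obtain N where N: "2 \<le> N" and limN: "(\<lambda>n. real n * (real n * theta n) / (real n * theta n) ^ N) \<longlonglongrightarrow> 0"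
    using ex_walk_length by blast
  define C where "C = 6 / c\<^sup>2 + 28 * K / c ^ 3 + (2 * N * K + 2) * (2 / c) ^ N"
  have C: "0 < C" unfolding C_def using c by (intro add_pos_nonneg) auto
  define CN where "CN = real (N + 1) ^ (2 * N + 1)"
  \<comment> \<open>Solves \<open>2 * (K * (8 / (c0 ^ 4 * M\<^sup>2))) \<le> delta / 2\<close>, the
    contribution of the two rows to the nonvanishing part of the probability bound; the summand 1
    makes \<open>M\<close> positive.\<close>
  define M where "M = sqrt (32 * K / (c0 ^ 4 * delta)) + 1"
  have M: "0 < M" unfolding M_def using c0 delta by (intro add_nonneg_pos) auto
  have M2: "2 * (K * (8 / (c0 ^ 4 * M\<^sup>2))) \<le> delta / 2"
  proof -
    have "32 * K / (c0 ^ 4 * delta) = (sqrt (32 * K / (c0 ^ 4 * delta)))\<^sup>2" using c0 delta by simp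
    also have "\<dots> \<le> M\<^sup>2" unfolding M_def using c0 delta by (intro power_mono) auto
    finally have "32 * K \<le> M\<^sup>2 * (c0 ^ 4 * delta)" using c0 delta by (simp add: field_simps)
    then show ?thesis using c0 delta M by (simp add: field_simps)
  qed
  \<comment> \<open>The second bound turns the deterministic error
    \<open>C * eta * (1 + M + zeta)\<close> into \<open>e * (1 + zeta)\<close>; the first is the gap
    condition of the perturbation argument.\<close>
  define eta where "eta = min (c / 4) (e / (C * (1 + M)))"
  have eta: "0 < eta" using c e C M by (simp add: eta_def)
  have eta4: "eta \<le> c / 4" unfolding eta_def by (rule min.cobounded1)
  have Ce: "C * eta * (1 + M) \<le> e"
  proof -
    have "eta \<le> e / (C * (1 + M))" by (simp add: eta_def)
    then have "eta * (C * (1 + M)) \<le> e" using C M by (subst (asm) pos_le_divide_eq) auto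
    then show ?thesis by (simp add: mult_ac)
  qed
  have Ce': "C * eta * (1 + M + z) \<le> e * (1 + z)" if "0 \<le> z" for z
  proof -
    have "C * eta * 1 \<le> C * eta * (1 + M)" using C eta M by (intro mult_left_mono) auto
    then have "C * eta * z \<le> e * z" using Ce that by (intro mult_right_mono) auto
    then show ?thesis using Ce by (simp add: distrib_left)
  qed
  have "(\<lambda>n. CN / (eta\<^sup>2) ^ N * (real n * (real n * theta n) / (real n * theta n) ^ N)
      + 2 * (CN / eta\<^sup>2 * (real n * (real n * theta n) / (real n * theta n) ^ N)
       + K * (8 / (c0 ^ 4 * M\<^sup>2) + N * (CN / (c0 ^ 4 * eta\<^sup>2) * (1 / (real n * theta n))))))
     \<longlonglongrightarrow> CN / (eta\<^sup>2) ^ N * 0 + 2 * (CN / eta\<^sup>2 * 0 + K * (8 / (c0 ^ 4 * M\<^sup>2) + N * (CN / (c0 ^ 4 * eta\<^sup>2) * 0)))"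
    by (intro tendsto_intros limN tendsto_divide_0[OF tendsto_const] filterlim_at_top_imp_at_infinity nt_at_top)
  then have ev: "\<forall>\<^sub>F n in sequentially. CN / (eta\<^sup>2) ^ N * (real n * (real n * theta n) / (real n * theta n) ^ N)
      + 2 * (CN / eta\<^sup>2 * (real n * (real n * theta n) / (real n * theta n) ^ N)
       + K * (8 / (c0 ^ 4 * M\<^sup>2) + N * (CN / (c0 ^ 4 * eta\<^sup>2) * (1 / (real n * theta n))))) < delta"
    by (rule order_tendstoD(2)) (use M2 delta in simp)
  show ?thesis
  \<comment> \<open>Two rows contribute at most \<open>M * (n * theta)\<close> each at the scale,
    and the division by the eigenvalue gains \<open>c * (n * theta)\<close>.\<close>
  proof (intro exI[of _ "2 * M / c"])
    show "\<forall>\<^sub>F n in sequentially. prb n (deviates e (2 * M / c) n) \<le> delta"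
      using ev model n_powr_le low gap X_decomp zeta_nonneg
    proof eventually_elim
      case (elim n)
      interpret mm_pair n K "theta n" "Pim n" "P n" "V n" "d n" c0 i j loops by (rule elim(2))
      let ?W = "Wmat loops (Hmat K (theta n) (Pim n) (P n))"
      have Xi_eq: "Xi n s k = (mv n (?W s) (v k) i - mv n (?W s) (v k) j) / d n k" for s k
        using xi_eq_mv[of s k] unfolding xi_def Xi_def .
      have sub: "(deviates e (2 * M / c) n)
        \<subseteq> {s. \<not> good N eta M {i, j} (?W s)}"
      proof (rule subsetI, rule ccontr)
        fix s assume s: "s \<in> (deviates e (2 * M / c) n)"
          and "s \<notin> {s. \<not> good N eta M {i, j} (?W s)}"
        then have g: "good N eta M {i, j} (?W s)" by simp
        have *: "scal n * \<bar>DVh n s k - DV n k - Xi n s k\<bar> \<le> e * (1 + zeta n) \<and> scal n * \<bar>Xi n s k\<bar> \<le> 2 * M / c" if k: "k < K" for k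
        proof
          have dec: "ordered_eigdecomp n (Xobs loops s) (Vh n s) (dh n s)" using elim(6) by blast
          have sg: "0 \<le> ip n (v k) (Vh n s k)" using elim(6) k by (simp add: ip_def mult.commute)
          have XH: "Xobs loops s l m = Hmat K (theta n) (Pim n) (P n) l m + ?W s l m" for l m
            by (simp add: Wmat_def)
          have Xs: "Xobs loops s l m = Xobs loops s m l" for l m
            by (simp add: Xobs_def Xstar_def min.commute max.commute)
          have lo: "c * (real n * theta n) \<le> d n k" if "k < K" for k using elim(4) that by blast
          have ga: "d n b + c * (real n * theta n) \<le> d n a" if "a < b" "b < K" for a b using elim(5) that by blast
          note gi = good_imp_row_difference[OF XH Xs dec sg c(1,2) lo ga eta eta4 k N M ij g]
          have "scal n * \<bar>DVh n s k - DV n k - Xi n s k\<bar> \<le> C * eta * (1 + M + zeta n)"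
            unfolding Xi_eq scal_def zeta_def DVh_def DV_def C_def by (rule gi(1))
          also have "\<dots> \<le> e * (1 + zeta n)" using Ce' elim(7) by blast
          finally show "scal n * \<bar>DVh n s k - DV n k - Xi n s k\<bar> \<le> e * (1 + zeta n)" .
          have w: "scal n * \<bar>mv n (?W s) (v k) r\<bar> \<le> M * (real n * theta n)" if "r \<in> {i, j}" for r
            unfolding scal_def by (rule gi(2)) (use that k in auto)
          have dk: "c * (real n * theta n) \<le> d n k" "0 < c * (real n * theta n)" using elim(4) k c nt_pos by auto
          have "scal n * \<bar>Xi n s k\<bar> = scal n * \<bar>mv n (?W s) (v k) i - mv n (?W s) (v k) j\<bar> / d n k"
            unfolding Xi_eq using dk by (simp add: abs_divide)
          also have "\<dots> \<le> (2 * (M * (real n * theta n))) / d n k"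
          proof (rule divide_right_mono)
            have "scal n * \<bar>mv n (?W s) (v k) i - mv n (?W s) (v k) j\<bar> \<le> scal n * (\<bar>mv n (?W s) (v k) i\<bar> + \<bar>mv n (?W s) (v k) j\<bar>)"
              using elim(7) by (intro mult_left_mono) auto
            then show "scal n * \<bar>mv n (?W s) (v k) i - mv n (?W s) (v k) j\<bar> \<le> 2 * (M * (real n * theta n))"
              using w[of i] w[of j] by (simp add: distrib_left)
          qed (use dk in linarith)
          also have "\<dots> \<le> (2 * (M * (real n * theta n))) / (c * (real n * theta n))"
            using dk M nt_pos by (intro divide_left_mono) auto
          also have "\<dots> = 2 * M / c" using n0 theta_pos by simp
          finally show "scal n * \<bar>Xi n s k\<bar> \<le> 2 * M / c" .
        qed
        then show False using s unfolding deviates_def by blast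
      qed
      have "prb n (deviates e (2 * M / c) n)
         \<le> prb n {s. \<not> good N eta M {i, j} (?W s)}"
        by (rule measure_pmf.finite_measure_mono[OF sub]) simp
      also have "\<dots> \<le> CN / (eta\<^sup>2) ^ N * (real n * (real n * theta n) / (real n * theta n) ^ N) + card {i, j} * (CN / eta\<^sup>2 * (real n * (real n * theta n) / (real n * theta n) ^ N)
       + K * (8 / (c0 ^ 4 * M\<^sup>2) + N * (CN / (c0 ^ 4 * eta\<^sup>2 * (real n * theta n)))))"
        unfolding CN_def using H_le_1 elim(3) ij by (intro prob_not_good_le eta M) auto
      also have "\<dots> \<le> delta" using elim(1) ij_ne by simp
      finally show ?case .
    qed
  qed
qed

end

lemma square_sum_le_card_sum_squares:
  "(\<Sum>a<K. \<bar>x a\<bar>)\<^sup>2 \<le> real K * ip K x x" for x :: "nat \<Rightarrow> real"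
  using ip_Cauchy_Schwarz[of K "\<lambda>_. 1" "\<lambda>a. \<bar>x a\<bar>"] by (simp add: ip_def)

section \<open>Power against separated memberships and the limit law\<close>

context mm_sequence
begin

text \<open>The bias \<open>kappa\<close> of the n-th model, defined for every n because
  \<open>mm_pair\<close> is available only for large n.\<close>

definition kap :: "nat \<Rightarrow> nat \<Rightarrow> real" where
  "kap n a = of_bool (\<not> loops) * (Hn n i i * (V n i a / d n a) - Hn n j j * (V n j a / d n a))"

lemma Tstat_eq: "Tstat K (Sinv n) (Vh n s) i j = qform K (Sinv n) (DVh n s)"
  by (simp add: Tstat_def DVh_def[abs_def])

lemma qform_Sinv_lower:
  "\<forall>\<^sub>F n in sequentially. \<forall>x. (scal n)\<^sup>2 * ip K x x \<le> 4 / c0 ^ 4 * qform K (Sinv n) x"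
  using model Sinv_inv
proof eventually_elim
  case (elim n)
  interpret mm_pair n K "theta n" "Pim n" "P n" "V n" "d n" c0 i j loops by (rule elim(1))
  show ?case
  proof
    fix x
    let ?k = "4 / (c0 ^ 4 * (real n)\<^sup>2 * theta n)"
    have k: "0 < ?k" using c0 n0 theta_pos by simp
    have "ip K x x \<le> ?k * qform K (Sinv n) x"
      by (rule norm_sq_le_qform_inverse[OF S_sym S_psd S_upper _ k]) (use elim(2) in auto)
    then have "(scal n)\<^sup>2 * ip K x x \<le> (scal n)\<^sup>2 * (?k * qform K (Sinv n) x)" by (intro mult_left_mono) auto
    also have "\<dots> = ((scal n)\<^sup>2 * ?k) * qform K (Sinv n) x" by simp
    also have "(scal n)\<^sup>2 * ?k = 4 / c0 ^ 4"
      using n0 theta_pos by (simp add: scal_def power_mult_distrib)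
    finally show "(scal n)\<^sup>2 * ip K x x \<le> 4 / c0 ^ 4 * qform K (Sinv n) x" .
  qed
qed

text \<open>\<open>V_diff_lower\<close> carries the separation of the memberships over to the rows
  of \<open>V\<close>, and the sum of absolute values in \<open>zeta\<close> dominates the Euclidean
  norm.\<close>

lemma zeta_at_top:
  assumes "filterlim (\<lambda>n. sqrt (real n * theta n) * sqrt (\<Sum>k<K. (Pim n i k - Pim n j k)\<^sup>2)) at_top sequentially"
  shows "filterlim zeta at_top sequentially"
proof (rule filterlim_at_top_mono)
  show "filterlim (\<lambda>n. sqrt (c0 ^ 3) * (sqrt (real n * theta n) * sqrt (\<Sum>k<K. (Pim n i k - Pim n j k)\<^sup>2))) at_top sequentially"
    by (rule filterlim_tendsto_pos_mult_at_top[OF tendsto_const _ assms]) (use c0 in simp)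
  show "\<forall>\<^sub>F n in sequentially. sqrt (c0 ^ 3) * (sqrt (real n * theta n) * sqrt (\<Sum>k<K. (Pim n i k - Pim n j k)\<^sup>2)) \<le> zeta n"
    using model
  proof eventually_elim
    case (elim n)
    interpret mm_pair n K "theta n" "Pim n" "P n" "V n" "d n" c0 i j loops by (rule elim)
    let ?p = "\<Sum>k<K. (Pim n i k - Pim n j k)\<^sup>2" and ?q = "\<Sum>a<K. (DV n a)\<^sup>2"
    have le: "c0 ^ 3 * ?p \<le> real n * ?q" using V_diff_lower[OF ij] by (simp add: DV_def)
    have "sqrt (c0 ^ 3) * (sqrt (real n * theta n) * sqrt ?p) = sqrt (real n * theta n) * sqrt (c0 ^ 3 * ?p)"
      by (simp add: real_sqrt_mult)
    also have "\<dots> \<le> sqrt (real n * theta n) * sqrt (real n * ?q)"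
      using le nt_pos theta_pos by (intro mult_left_mono) auto
    also have "\<dots> = scal n * sqrt ?q"
    proof -
      have "sqrt (real n) * sqrt (real n) = real n" by simp
      then show ?thesis unfolding scal_def real_sqrt_mult by (metis (no_types, lifting) mult.assoc mult.commute)
    qed
    also have "\<dots> \<le> scal n * (\<Sum>a<K. \<bar>DV n a\<bar>)"
      using L2_set_le_sum_abs[of "DV n" "{..<K}"] theta_pos by (intro mult_left_mono) (auto simp: L2_set_def scal_def)
    finally show ?case by (simp add: zeta_def)
  qed
qed

text \<open>With tolerance 1 / (2 K) in each of K coordinates, the expansion error consumes at most
  half of \<open>zeta\<close>. Outside the exceptional event the empirical row difference is then at
  least \<open>zeta / 2\<close> minus a constant at the scale, whereas \<open>T \<le> C\<close>
  would keep it bounded.\<close>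

lemma power_tends_to_1:
  assumes "filterlim (\<lambda>n. sqrt (real n * theta n) * sqrt (\<Sum>k<K. (Pim n i k - Pim n j k)\<^sup>2)) at_top sequentially"
    and C: "0 < C"
  shows "(\<lambda>n. prb n {s. Tstat K (Sinv n) (Vh n s) i j > C}) \<longlonglongrightarrow> 1"
proof (rule LIMSEQ_I)
  fix r :: real assume r: "0 < r"
  have e: "0 < 1 / (2 * real K)" using K_pos by simp
  have "0 < r / 2" using r by simp
  from eventually_row_difference[OF e this] obtain M where
    M: "\<forall>\<^sub>F n in sequentially. prb n (deviates (1 / (2 * real K)) M n) \<le> r / 2"
    by blast
  \<comment> \<open>Value of \<open>zeta\<close> beyond which \<open>T \<le> C\<close> is impossible
    outside the exceptional event: half of it exceeds the constant part of the tolerance, the noise,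
    and the largest scaled row difference compatible with \<open>C\<close>.\<close>
  define B where "B = 2 * (1 / 2 + K * M + sqrt (K * (4 / c0 ^ 4 * C)))"
  have zB: "\<forall>\<^sub>F n in sequentially. B < zeta n"
    using zeta_at_top[OF assms(1)] by (simp add: filterlim_at_top_dense)
  have "\<forall>\<^sub>F n in sequentially. norm (prb n {s. Tstat K (Sinv n) (Vh n s) i j > C} - 1) < r"
    using M zB qform_Sinv_lower zeta_nonneg
  proof eventually_elim
    case (elim n)
    let ?bad = "(deviates (1 / (2 * real K)) M n)"
    let ?A = "{s. Tstat K (Sinv n) (Vh n s) i j > C}"
    have "UNIV - ?A \<subseteq> ?bad"
    proof (rule subsetI, rule ccontr)
      fix s assume s: "s \<in> UNIV - ?A" "s \<notin> ?bad"
      then have g: "scal n * \<bar>DVh n s k - DV n k - Xi n s k\<bar> \<le> 1 / (2 * real K) * (1 + zeta n)" "scal n * \<bar>Xi n s k\<bar> \<le> M" if "k < K" for k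
        using that by (auto simp: deviates_def)
      have T: "qform K (Sinv n) (DVh n s) \<le> C" using s(1) by (simp add: Tstat_eq not_less)
      have "zeta n = (\<Sum>k<K. scal n * \<bar>DV n k\<bar>)" by (simp add: zeta_def sum_distrib_left)
      also have "\<dots> \<le> (\<Sum>k<K. 1 / (2 * real K) * (1 + zeta n) + M + scal n * \<bar>DVh n s k\<bar>)"
      proof (rule sum_mono)
        fix k assume "k \<in> {..<K}"
        then have k: "k < K" by simp
        have "scal n * \<bar>DV n k\<bar> \<le> scal n * (\<bar>DVh n s k - DV n k - Xi n s k\<bar> + \<bar>Xi n s k\<bar> + \<bar>DVh n s k\<bar>)"
          using elim(4) by (intro mult_left_mono) auto
        then show "scal n * \<bar>DV n k\<bar> \<le> 1 / (2 * real K) * (1 + zeta n) + M + scal n * \<bar>DVh n s k\<bar>"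
          using g[OF k] by (simp only: distrib_left)
      qed
      also have "\<dots> = (1 + zeta n) / 2 + K * M + scal n * (\<Sum>k<K. \<bar>DVh n s k\<bar>)"
      proof -
        have "real K \<noteq> 0" using K_pos by simp
        then have "(\<Sum>k<K. 1 / (2 * real K) * (1 + zeta n)) = (1 + zeta n) / 2" by simp
        then show ?thesis unfolding sum.distrib sum_distrib_left[of "scal n"] by simp
      qed
      finally have z: "zeta n / 2 - 1 / 2 - K * M \<le> scal n * (\<Sum>k<K. \<bar>DVh n s k\<bar>)" by (simp add: add_divide_distrib)
      have "(scal n * (\<Sum>k<K. \<bar>DVh n s k\<bar>))\<^sup>2 = (scal n)\<^sup>2 * (\<Sum>k<K. \<bar>DVh n s k\<bar>)\<^sup>2" by (simp add: power_mult_distrib)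
      also have "\<dots> \<le> (scal n)\<^sup>2 * (real K * ip K (DVh n s) (DVh n s))"
        by (intro mult_left_mono square_sum_le_card_sum_squares) auto
      also have "\<dots> = real K * ((scal n)\<^sup>2 * ip K (DVh n s) (DVh n s))" by simp
      also have "\<dots> \<le> real K * (4 / c0 ^ 4 * qform K (Sinv n) (DVh n s))" using elim(3) by (intro mult_left_mono) auto
      also have "\<dots> \<le> real K * (4 / c0 ^ 4 * C)" using T c0 by (intro mult_left_mono) auto
      finally have "scal n * (\<Sum>k<K. \<bar>DVh n s k\<bar>) \<le> sqrt (K * (4 / c0 ^ 4 * C))" by (rule real_le_rsqrt)
      then show False using z elim(2) by (simp add: B_def)
    qed
    then have "prb n (UNIV - ?A) \<le> prb n ?bad" by (rule measure_pmf.finite_measure_mono) simp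
    then have "prb n (UNIV - ?A) \<le> r / 2" using elim(1) by linarith
    moreover have "prb n (UNIV - ?A) = 1 - prb n ?A"
      using measure_pmf.prob_compl[of ?A "edge_pmf n (Hn n)"] by simp
    moreover have "prb n ?A \<le> 1" by simp
    ultimately show ?case using r unfolding real_norm_def by linarith
  qed
  then show "\<exists>n0. \<forall>n\<ge>n0. norm (prb n {s. Tstat K (Sinv n) (Vh n s) i j > C} - 1) < r"
    by (simp add: eventually_sequentially)
qed

text \<open>Covers the null hypothesis, with \<open>DV\<close> eventually 0, and the local
  alternative. The lower eigenvalue bound keeps the whitening vectors within a multiple of n * sqrt
  theta, so errors negligible at the noise scale stay negligible after whitening; convergence of the
  noncentrality keeps \<open>zeta\<close> bounded.\<close>

lemma Tstat_weak_conv: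
  assumes C3: "0 < cc" "\<forall>\<^sub>F n in sequentially. \<forall>lam. is_eigval K (\<lambda>a b. (real n)\<^sup>2 * theta n * Sn n a b) lam \<longrightarrow> cc \<le> lam"
    and mu: "(\<lambda>n. qform K (Sinv n) (DV n)) \<longlonglongrightarrow> mu"
  shows "weak_conv_m (\<lambda>n. distr (measure_pmf (edge_pmf n (Hn n))) borel (\<lambda>s. Tstat K (Sinv n) (Vh n s) i j)) (chi_square K mu)"
proof -
  have S_low: "\<forall>\<^sub>F n in sequentially. 0 < scal n \<and> (\<forall>x. cc / (scal n)\<^sup>2 * ip K x x \<le> qform K (Sn n) x)"
    using C3(2) model
  proof eventually_elim
    case (elim n)
    interpret mm_pair n K "theta n" "Pim n" "P n" "V n" "d n" c0 i j loops by (rule elim(2))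
    let ?w = "(real n)\<^sup>2 * theta n"
    have w: "0 < ?w" "?w = (scal n)\<^sup>2" using n0 theta_pos by (auto simp: scal_def power_mult_distrib)
    \<comment> \<open>(C3) speaks of eigenvalues; the minimum of the Rayleigh quotient is one, which
      converts the condition into coercivity.\<close>
    obtain lam where lam: "is_eigval K (\<lambda>a b. ?w * Sn n a b) lam" "\<And>x. lam * ip K x x \<le> qform K (\<lambda>a b. ?w * Sn n a b) x"
      by (rule eigval_Rayleigh_min[OF K_pos, of "\<lambda>a b. ?w * Sn n a b"]) (auto simp: S_sym)
    have ccl: "cc \<le> lam" using elim(1) lam(1) by blast
    show ?case
    proof (intro conjI allI)
      show "0 < scal n" using n0 theta_pos by (simp add: scal_def)
      fix x
      have "cc * ip K x x \<le> lam * ip K x x" using ccl by (intro mult_right_mono) auto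
      also have "\<dots> \<le> ?w * qform K (Sn n) x" using lam(2)[of x] by (simp add: qform_def sum_distrib_left mult_ac)
      finally have "cc * ip K x x \<le> (scal n)\<^sup>2 * qform K (Sn n) x" unfolding w(2) .
      moreover have "0 < (scal n)\<^sup>2" using w by simp
      ultimately show "cc / (scal n)\<^sup>2 * ip K x x \<le> qform K (Sn n) x" by (simp add: field_simps)
    qed
  qed
  define basis where "basis = (\<lambda>n r. (\<forall>a<K. \<forall>b<K. bil K (Sn n) (r a) (r b) = of_bool (a = b)) \<and>
    (\<forall>a<K. ip K (r a) (DV n) = (if a = 0 then sqrt (qform K (Sinv n) (DV n)) else 0)) \<and>
    (\<forall>x. qform K (Sinv n) x = (\<Sum>a<K. (ip K (r a) x)\<^sup>2)))"
  \<comment> \<open>Whitening vectors exist only for large n, while the limit lemma wants a total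
    sequence; the values at small n are arbitrary.\<close>
  define r where "r = (\<lambda>n. SOME r. basis n r)"
  have basis_r: "\<forall>\<^sub>F n in sequentially. basis n (r n)"
    using S_low model Sinv_inv
  proof eventually_elim
    case (elim n)
    interpret mm_pair n K "theta n" "Pim n" "P n" "V n" "d n" c0 i j loops by (rule elim(2))
    have "0 < cc / (scal n)\<^sup>2" using elim(1) C3(1) by simp
    then obtain r' where "basis n r'"
      using whitening_basis[where K = K and S = "Sn n" and T = "Sinv n" and c = "cc / (scal n)\<^sup>2" and D = "DV n", OF K_pos S_sym] elim(1,3)
      unfolding basis_def by (smt (verit) of_bool_eq)
    then show ?case unfolding r_def by (rule someI[of "basis n"])
  qed
  \<comment> \<open>Adding \<open>kap\<close> removes the mean of the noise, so that
    \<open>Y\<close> is an exactly centred edge sum with identity covariance for large n.\<close>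
  define Y where "Y = (\<lambda>n k s. ip K (r n k) (\<lambda>a. Xi n s a + kap n a))"
  define A where "A = (\<lambda>n k s. ip K (r n k) (DVh n s))"
  define \<rho> where "\<rho> = (\<lambda>n. sqrt (qform K (Sinv n) (DV n)))"
  have r_bound: "\<forall>\<^sub>F n in sequentially. \<forall>k<K. \<forall>a<K. \<bar>r n k a\<bar> \<le> scal n / sqrt cc"
    using basis_r S_low
  proof eventually_elim
    case (elim n)
    show ?case
    proof (intro allI impI)
      fix k a assume k: "k < K" and a: "a < K"
      have "(r n k a)\<^sup>2 \<le> ip K (r n k) (r n k)" unfolding ip_def power2_eq_square
        by (rule member_le_sum[where f = "\<lambda>a. r n k a * r n k a"]) (use a in auto)
      then have "cc / (scal n)\<^sup>2 * (r n k a)\<^sup>2 \<le> cc / (scal n)\<^sup>2 * ip K (r n k) (r n k)"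
        using C3(1) by (intro mult_left_mono) auto
      also have "\<dots> \<le> qform K (Sn n) (r n k)" using elim(2) by blast
      also have "\<dots> = 1" using elim(1) k unfolding basis_def qform_eq_bil by simp
      finally have "cc / (scal n)\<^sup>2 * (r n k a)\<^sup>2 \<le> 1" .
      then have "\<bar>r n k a\<bar>\<^sup>2 \<le> (scal n / sqrt cc)\<^sup>2" using elim C3(1) by (simp add: field_simps power_divide)
      then show "\<bar>r n k a\<bar> \<le> scal n / sqrt cc" by (rule power2_le_imp_le) (use elim C3(1) in \<open>simp add: less_imp_le\<close>)
    qed
  qed
  have "weak_conv_m (\<lambda>n. distr (measure_pmf (edge_pmf n (Hn n))) borel (\<lambda>s. \<Sum>k<K. (A n k s)\<^sup>2)) (chi_square K mu)"
  proof (rule weak_conv_chi_square[where Y = Y and \<rho> = \<rho>])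
    show "\<rho> \<longlonglongrightarrow> sqrt mu" unfolding \<rho>_def by (intro tendsto_intros mu)
    show "1 \<le> K" by (rule K_pos)
    fix u :: "nat \<Rightarrow> real"
    define U where "U = (\<Sum>k<K. \<bar>u k\<bar>)"
    define C where "C = 2 * (K * (U / sqrt cc)) / c0 ^ 4"
    \<comment> \<open>Largest edge coefficient of the whitened combination, from
      \<open>abs_sum_alpha_le\<close> and the bound on the whitening vectors; it tends to 0 because
      n * theta diverges.\<close>
    define m where "m = (\<lambda>n. C * (1 / sqrt (real n * theta n)))"
    have m0: "m \<longlonglongrightarrow> C * 0"
      unfolding m_def
      by (intro tendsto_intros tendsto_divide_0[OF tendsto_const] filterlim_at_top_imp_at_infinity
          filterlim_compose[OF sqrt_at_top nt_at_top])
    have main: "\<forall>\<^sub>F n in sequentially. cmod ((\<integral>s. iexp (\<Sum>k<K. u k * Y n k s) \<partial>edge_pmf n (Hn n)) - of_real (exp (- (\<Sum>k<K. (u k)\<^sup>2) / 2)))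
       \<le> (m n + (m n)\<^sup>2) * (\<Sum>k<K. (u k)\<^sup>2)"
      using basis_r r_bound model S_low
    proof eventually_elim
      case (elim n)
      interpret mm_pair n K "theta n" "Pim n" "P n" "V n" "d n" c0 i j loops by (rule elim(3))
      define y where "y = (\<lambda>a. \<Sum>k<K. u k * r n k a)"
      define al where "al = (\<lambda>e. \<Sum>a<K. y a * alpha a e)"
      have Xi: "Xi n s a + kap n a = (\<Sum>e\<in>edges n. alpha a e * centred (Hn n) s e)" for s a
        using xi_eq[of s a] unfolding xi_def Xi_def kappa_def kap_def by simp
      have sumY: "(\<Sum>k<K. u k * Y n k s) = (\<Sum>e\<in>edges n. al e * (of_bool (s e) - Hn n (fst e) (snd e)))" for s
      proof -
        have "(\<Sum>k<K. u k * Y n k s) = ip K y (\<lambda>a. Xi n s a + kap n a)" unfolding Y_def y_def ip_sum_left ip_scale_left ..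
        also have "\<dots> = (\<Sum>a<K. \<Sum>e\<in>edges n. y a * alpha a e * centred (Hn n) s e)"
          unfolding Xi by (simp add: ip_def sum_distrib_left mult.assoc)
        also have "\<dots> = (\<Sum>e\<in>edges n. \<Sum>a<K. y a * alpha a e * centred (Hn n) s e)" by (rule sum.swap)
        also have "\<dots> = (\<Sum>e\<in>edges n. al e * (of_bool (s e) - Hn n (fst e) (snd e)))"
          by (simp add: al_def sum_distrib_right centred_def)
        finally show ?thesis .
      qed
      have var: "(\<Sum>e\<in>edges n. (al e)\<^sup>2 * (Hn n (fst e) (snd e) * (1 - Hn n (fst e) (snd e)))) = (\<Sum>k<K. (u k)\<^sup>2)"
      proof -
        have "(\<Sum>e\<in>edges n. (al e)\<^sup>2 * (Hn n (fst e) (snd e) * (1 - Hn n (fst e) (snd e)))) = bil K (Sn n) y y"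
          unfolding bil_S by (simp add: al_def edge_var_def power2_eq_square)
        also have "\<dots> = (\<Sum>k<K. u k * (\<Sum>l<K. u l * bil K (Sn n) (r n k) (r n l)))"
          unfolding y_def by (simp add: bil_linear)
        also have "\<dots> = (\<Sum>k<K. u k * (\<Sum>l<K. if l = k then u k else 0))"
          using elim(1) unfolding basis_def by (intro sum.cong refl arg_cong2[where f = "(*)"]) auto
        finally show ?thesis by (simp add: sum.delta power2_eq_square)
      qed
      have ysum: "(\<Sum>a<K. \<bar>y a\<bar>) \<le> K * (U * (scal n / sqrt cc))"
      proof -
        have "\<bar>y a\<bar> \<le> U * (scal n / sqrt cc)" if "a < K" for a
        proof -
          have "\<bar>y a\<bar> \<le> (\<Sum>k<K. \<bar>u k * r n k a\<bar>)" unfolding y_def by (rule sum_abs)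
          also have "\<dots> \<le> (\<Sum>k<K. \<bar>u k\<bar> * (scal n / sqrt cc))"
            unfolding abs_mult using elim(2) that by (intro sum_mono mult_left_mono) auto
          finally show ?thesis unfolding U_def sum_distrib_right .
        qed
        then have "(\<Sum>a<K. \<bar>y a\<bar>) \<le> (\<Sum>a<K. U * (scal n / sqrt cc))" by (intro sum_mono) auto
        then show ?thesis by simp
      qed
      have albound: "\<bar>al e\<bar> \<le> m n" if "e \<in> edges n" for e
      proof -
        have "\<bar>al e\<bar> \<le> 2 * (\<Sum>a<K. \<bar>y a\<bar>) / (c0 ^ 4 * sqrt (real n) * (real n * theta n))"
          unfolding al_def by (rule abs_sum_alpha_le[OF that])
        also have "\<dots> \<le> 2 * (K * (U * (scal n / sqrt cc))) / (c0 ^ 4 * sqrt (real n) * (real n * theta n))"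
          using ysum nt_pos theta_pos c0 by (intro divide_right_mono mult_left_mono) auto
        also have "\<dots> = C * (scal n / (sqrt (real n) * (real n * theta n)))" by (simp add: C_def)
        also have "scal n / (sqrt (real n) * (real n * theta n)) = 1 / sqrt (real n * theta n)"
        proof -
          have gen: "x * y / (z * (x * (y * y))) = 1 / (z * y)" if "x \<noteq> 0" "y \<noteq> 0" for x y z :: real
            using that by simp
          have "sqrt (theta n) * sqrt (theta n) = theta n" using theta_pos by simp
          then show ?thesis
            using gen[of "real n" "sqrt (theta n)" "sqrt (real n)"] n0 theta_pos by (simp add: scal_def real_sqrt_mult)
        qed
        finally show ?thesis by (simp add: m_def)
      qed
      show ?case
        using char_edge_sum_approx[where n = n and H = "Hn n" and a = al and m = "m n", OF edge_H albound]
        unfolding sumY var by (simp add: exp_of_real)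
    qed
    have "(\<lambda>n. (m n + (m n)\<^sup>2) * (\<Sum>k<K. (u k)\<^sup>2)) \<longlonglongrightarrow> (C * 0 + (C * 0)\<^sup>2) * (\<Sum>k<K. (u k)\<^sup>2)"
      by (intro tendsto_intros m0)
    then have "(\<lambda>n. (m n + (m n)\<^sup>2) * (\<Sum>k<K. (u k)\<^sup>2)) \<longlonglongrightarrow> 0" by simp
    from Lim_null_comparison[OF main this]
    show "(\<lambda>n. \<integral>s. iexp (\<Sum>k<K. u k * Y n k s) \<partial>edge_pmf n (Hn n)) \<longlonglongrightarrow> of_real (exp (- (\<Sum>k<K. (u k)\<^sup>2) / 2))"
      by (rule LIM_zero_cancel)
  next
    fix e :: real assume e: "0 < e"
    \<comment> \<open>The convergent noncentrality is eventually below
      \<open>\<bar>mu\<bar> + 1\<close>; through \<open>qform_Sinv_lower\<close> this bounds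
      \<open>zeta\<close>.\<close>
    define Z where "Z = sqrt (K * (4 / c0 ^ 4 * (\<bar>mu\<bar> + 1)))"
    have Z: "0 \<le> Z" using c0 by (simp add: Z_def)
    have zeta_le: "\<forall>\<^sub>F n in sequentially. zeta n \<le> Z"
    proof -
      have "\<forall>\<^sub>F n in sequentially. qform K (Sinv n) (DV n) < \<bar>mu\<bar> + 1"
        using mu by (rule order_tendstoD(2)) simp
      then show ?thesis using qform_Sinv_lower
      proof eventually_elim
        case (elim n)
        have "(zeta n)\<^sup>2 = (scal n)\<^sup>2 * (\<Sum>k<K. \<bar>DV n k\<bar>)\<^sup>2" by (simp add: zeta_def power_mult_distrib)
        also have "\<dots> \<le> (scal n)\<^sup>2 * (real K * ip K (DV n) (DV n))"
          by (intro mult_left_mono square_sum_le_card_sum_squares) auto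
        also have "\<dots> = real K * ((scal n)\<^sup>2 * ip K (DV n) (DV n))" by simp
        also have "\<dots> \<le> real K * (4 / c0 ^ 4 * qform K (Sinv n) (DV n))" using elim(2) by (intro mult_left_mono) auto
        also have "\<dots> \<le> real K * (4 / c0 ^ 4 * (\<bar>mu\<bar> + 1))" using elim(1) c0 by (intro mult_left_mono) auto
        finally show ?case unfolding Z_def by (rule real_le_rsqrt)
      qed
    qed
    \<comment> \<open>Makes the expansion error, over K coordinates and after whitening, exactly
      \<open>e / 2\<close>; the other half of \<open>e\<close> is left for the bias.\<close>
    define e' where "e' = e * sqrt cc / (2 * real K * (1 + Z))"
    have e': "0 < e'" using e C3(1) K_pos Z by (simp add: e'_def)
    have "(\<lambda>n. K / sqrt cc * (2 / c0 ^ 4 * (1 / sqrt (real n)))) \<longlonglongrightarrow> K / sqrt cc * (2 / c0 ^ 4 * 0)"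
      by (intro tendsto_intros tendsto_divide_0[OF tendsto_const] filterlim_at_top_imp_at_infinity
          filterlim_compose[OF sqrt_at_top filterlim_real_sequentially])
    then have ksmall: "\<forall>\<^sub>F n in sequentially. K / sqrt cc * (2 / c0 ^ 4 * (1 / sqrt (real n))) < e / 2"
      by (rule order_tendstoD(2)) (use e in simp)
    show "(\<lambda>n. prb n {s. \<exists>k<K. e < \<bar>A n k s - (Y n k s + (if k = 0 then \<rho> n else 0))\<bar>}) \<longlonglongrightarrow> 0"
    proof (rule LIMSEQ_I)
      fix dl :: real assume dl: "0 < dl"
      then have "0 < dl / 2" by simp
      from eventually_row_difference[OF e' this] obtain M where
        M: "\<forall>\<^sub>F n in sequentially. prb n (deviates e' M n) \<le> dl / 2"
        by blast
      have "\<forall>\<^sub>F n in sequentially. norm (prb n {s. \<exists>k<K. e < \<bar>A n k s - (Y n k s + (if k = 0 then \<rho> n else 0))\<bar>} - 0) < dl"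
        using M zeta_le ksmall basis_r r_bound model S_low
      proof eventually_elim
        case (elim n)
        interpret mm_pair n K "theta n" "Pim n" "P n" "V n" "d n" c0 i j loops by (rule elim(6))
        let ?bad = "(deviates e' M n)"
        let ?E = "{s. \<exists>k<K. e < \<bar>A n k s - (Y n k s + (if k = 0 then \<rho> n else 0))\<bar>}"
        have "?E \<subseteq> ?bad"
        proof (rule subsetI, rule ccontr)
          fix s assume s: "s \<in> ?E" "s \<notin> ?bad"
          then obtain k where k: "k < K" "e < \<bar>A n k s - (Y n k s + (if k = 0 then \<rho> n else 0))\<bar>" by blast
          have g: "scal n * \<bar>DVh n s a - DV n a - Xi n s a\<bar> \<le> e' * (1 + zeta n)" if "a < K" for a
            using s(2) that by (auto simp: deviates_def)
          have kp: "scal n * \<bar>kap n a\<bar> \<le> 2 / (c0 ^ 4 * sqrt (real n))" if "a < K" for a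
            using kappa_le[OF that] unfolding kappa_def kap_def scal_def .
          have sh: "(if k = 0 then \<rho> n else 0) = ip K (r n k) (DV n)"
            using elim(4) k(1) by (simp add: basis_def \<rho>_def)
          have "\<bar>A n k s - (Y n k s + (if k = 0 then \<rho> n else 0))\<bar> = \<bar>ip K (r n k) (\<lambda>a. DVh n s a - DV n a - Xi n s a - kap n a)\<bar>"
            unfolding sh A_def Y_def ip_diff_right ip_add_right by (simp add: algebra_simps)
          also have "\<dots> \<le> (\<Sum>a<K. \<bar>r n k a * (DVh n s a - DV n a - Xi n s a - kap n a)\<bar>)" unfolding ip_def by (rule sum_abs)
          also have "\<dots> \<le> (\<Sum>a<K. (1 / sqrt cc) * (e' * (1 + Z) + 2 / (c0 ^ 4 * sqrt (real n))))"
          proof (rule sum_mono)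
            fix a assume "a \<in> {..<K}"
            then have a: "a < K" by simp
            have "\<bar>r n k a * (DVh n s a - DV n a - Xi n s a - kap n a)\<bar> \<le> scal n / sqrt cc * (\<bar>DVh n s a - DV n a - Xi n s a\<bar> + \<bar>kap n a\<bar>)"
              unfolding abs_mult using elim(5) k(1) a elim(7) C3(1) by (intro mult_mono) auto
            also have "\<dots> = (1 / sqrt cc) * (scal n * \<bar>DVh n s a - DV n a - Xi n s a\<bar> + scal n * \<bar>kap n a\<bar>)"
              by (simp add: distrib_left)
            also have "\<dots> \<le> (1 / sqrt cc) * (e' * (1 + zeta n) + 2 / (c0 ^ 4 * sqrt (real n)))"
              using g[OF a] kp[OF a] C3(1) by (intro mult_left_mono add_mono) auto
            also have "\<dots> \<le> (1 / sqrt cc) * (e' * (1 + Z) + 2 / (c0 ^ 4 * sqrt (real n)))"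
              using elim(2) e' C3(1) by (intro mult_left_mono add_right_mono) auto
            finally show "\<bar>r n k a * (DVh n s a - DV n a - Xi n s a - kap n a)\<bar> \<le> (1 / sqrt cc) * (e' * (1 + Z) + 2 / (c0 ^ 4 * sqrt (real n)))" .
          qed
          also have "\<dots> = K / sqrt cc * (e' * (1 + Z)) + K / sqrt cc * (2 / c0 ^ 4 * (1 / sqrt (real n)))"
            by (simp add: distrib_left)
          also have "K / sqrt cc * (e' * (1 + Z)) = e / 2"
          proof -
            have gen: "k / s * (e * s / (2 * k * z) * z) = e / 2" if "k \<noteq> 0" "s \<noteq> 0" "z \<noteq> 0" for k s z :: real
              using that by simp
            show ?thesis unfolding e'_def by (rule gen) (use Z K_pos C3(1) in auto)
          qed
          finally show False using k(2) elim(3) by simp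
        qed
        then have "prb n ?E \<le> prb n ?bad" by (rule measure_pmf.finite_measure_mono) simp
        then have "prb n ?E \<le> dl / 2" using elim(1) by linarith
        then show ?case using dl by simp
      qed
      then show "\<exists>n0. \<forall>n\<ge>n0. norm (prb n {s. \<exists>k<K. e < \<bar>A n k s - (Y n k s + (if k = 0 then \<rho> n else 0))\<bar>} - 0) < dl"
        by (simp add: eventually_sequentially)
    qed
  qed simp
  then show ?thesis
  proof (rule weak_conv_m_eventually_cong)
    show "\<forall>\<^sub>F n in sequentially. distr (measure_pmf (edge_pmf n (Hn n))) borel (\<lambda>s. \<Sum>k<K. (A n k s)\<^sup>2)
       = distr (measure_pmf (edge_pmf n (Hn n))) borel (\<lambda>s. Tstat K (Sinv n) (Vh n s) i j)"
      using basis_r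
    proof eventually_elim
      case (elim n)
      then show ?case by (simp add: basis_def Tstat_eq A_def)
    qed
  qed
qed

end

section \<open>From the conditions to eventual bounds, and the three limit statements\<close>

theorem theorem1:
  fixes K :: nat and loops :: bool and i j :: nat
    and theta :: "nat \<Rightarrow> real"
    and Pim :: "nat \<Rightarrow> nat \<Rightarrow> nat \<Rightarrow> real"
    and P :: "nat \<Rightarrow> nat \<Rightarrow> nat \<Rightarrow> real"
    and V :: "nat \<Rightarrow> nat \<Rightarrow> nat \<Rightarrow> real" and d :: "nat \<Rightarrow> nat \<Rightarrow> real"
    and Vh :: "nat \<Rightarrow> sample \<Rightarrow> nat \<Rightarrow> nat \<Rightarrow> real" and dh :: "nat \<Rightarrow> sample \<Rightarrow> nat \<Rightarrow> real"
    and Sinv :: "nat \<Rightarrow> nat \<Rightarrow> nat \<Rightarrow> real"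
  assumes K_pos: "K \<ge> 1"
    and ij: "i \<noteq> j"
    and theta_pos: "\<forall>n. 0 < theta n"
    and Pi_prob: "\<forall>n l. l < n \<longrightarrow> (\<forall>k<K. 0 \<le> Pim n l k) \<and> (\<Sum>k<K. Pim n l k) = 1"
    and P_entries: "\<forall>n a b. a < K \<and> b < K \<longrightarrow> 0 \<le> P n a b \<and> P n a b \<le> 1 \<and> P n a b = P n b a"
    and P_nonsing: "\<forall>n v. (\<forall>a<K. (\<Sum>b<K. P n a b * v b) = 0) \<longrightarrow> (\<forall>b<K. v b = 0)"
    and H_le1: "\<forall>n l m. l < n \<and> m < n \<longrightarrow> Hmat K (theta n) (Pim n) (P n) l m \<le> 1"
    and H_decomp: "\<forall>\<^sub>F n in sequentially. H_eigdecomp n K (Hmat K (theta n) (Pim n) (P n)) (V n) (d n)"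
    and X_decomp: "\<forall>\<^sub>F n in sequentially. \<forall>s.
        ordered_eigdecomp n (Xobs loops s) (Vh n s) (dh n s) \<and>
        (\<forall>k<K. 0 \<le> (\<Sum>l<n. Vh n s k l * V n l k))"
    and Sinv_inv: "\<forall>\<^sub>F n in sequentially. \<forall>a<K. \<forall>b<K.
        (\<Sum>c<K. Sigma1 loops n (Hmat K (theta n) (Pim n) (P n)) (V n) (d n) i j a c * Sinv n c b)
          = (if a = b then 1 else 0)"
    and C1: "\<exists>c0>0. \<forall>\<^sub>F n in sequentially. \<forall>a b. a < b \<and> b < K \<and> d n a \<noteq> - d n b \<longrightarrow>
        1 + c0 \<le> \<bar>d n a\<bar> / \<bar>d n b\<bar>"
    and C1_alpha: "filterlim (\<lambda>n. alpha_n loops n (Hmat K (theta n) (Pim n) (P n))) at_top sequentially"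
    and C2: "\<exists>c0 c1. 0 < c0 \<and> c0 < 1 \<and> 0 < c1 \<and> c1 < 1 \<and> (\<forall>\<^sub>F n in sequentially.
        c0 * real n \<le> lambda_K K (\<lambda>a b. \<Sum>l<n. Pim n l a * Pim n l b) \<and>
        c0 \<le> lambda_K K (P n) \<and> real n powr (- c1) \<le> theta n)"
  shows
   "(((\<forall>n. i < n \<and> j < n \<longrightarrow> (\<forall>k<K. Pim n i k = Pim n j k)) \<and>
      (\<exists>c C. 0 < c \<and> c \<le> C \<and> (\<forall>\<^sub>F n in sequentially. \<forall>lam.
         is_eigval K (\<lambda>a b. (real n)\<^sup>2 * theta n *
            Sigma1 loops n (Hmat K (theta n) (Pim n) (P n)) (V n) (d n) i j a b) lam
         \<longrightarrow> c \<le> lam \<and> lam \<le> C)))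
     \<longrightarrow> weak_conv_m
           (\<lambda>n. distr (measure_pmf (edge_pmf n (Hmat K (theta n) (Pim n) (P n)))) borel
                   (\<lambda>s. Tstat K (Sinv n) (Vh n s) i j))
           (chi_square K 0))
    \<and>
    (filterlim (\<lambda>n. sqrt (real n * theta n) * sqrt (\<Sum>k<K. (Pim n i k - Pim n j k)\<^sup>2)) at_top sequentially
     \<longrightarrow> (\<forall>C>0. (\<lambda>n. measure_pmf.prob (edge_pmf n (Hmat K (theta n) (Pim n) (P n)))
                        {s. Tstat K (Sinv n) (Vh n s) i j > C}) \<longlonglongrightarrow> 1))
    \<and>
    (\<forall>mu. ((\<exists>c C. 0 < c \<and> c \<le> C \<and> (\<forall>\<^sub>F n in sequentially. \<forall>lam.
         is_eigval K (\<lambda>a b. (real n)\<^sup>2 * theta n *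
            Sigma1 loops n (Hmat K (theta n) (Pim n) (P n)) (V n) (d n) i j a b) lam
         \<longrightarrow> c \<le> lam \<and> lam \<le> C)) \<and>
       (\<exists>c C. 0 < c \<and> c \<le> C \<and> (\<forall>\<^sub>F n in sequentially.
          c / sqrt (real n * theta n) \<le> sqrt (\<Sum>k<K. (Pim n i k - Pim n j k)\<^sup>2) \<and>
          sqrt (\<Sum>k<K. (Pim n i k - Pim n j k)\<^sup>2) \<le> C / sqrt (real n * theta n))) \<and>
       (\<lambda>n. qform K (Sinv n) (\<lambda>a. V n i a - V n j a)) \<longlonglongrightarrow> mu)
     \<longrightarrow> weak_conv_m
           (\<lambda>n. distr (measure_pmf (edge_pmf n (Hmat K (theta n) (Pim n) (P n)))) borel
                   (\<lambda>s. Tstat K (Sinv n) (Vh n s) i j))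
           (chi_square K mu))"
proof -
  let ?H = "\<lambda>n. Hmat K (theta n) (Pim n) (P n)"
  from C2 obtain c0 c1 where c: "0 < c0" "c0 < 1" "0 < c1" "c1 < 1"
    and ev: "\<forall>\<^sub>F n in sequentially. c0 * real n \<le> lambda_K K (\<lambda>a b. \<Sum>l<n. Pim n l a * Pim n l b) \<and>
        c0 \<le> lambda_K K (P n) \<and> real n powr (- c1) \<le> theta n" by blast
  from C1 obtain cg where cg: "0 < cg" and evg: "\<forall>\<^sub>F n in sequentially. \<forall>a b. a < b \<and> b < K \<and> d n a \<noteq> - d n b \<longrightarrow>
        1 + cg \<le> \<bar>d n a\<bar> / \<bar>d n b\<bar>" by blast
  \<comment> \<open>One constant for two bounds: eigenvalues are at least
    \<open>c0\<^sup>2 * n * theta\<close>, and the ratio condition gives gaps of at least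
    \<open>cg * d n b\<close>, hence \<open>cg * c0\<^sup>2 * n * theta\<close>.\<close>
  define cc where "cc = c0\<^sup>2 * min 1 cg"
  have cc: "0 < cc" "cc \<le> 1" "cc \<le> c0\<^sup>2" "cc \<le> cg * c0\<^sup>2"
  proof -
    have c01: "0 < c0\<^sup>2" "c0\<^sup>2 \<le> 1" using c by (auto simp: power_le_one)
    show "0 < cc" using c01 cg by (simp add: cc_def)
    have "cc \<le> c0\<^sup>2 * 1" unfolding cc_def using c01 by (intro mult_left_mono) auto
    then show "cc \<le> c0\<^sup>2" "cc \<le> 1" using c01 by auto
    have "cc \<le> c0\<^sup>2 * cg" unfolding cc_def using c01 by (intro mult_left_mono) auto
    then show "cc \<le> cg * c0\<^sup>2" by (simp add: mult.commute)
  qed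
  have model: "\<forall>\<^sub>F n in sequentially. mm_pair n K (theta n) (Pim n) (P n) (V n) (d n) c0 i j"
    using ev H_decomp eventually_gt_at_top[of "max i j"]
  proof eventually_elim
    case (elim n)
    have P_coer: "c0 * ip K x x \<le> qform K (P n) x" for x
    proof -
      have "c0 * ip K x x \<le> lambda_K K (P n) * ip K x x" using elim(1) by (intro mult_right_mono) auto
      also have "\<dots> \<le> qform K (P n) x" by (rule lambda_K_le_qform[OF K_pos]) (use P_entries in blast)
      finally show ?thesis .
    qed
    have G_coer: "c0 * real n * ip K x x \<le> qform K (\<lambda>a b. \<Sum>l<n. Pim n l a * Pim n l b) x" for x
    proof -
      have "c0 * real n * ip K x x \<le> lambda_K K (\<lambda>a b. \<Sum>l<n. Pim n l a * Pim n l b) * ip K x x"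
        using elim(1) by (intro mult_right_mono) auto
      also have "\<dots> \<le> qform K (\<lambda>a b. \<Sum>l<n. Pim n l a * Pim n l b) x"
        by (rule lambda_K_le_qform[OF K_pos]) (simp add: mult.commute)
      finally show ?thesis .
    qed
    show ?case
    proof unfold_locales
      show "0 < theta n" using theta_pos by blast
      show "0 < c0" by (rule c)
      show "0 < n" using elim(3) by linarith
      show "0 \<le> Pim n l k" if "l < n" "k < K" for l k using Pi_prob that by blast
      show "(\<Sum>k<K. Pim n l k) = 1" if "l < n" for l using Pi_prob that by blast
      show "0 \<le> P n a b \<and> P n a b \<le> 1" if "a < K" "b < K" for a b using P_entries that by blast
      show "P n a b = P n b a" if "a < K" "b < K" for a b using P_entries that by blast
      show "H_eigdecomp n K (?H n) (V n) (d n)" by (rule elim(2))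
      show "i < n" "j < n" using elim(3) by auto
      show "?H n l m \<le> 1" if "l < n" "m < n" for l m using H_le1 that by blast
    qed (fact P_coer G_coer)+
  qed
  interpret mm_sequence K loops i j theta Pim P V d Vh dh Sinv c0 c1 cc
  proof unfold_locales
    show "\<forall>\<^sub>F n in sequentially. real n powr - c1 \<le> theta n" using ev by eventually_elim simp
    show "\<forall>\<^sub>F n in sequentially. \<forall>k<K. cc * (real n * theta n) \<le> d n k"
      using model
    proof eventually_elim
      case (elim n)
      interpret mm_pair n K "theta n" "Pim n" "P n" "V n" "d n" c0 i j loops by (rule elim)
      show ?case
      proof (intro allI impI)
        fix k assume k: "k < K"
        have "cc * (real n * theta n) \<le> c0\<^sup>2 * (real n * theta n)" using cc nt_pos by (intro mult_right_mono) auto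
        then show "cc * (real n * theta n) \<le> d n k" using d_lower[OF k] by linarith
      qed
    qed
    show "\<forall>\<^sub>F n in sequentially. \<forall>a b. a < b \<longrightarrow> b < K \<longrightarrow> d n b + cc * (real n * theta n) \<le> d n a"
      using model evg
    proof eventually_elim
      case (elim n)
      interpret mm_pair n K "theta n" "Pim n" "P n" "V n" "d n" c0 i j loops by (rule elim(1))
      show ?case
      proof (intro allI impI)
        fix a b assume ab: "a < b" "b < K"
        have pos: "0 < d n a" "0 < d n b" using d_pos ab by auto
        \<comment> \<open>Both eigenvalues are positive, so they are not opposite to each other and
          the ratio condition of (C1) speaks about this pair.\<close>
        then have "1 + cg \<le> d n a / d n b" using elim(2) ab by fastforce
        then have "(1 + cg) * d n b \<le> d n a" using pos by (simp add: field_simps)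
        moreover have "cg * (c0\<^sup>2 * (real n * theta n)) \<le> cg * d n b" using d_lower[OF ab(2)] cg by (intro mult_left_mono) auto
        moreover have "cc * (real n * theta n) \<le> (cg * c0\<^sup>2) * (real n * theta n)" using cc nt_pos by (intro mult_right_mono) auto
        ultimately show "d n b + cc * (real n * theta n) \<le> d n a" by (simp add: algebra_simps)
      qed
    qed
  qed (fact K_pos ij model c cc X_decomp Sinv_inv)+
  show ?thesis
  proof (intro conjI impI allI, goal_cases)
    case H0: 1
    then obtain c' C' where c': "0 < c'" and e: "\<forall>\<^sub>F n in sequentially. \<forall>lam. is_eigval K (\<lambda>a b. (real n)\<^sup>2 * theta n * Sn n a b) lam \<longrightarrow> c' \<le> lam \<and> lam \<le> C'"
      by blast
    have e': "\<forall>\<^sub>F n in sequentially. \<forall>lam. is_eigval K (\<lambda>a b. (real n)\<^sup>2 * theta n * Sn n a b) lam \<longrightarrow> c' \<le> lam"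
      using e by (rule eventually_mono) blast
    \<comment> \<open>Equal memberships give equal rows of H, hence equal rows of \<open>V\<close>:
      the noncentrality is exactly 0 for large n.\<close>
    have "\<forall>\<^sub>F n in sequentially. 0 = qform K (Sinv n) (DV n)"
      using model
    proof eventually_elim
      case (elim n)
      interpret mm_pair n K "theta n" "Pim n" "P n" "V n" "d n" c0 i j loops by (rule elim)
      have "DV n a = 0" if "a < K" for a
        using V_eq_of_Pi_eq[OF ij that] H0 ij unfolding DV_def by fastforce
      then show ?case by (simp add: qform_def)
    qed
    then have "(\<lambda>n. qform K (Sinv n) (DV n)) \<longlonglongrightarrow> 0" by (rule Lim_transform_eventually[OF tendsto_const])
    then show ?case by (rule Tstat_weak_conv[OF c' e'])
  next
    case (2 C)
    then show ?case by (rule power_tends_to_1)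
  next
    case H1: (3 mu)
    then obtain c' C' where c': "0 < c'" and e: "\<forall>\<^sub>F n in sequentially. \<forall>lam. is_eigval K (\<lambda>a b. (real n)\<^sup>2 * theta n * Sn n a b) lam \<longrightarrow> c' \<le> lam \<and> lam \<le> C'"
      by blast
    have e': "\<forall>\<^sub>F n in sequentially. \<forall>lam. is_eigval K (\<lambda>a b. (real n)\<^sup>2 * theta n * Sn n a b) lam \<longrightarrow> c' \<le> lam"
      using e by (rule eventually_mono) blast
    have "(\<lambda>n. qform K (Sinv n) (DV n)) \<longlonglongrightarrow> mu" using H1 by (simp add: DV_def[abs_def])
    then show ?case by (rule Tstat_weak_conv[OF c' e'])
  qed
qed

end
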